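(* Let $G\subseteq \mathrm{SL}_2(\mathbb{R})$ be a group and $H$ a finite index subgroup with $-I\in H$ such that the images $\bar H,\bar G$ in $\mathrm{PSL}_2(\mathbb{R})$ are Fuchsian groups of the first kind. Let $\rho:H\to\mathrm{GL}_m(\mathbb{C})$ be a (logarithmic) finite dimensional representation, $\widetilde\rho=\mathrm{Ind}_H^G(\rho)$, and $k$ an integer. Then there is an $R_G$-module isomorphism between the following spaces: (i) $M^!_k(\rho)$ and $M^!_k(\widetilde\rho)$; (ii) $M_{0,\mathrm{hol}}(\rho)$ and $M_{0,\mathrm{hol}}(\widetilde\rho)$; (iii) $M_{0,\mathrm{cusp}}(\rho)$ and $M_{0,\mathrm{cusp}}(\widetilde\rho)$.
   Context: **Groups and cusps.** $\mathbb{H}$ is the upper half plane; matrices act by Möbius transformations. A Fuchsian group of the first kind is a discrete subgroup of $\mathrm{PSL}_2(\mathbb{R})$ whose quotient of $\mathbb{H}$ is a Riemann surface with finitely many punctures and which has a fundamental domain of finite area. Parabolic means trace $\pm2$; cusps are points of $\mathbb{R}\cup\{\infty\}$ fixed by a nontrivial parabolic element of the group. $A_{\mathfrak{c}}=\begin{pmatrix}\mathfrak{c}&-1\\1&0\end{pmatrix}$ for $\mathfrak{c}\ne\infty$, $A_\infty=I$; the cusp width $h_{\mathfrak{c}}>0$ is such that the stabilizer of $\mathfrak{c}$ in the image of the group in $\mathrm{PSL}_2(\mathbb{R})$ is generated by the image of $t_{\mathfrak{c}}=A_{\mathfrak{c}}\begin{pmatrix}1&h_{\mathfrak{c}}\\0&1\end{pmatrix}A_{\mathfrak{c}}^{-1}$.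 Put $\log\widetilde q_{\mathfrak{c}}=2\pi iA_{\mathfrak{c}}^{-1}\tau/h_{\mathfrak{c}}$, $\widetilde q_{\mathfrak{c}}=e^{\log\widetilde q_{\mathfrak{c}}}$. **Logarithmic vvafs.** $\mathbb{X}|_k\gamma(\tau)=(c\tau+d)^{-k}\mathbb{X}(\gamma\tau)$. A representation is logarithmic if at all parabolic elements its values have only eigenvalues of absolute value 1 and at some parabolic element its value is not diagonalizable. A weakly holomorphic logarithmic vvaf of weight $k$ associated to a logarithmic $\rho$ (with $\rho(I)=e^{i\pi k}\rho(-I)$) is a holomorphic $\mathbb{X}:\mathbb{H}\to\mathbb{C}^m$ with $\mathbb{X}|_k\gamma=\rho(\gamma)\mathbb{X}$ for all group elements $\gamma$ and at every cusp $\mathfrak{c}$ an expansion $\mathbb{X}(\tau)=\epsilon_{\mathfrak{c}}(\tau)\sum_\lambda\sum_{j=0}^{m(\lambda)-1}(\log\widetilde q_{\mathfrak{c}})^j\widetilde q_{\mathfrak{c}}^{\,\mu(\lambda)}\sum_{n\ge-M_{\mathfrak{c}}}\mathbb{X}^{\mathfrak{c}}[\lambda,j,n]\widetilde q_{\mathfrak{c}}^{\,n}$ with $M_{\mathfrak{c}}$ finite, where $\epsilon_\infty=1$, $\epsilon_{\mathfrak{c}}(\tau)=(\tau-\mathfrak{c})^{-k}$ for $\mathfrak{c}\neq\infty$, $\lambda$ runs over the eigenvalues of $\rho(t_{\mathfrak{c}})$ attached to Jordan blocks, $m(\lambda)$ is the block size, $\lambda=e^{2\pi i\mu(\lambda)}$,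 $0\le\mu(\lambda)<1$. It is holomorphic if $M_{\mathfrak{c}}\le0$ for all cusps, and a cusp form if $M_{\mathfrak{c}}<0$ for all cusps. **Spaces.** $M^!_k(\rho)$, $M_{k,\mathrm{hol}}(\rho)$, $M_{k,\mathrm{cusp}}(\rho)$ are respectively the sets of weakly holomorphic logarithmic vvafs, holomorphic logarithmic vvafs, and logarithmic vector-valued cusp forms of weight $k$ associated to $\rho$ (and likewise for $\widetilde\rho$ and $G$). $R_G$ is the ring of weakly holomorphic scalar-valued automorphic forms associated with $G$, acting by multiplication $(f,\mathbb{X})\mapsto f\mathbb{X}$. $\widetilde\rho(\gamma)$ is the block matrix with $(a,b)$ block $\rho(\gamma_a^{-1}\gamma\gamma_b)$ (zero if this element is not in $H$), for representatives $\gamma_1,\dots,\gamma_d$ of $G/H$.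
   Formalization: In (iii) "cusp form" means all exponents μ(λ)+n are positive, not n≥1 (with n≥1 the claim fails). In (ii),(iii) the spaces are not stable under R_G, so the isomorphism is one of abelian groups that respects multiplication by f in R_G whenever the product stays in the space. *)

theory Defs
  imports
    "HOL-Complex_Analysis.Complex_Analysis"
    "HOL-Algebra.Generated_Groups"
    "HOL-Algebra.Left_Coset"
    "Jordan_Normal_Form.Jordan_Normal_Form"
    "Jordan_Normal_Form.VS_Connect"
begin

(* Elements of SL_2(R) are Analysis matrices (real^2^2, entries written $h), so that the topology
   comes from the library; representations take values in Jordan_Normal_Form matrices. *)
unbundle no vec_syntax
notation vec_nth (infixl "$h" 90)

section \<open>The groups SL_2(R), PSL_2(R) and their actions\<close>

definition mat22 :: "real \<Rightarrow> real \<Rightarrow> real \<Rightarrow> real \<Rightarrow> real^2^2" where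
  "mat22 a b c d = vector [vector [a, b], vector [c, d]]"

abbreviation id22 :: "real^2^2" where
  "id22 \<equiv> Finite_Cartesian_Product.mat 1"

definition SL2R :: "(real^2^2) monoid" where
  "SL2R = \<lparr>carrier = {A. Determinants.det A = 1}, mult = (**), one = id22\<rparr>"

definition PSL2R :: "(real^2^2) set monoid" where
  "PSL2R = SL2R Mod {id22, - id22}"

definition to_PSL :: "real^2^2 \<Rightarrow> (real^2^2) set" where
  "to_PSL A = {id22, - id22} #>\<^bsub>SL2R\<^esub> A"

definition upper_half :: "complex set" where
  "upper_half = {\<tau>. Im \<tau> > 0}"

definition moebius :: "real^2^2 \<Rightarrow> complex \<Rightarrow> complex" where
  "moebius A \<tau> = (of_real (A $h 1 $h 1) * \<tau> + of_real (A $h 1 $h 2)) /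
                 (of_real (A $h 2 $h 1) * \<tau> + of_real (A $h 2 $h 2))"

(* The boundary R + {infinity} is modelled by "real option", None being the point infinity. *)
fun moebius_bd :: "real^2^2 \<Rightarrow> real option \<Rightarrow> real option" where
  "moebius_bd A None =
     (if A $h 2 $h 1 = 0 then None else Some (A $h 1 $h 1 / A $h 2 $h 1))"
| "moebius_bd A (Some x) =
     (if A $h 2 $h 1 * x + A $h 2 $h 2 = 0 then None
      else Some ((A $h 1 $h 1 * x + A $h 1 $h 2) / (A $h 2 $h 1 * x + A $h 2 $h 2)))"


section \<open>Fuchsian groups of the first kind\<close>

definition quotient_topology :: "'a topology \<Rightarrow> ('a \<Rightarrow> 'b) \<Rightarrow> 'b topology" where
  "quotient_topology X f =
     topology (\<lambda>U. U \<subseteq> f ` topspace X \<and> openin X {x \<in> topspace X. f x \<in> U})"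

lemma openin_quotient_topology:
  "openin (quotient_topology X f) U \<longleftrightarrow>
     U \<subseteq> f ` topspace X \<and> openin X {x \<in> topspace X. f x \<in> U}"
proof -
  have Int: "{x \<in> topspace X. f x \<in> S \<inter> T} =
      {x \<in> topspace X. f x \<in> S} \<inter> {x \<in> topspace X. f x \<in> T}" for S T
    by blast
  have Un: "{x \<in> topspace X. f x \<in> \<Union>\<K>} =
      \<Union> ((\<lambda>K. {x \<in> topspace X. f x \<in> K}) ` \<K>)" for \<K>
    by blast
  have "istopology (\<lambda>U. U \<subseteq> f ` topspace X \<and> openin X {x \<in> topspace X. f x \<in> U})"
    unfolding istopology_def Int Un
    by (intro conjI allI impI openin_Int openin_Union) blast+
  then show ?thesis
    unfolding quotient_topology_def by (simp only: topology_inverse')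
qed

lemma topspace_quotient_topology: "topspace (quotient_topology X f) = f ` topspace X"
proof (rule subset_antisym)
  show "topspace (quotient_topology X f) \<subseteq> f ` topspace X"
    using openin_quotient_topology[of X f] openin_topspace by blast
  have "{x \<in> topspace X. f x \<in> f ` topspace X} = topspace X"
    by blast
  then have "openin (quotient_topology X f) (f ` topspace X)"
    by (simp only: openin_quotient_topology openin_topspace subset_refl conj_absorb)
  then show "f ` topspace X \<subseteq> topspace (quotient_topology X f)"
    by (rule openin_subset)
qed

lemma quotient_map_quotient_topology: "quotient_map X (quotient_topology X f) f"
  unfolding quotient_map_def openin_quotient_topology topspace_quotient_topology by blast

definition PSL2R_topology :: "(real^2^2) set topology" where
  "PSL2R_topology = quotient_topology (top_of_set (carrier SL2R)) to_PSL"

(* A subgroup \<Gamma> of PSL_2(R) is a set of cosets, so \<Union>\<Gamma> is its full preimage in SL_2(R). *)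
definition orbit :: "(real^2^2) set set \<Rightarrow> complex \<Rightarrow> complex set" where
  "orbit \<Gamma> \<tau> = (\<lambda>A. moebius A \<tau>) ` (\<Union>\<Gamma>)"

definition orbit_space :: "(real^2^2) set set \<Rightarrow> complex set topology" where
  "orbit_space \<Gamma> = quotient_topology (top_of_set upper_half) (orbit \<Gamma>)"

definition riemann_surface :: "'a topology \<Rightarrow> ('a set \<times> ('a \<Rightarrow> complex)) set \<Rightarrow> bool" where
  "riemann_surface Y At \<longleftrightarrow>
     connected_space Y \<and> Hausdorff_space Y \<and> \<Union>(fst ` At) = topspace Y \<and>
     (\<forall>(U, \<phi>) \<in> At. openin Y U \<and> open (\<phi> ` U) \<and>
        homeomorphic_map (subtopology Y U) (top_of_set (\<phi> ` U)) \<phi>) \<and>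
     (\<forall>(U, \<phi>) \<in> At. \<forall>(V, \<psi>) \<in> At. (\<psi> \<circ> inv_into U \<phi>) holomorphic_on \<phi> ` (U \<inter> V))"

(* The orbit space is a compact Riemann surface minus a finite set; holomorphy of the projection
   makes the complex structure the one induced from the upper half plane. The points of the
   compactification can be taken in the type complex set for reasons of cardinality. *)
definition finitely_punctured_quotient :: "(real^2^2) set set \<Rightarrow> bool" where
  "finitely_punctured_quotient \<Gamma> \<longleftrightarrow>
     (\<exists>(Y :: complex set topology) At P \<iota>.
        riemann_surface Y At \<and> compact_space Y \<and> finite P \<and> P \<subseteq> topspace Y \<and>
        homeomorphic_map (orbit_space \<Gamma>) (subtopology Y (topspace Y - P)) \<iota> \<and>
        (\<forall>(U, \<phi>) \<in> At. (\<lambda>\<tau>. \<phi> (\<iota> (orbit \<Gamma> \<tau>))) holomorphic_on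
           {\<tau> \<in> upper_half. \<iota> (orbit \<Gamma> \<tau>) \<in> U}))"

definition fundamental_domain :: "(real^2^2) set set \<Rightarrow> complex set \<Rightarrow> bool" where
  "fundamental_domain \<Gamma> D \<longleftrightarrow>
     D \<subseteq> upper_half \<and> interior D \<noteq> {} \<and> D = closure (interior D) \<inter> upper_half \<and>
     (\<Union>A\<in>\<Union>\<Gamma>. moebius A ` D) = upper_half \<and>
     (\<forall>A\<in>\<Union>\<Gamma> - {id22, - id22}. interior D \<inter> moebius A ` interior D = {})"

definition hyperbolic_area :: "complex set \<Rightarrow> ennreal" where
  "hyperbolic_area D = (\<integral>\<^sup>+\<tau>\<in>D. ennreal (1 / (Im \<tau>)\<^sup>2) \<partial>lborel)"

definition fuchsian_first_kind :: "(real^2^2) set set \<Rightarrow> bool" where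
  "fuchsian_first_kind \<Gamma> \<longleftrightarrow>
     subgroup \<Gamma> PSL2R \<and>
     subtopology PSL2R_topology \<Gamma> = discrete_topology \<Gamma> \<and>
     finitely_punctured_quotient \<Gamma> \<and>
     (\<exists>D. fundamental_domain \<Gamma> D \<and> hyperbolic_area D < \<infinity>)"


section \<open>Cusps\<close>

definition parabolic :: "real^2^2 \<Rightarrow> bool" where
  "parabolic A \<longleftrightarrow> Determinants.trace A = 2 \<or> Determinants.trace A = - 2"

definition cusps :: "(real^2^2) set \<Rightarrow> real option set" where
  "cusps G = {\<cc>. \<exists>A\<in>G. parabolic A \<and> A \<noteq> id22 \<and> A \<noteq> - id22 \<and> moebius_bd A \<cc> = \<cc>}"

fun cusp_mat :: "real option \<Rightarrow> real^2^2" where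
  "cusp_mat None = id22"
| "cusp_mat (Some x) = mat22 x (- 1) 1 0"

definition cusp_translation :: "real option \<Rightarrow> real \<Rightarrow> real^2^2" where
  "cusp_translation \<cc> h = cusp_mat \<cc> ** mat22 1 h 0 1 ** inv\<^bsub>SL2R\<^esub> (cusp_mat \<cc>)"

definition cusp_width :: "(real^2^2) set \<Rightarrow> real option \<Rightarrow> real" where
  "cusp_width G \<cc> = (THE h. h > 0 \<and>
     to_PSL ` {A \<in> G. moebius_bd A \<cc> = \<cc>} = generate PSL2R {to_PSL (cusp_translation \<cc> h)})"

definition cusp_gen :: "(real^2^2) set \<Rightarrow> real option \<Rightarrow> real^2^2" where
  "cusp_gen G \<cc> = cusp_translation \<cc> (cusp_width G \<cc>)"

definition log_q :: "(real^2^2) set \<Rightarrow> real option \<Rightarrow> complex \<Rightarrow> complex" where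
  "log_q G \<cc> \<tau> =
     2 * of_real pi * \<i> * moebius (inv\<^bsub>SL2R\<^esub> (cusp_mat \<cc>)) \<tau> / of_real (cusp_width G \<cc>)"

definition loc_q :: "(real^2^2) set \<Rightarrow> real option \<Rightarrow> complex \<Rightarrow> complex" where
  "loc_q G \<cc> \<tau> = exp (log_q G \<cc> \<tau>)"

fun cusp_factor :: "int \<Rightarrow> real option \<Rightarrow> complex \<Rightarrow> complex" where
  "cusp_factor k None \<tau> = 1"
| "cusp_factor k (Some x) \<tau> = (\<tau> - of_real x) powi (- k)"


section \<open>Representations\<close>

type_synonym rep = "real^2^2 \<Rightarrow> complex mat"

definition GL :: "nat \<Rightarrow> complex mat monoid" where
  "GL m = units_of (ring_mat TYPE(complex) m ())"

definition representation :: "(real^2^2) set \<Rightarrow> nat \<Rightarrow> rep \<Rightarrow> bool" where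
  "representation G m \<rho> \<longleftrightarrow> \<rho> \<in> hom (SL2R\<lparr>carrier := G\<rparr>) (GL m)"

definition diagonalizable :: "complex mat \<Rightarrow> bool" where
  "diagonalizable A \<longleftrightarrow> (\<exists>D. diagonal_mat D \<and> similar_mat A D)"

definition unimodular_at_parabolics :: "(real^2^2) set \<Rightarrow> rep \<Rightarrow> bool" where
  "unimodular_at_parabolics G \<rho> \<longleftrightarrow>
     (\<forall>A\<in>G. parabolic A \<longrightarrow> (\<forall>l. eigenvalue (\<rho> A) l \<longrightarrow> cmod l = 1))"

definition logarithmic_rep :: "(real^2^2) set \<Rightarrow> rep \<Rightarrow> bool" where
  "logarithmic_rep G \<rho> \<longleftrightarrow>
     unimodular_at_parabolics G \<rho> \<and> (\<exists>A\<in>G. parabolic A \<and> \<not> diagonalizable (\<rho> A))"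

(* the complementary case, in which only blocks of size 1 (no logarithms) occur at the cusps *)
definition admissible_rep :: "(real^2^2) set \<Rightarrow> rep \<Rightarrow> bool" where
  "admissible_rep G \<rho> \<longleftrightarrow>
     unimodular_at_parabolics G \<rho> \<and> (\<forall>A\<in>G. parabolic A \<longrightarrow> diagonalizable (\<rho> A))"

definition weight_compatible :: "int \<Rightarrow> rep \<Rightarrow> bool" where
  "weight_compatible k \<rho> \<longleftrightarrow>
     \<rho> id22 = exp (\<i> * of_real pi * of_int k) \<cdot>\<^sub>m \<rho> (- id22)"

definition left_transversal ::
  "(real^2^2) set \<Rightarrow> (real^2^2) set \<Rightarrow> nat \<Rightarrow> (nat \<Rightarrow> real^2^2) \<Rightarrow> bool" where
  "left_transversal G H d \<gamma> \<longleftrightarrow>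
     (\<forall>a<d. \<gamma> a \<in> G) \<and>
     bij_betw (\<lambda>a. \<gamma> a <#\<^bsub>SL2R\<^esub> H) {..<d} (lcosets\<^bsub>SL2R\<lparr>carrier := G\<rparr>\<^esub> H)"

definition induced_rep ::
  "(real^2^2) set \<Rightarrow> nat \<Rightarrow> nat \<Rightarrow> (nat \<Rightarrow> real^2^2) \<Rightarrow> rep \<Rightarrow> rep" where
  "induced_rep H m d \<gamma> \<rho> A = Matrix.mat (d * m) (d * m) (\<lambda>(r, s).
     let B = inv\<^bsub>SL2R\<^esub> (\<gamma> (r div m)) ** A ** \<gamma> (s div m)
     in if B \<in> H then \<rho> B $$ (r mod m, s mod m) else 0)"


section \<open>Vector-valued automorphic forms\<close>

definition slash ::
  "int \<Rightarrow> (complex \<Rightarrow> complex Matrix.vec) \<Rightarrow> real^2^2 \<Rightarrow> complex \<Rightarrow> complex Matrix.vec" where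
  "slash k X A \<tau> =
     (of_real (A $h 2 $h 1) * \<tau> + of_real (A $h 2 $h 2)) powi (- k) \<cdot>\<^sub>v X (moebius A \<tau>)"

definition mu :: "complex \<Rightarrow> real" where
  "mu l = (THE \<mu>. 0 \<le> \<mu> \<and> \<mu> < 1 \<and> l = exp (2 * of_real pi * \<i> * of_real \<mu>))"

(* bs lists the pairs (block size, eigenvalue) of a Jordan normal form of \<rho> at the generator of the
   cusp stabilizer; C i j n is the coefficient vector attached to the i-th block, to the j-th power
   of log q and to the n-th power of q; the sum runs over n \<ge> -M. *)
definition log_expansion ::
  "(real^2^2) set \<Rightarrow> nat \<Rightarrow> int \<Rightarrow> rep \<Rightarrow> (complex \<Rightarrow> complex Matrix.vec) \<Rightarrow> real option \<Rightarrow>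
   int \<Rightarrow> (nat \<times> complex) list \<Rightarrow> (nat \<Rightarrow> nat \<Rightarrow> int \<Rightarrow> complex Matrix.vec) \<Rightarrow> bool" where
  "log_expansion G m k \<rho> X \<cc> M bs C \<longleftrightarrow>
     jordan_nf (\<rho> (cusp_gen G \<cc>)) bs \<and>
     (\<forall>i j n. C i j n \<in> carrier_vec m) \<and>
     (\<forall>\<tau>\<in>upper_half. \<forall>r<m.
        (\<forall>i<length bs. \<forall>j<fst (bs ! i).
           (\<lambda>n. C i j n $ r * loc_q G \<cc> \<tau> powi n) summable_on {- M..}) \<and>
        X \<tau> $ r = cusp_factor k \<cc> \<tau> *
          (\<Sum>i<length bs. \<Sum>j<fst (bs ! i).
             log_q G \<cc> \<tau> ^ j * exp (of_real (mu (snd (bs ! i))) * log_q G \<cc> \<tau>) *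
             (\<Sum>\<^sub>\<infinity>n\<in>{- M..}. C i j n $ r * loc_q G \<cc> \<tau> powi n)))"

(* Forms are functions on the upper half plane, hence extensional (undefined off it). *)
definition weakly_hol_vvafs ::
  "(real^2^2) set \<Rightarrow> nat \<Rightarrow> int \<Rightarrow> rep \<Rightarrow> (complex \<Rightarrow> complex Matrix.vec) set" where
  "weakly_hol_vvafs G m k \<rho> =
     {X \<in> upper_half \<rightarrow>\<^sub>E carrier_vec m.
        (\<forall>r<m. (\<lambda>\<tau>. X \<tau> $ r) holomorphic_on upper_half) \<and>
        (\<forall>A\<in>G. \<forall>\<tau>\<in>upper_half. slash k X A \<tau> = \<rho> A *\<^sub>v X \<tau>) \<and>
        (\<forall>\<cc>\<in>cusps G. \<exists>M bs C. log_expansion G m k \<rho> X \<cc> M bs C)}"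

definition hol_vvafs ::
  "(real^2^2) set \<Rightarrow> nat \<Rightarrow> int \<Rightarrow> rep \<Rightarrow> (complex \<Rightarrow> complex Matrix.vec) set" where
  "hol_vvafs G m k \<rho> = {X \<in> weakly_hol_vvafs G m k \<rho>.
     \<forall>\<cc>\<in>cusps G. \<exists>M bs C. log_expansion G m k \<rho> X \<cc> M bs C \<and> M \<le> 0}"

(* Vanishing at a cusp means that all exponents mu + n of q which occur are positive, so the term
   n = 0 is excluded for eigenvalue 1 only. Excluding n = 0 for every eigenvalue would not be
   compatible with induction: the exponents are divided by the relative cusp widths when passing
   from H to G, so an exponent 1 can become 1/2. *)
definition cusp_vvafs ::
  "(real^2^2) set \<Rightarrow> nat \<Rightarrow> int \<Rightarrow> rep \<Rightarrow> (complex \<Rightarrow> complex Matrix.vec) set" where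
  "cusp_vvafs G m k \<rho> = {X \<in> weakly_hol_vvafs G m k \<rho>.
     \<forall>\<cc>\<in>cusps G. \<exists>M bs C. log_expansion G m k \<rho> X \<cc> M bs C \<and> M \<le> 0 \<and>
       (\<forall>i<length bs. \<forall>j<fst (bs ! i). \<forall>n. mu (snd (bs ! i)) + of_int n \<le> 0 \<longrightarrow> C i j n = 0\<^sub>v m)}"


section \<open>The ring of scalar automorphic functions and its modules\<close>

(* weight 0, trivial multiplier: multiplication by such a function preserves weights *)
definition automorphic_functions :: "(real^2^2) set \<Rightarrow> (complex \<Rightarrow> complex) set" where
  "automorphic_functions G =
     {f \<in> extensional upper_half. f holomorphic_on upper_half \<and>
        (\<forall>A\<in>G. \<forall>\<tau>\<in>upper_half. f (moebius A \<tau>) = f \<tau>) \<and>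
        (\<forall>\<cc>\<in>cusps G. \<exists>(M :: int) a. \<forall>\<tau>\<in>upper_half.
           ((\<lambda>n. a n * loc_q G \<cc> \<tau> powi n) has_sum f \<tau>) {- M..})}"

definition automorphic_ring :: "(real^2^2) set \<Rightarrow> (complex \<Rightarrow> complex) ring" where
  "automorphic_ring G = \<lparr>carrier = automorphic_functions G,
     mult = (\<lambda>f g. \<lambda>\<tau>\<in>upper_half. f \<tau> * g \<tau>), one = (\<lambda>\<tau>\<in>upper_half. 1),
     zero = (\<lambda>\<tau>\<in>upper_half. 0), add = (\<lambda>f g. \<lambda>\<tau>\<in>upper_half. f \<tau> + g \<tau>)\<rparr>"

definition vvaf_module ::
  "nat \<Rightarrow> (complex \<Rightarrow> complex Matrix.vec) set \<Rightarrow> (complex \<Rightarrow> complex, complex \<Rightarrow> complex Matrix.vec) module" where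
  "vvaf_module m V = \<lparr>carrier = V, mult = undefined, one = undefined,
     zero = (\<lambda>\<tau>\<in>upper_half. 0\<^sub>v m), add = (\<lambda>X Y. \<lambda>\<tau>\<in>upper_half. X \<tau> + Y \<tau>),
     smult = (\<lambda>f X. \<lambda>\<tau>\<in>upper_half. f \<tau> \<cdot>\<^sub>v X \<tau>)\<rparr>"

(* Isomorphisms of abelian groups on which R acts only partially, i.e. f X need not lie in M for
   f in R and X in M: a product lies in M iff the corresponding one lies in N, and then it is
   respected. This matters for holomorphic and cusp forms, because an element of automorphic_ring
   may have poles at cusps. For R-modules these are exactly the bijective elements of module_hom. *)
definition partial_module_iso ::
  "('a, 'c) ring_scheme \<Rightarrow> ('a, 'b, 'd) module_scheme \<Rightarrow> ('a, 'e, 'f) module_scheme \<Rightarrow> ('b \<Rightarrow> 'e) set" where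
  "partial_module_iso R M N = {\<Phi> \<in> iso (add_monoid M) (add_monoid N).
     \<forall>f\<in>carrier R. \<forall>X\<in>carrier M.
       (f \<odot>\<^bsub>M\<^esub> X \<in> carrier M \<longleftrightarrow> f \<odot>\<^bsub>N\<^esub> \<Phi> X \<in> carrier N) \<and>
       (f \<odot>\<^bsub>M\<^esub> X \<in> carrier M \<longrightarrow> \<Phi> (f \<odot>\<^bsub>M\<^esub> X) = f \<odot>\<^bsub>N\<^esub> \<Phi> X)}"

end

theory Submission
  imports Defs "Jordan_Normal_Form.Jordan_Normal_Form_Existence"
begin

text \<open>At a cusp \<open>\<cc>\<close> of width \<open>h\<close>, a form transported to infinity by \<open>A\<^sub>\<cc>\<close> is a vector \<open>F\<close> of
  holomorphic functions with \<open>F(w + h) = T F(w)\<close>, where \<open>T\<close> is the value of the representation at the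
  generator of the stabilizer. The Jordan form of \<open>T\<close> alone forces an expansion in the prescribed powers
  of \<open>log q\<close> and \<open>q\<close>, with Laurent series a priori infinite in both directions. Hence the expansion
  conditions are growth conditions: the form is weakly holomorphic, holomorphic or cuspidal iff its
  components are \<open>O(exp ((e - E) Im w))\<close> on vertical strips for all \<open>e > 0\<close>, with \<open>E\<close> arbitrary, \<open>E = 0\<close>
  or \<open>E > 0\<close>, respectively. Such conditions involve neither the representation nor the cusp width, and
  moving to another cusp only rescales \<open>E\<close> by a positive factor. Therefore
  \<open>X \<mapsto> (X|\<gamma>\<^sub>a\<^sup>-\<^sup>1)\<^sub>a\<close> and its inverse \<open>Y \<mapsto> Y\<^sub>0|\<gamma>\<^sub>0\<close> preserve them, and the Jordan form of the induced
  representation never has to be computed. Its eigenvalues at parabolic elements have modulus 1 because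
  some power of such an element is conjugate into \<open>H\<close>.\<close>

section \<open>Growth at the cusp infinity\<close>

text \<open>Strips of bounded real part are forced by log q, which is unbounded horizontally: on a
  strip \<open>norm w\<close> is at most a multiple of \<open>Im w\<close>, and a single strip of
  width h controls an h-periodic function. Strips of every width occur because an upper triangular
  change of coordinate maps a strip to one of another width. The power q^a at a cusp of width h has
  rate 2 pi a / h. Passing from an expansion to growth is then a termwise estimate. The converse is
  the harder direction. In a Jordan basis each component f satisfies (T - l)^s f = 0, where T is the
  shift by h; such an f is a combination of Newton polynomials in w / h with coefficients multiplied
  by l under T. Division by q^mu makes the coefficients periodic, and the growth bound makes a
  singularity in the variable q removable, which cuts off their Laurent series at the right index.
  Cusp forms need one more remark: the positive exponents must stay away from 0 for a positive rate
  to exist, and they do because there are finitely many Jordan blocks.\<close>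

text \<open>The exponential rate is prescribed only up to an arbitrarily small error, so that polynomial
  factors, in particular powers of the logarithm of \<open>q\<close>, do not affect it.\<close>

definition cusp_growth :: "real \<Rightarrow> (complex \<Rightarrow> complex) \<Rightarrow> bool" where
  "cusp_growth E f \<longleftrightarrow>
     (\<forall>R. \<forall>e>0. \<exists>y0. \<forall>w. \<bar>Re w\<bar> \<le> R \<longrightarrow> y0 \<le> Im w \<longrightarrow> norm (f w) \<le> exp ((e - E) * Im w))"

lemma cusp_growthI:
  assumes "\<And>R e. e > 0 \<Longrightarrow> \<exists>y0. \<forall>w. \<bar>Re w\<bar> \<le> R \<longrightarrow> y0 \<le> Im w \<longrightarrow> norm (f w) \<le> exp ((e - E) * Im w)"
  shows "cusp_growth E f"
  unfolding cusp_growth_def by (intro allI impI assms)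

lemma cusp_growthE:
  assumes "cusp_growth E f" "e > 0"
  obtains y0 where "y0 \<ge> y" "\<And>w. \<bar>Re w\<bar> \<le> R \<Longrightarrow> y0 \<le> Im w \<Longrightarrow> norm (f w) \<le> exp ((e - E) * Im w)"
proof -
  obtain y1 where "\<forall>w. \<bar>Re w\<bar> \<le> R \<longrightarrow> y1 \<le> Im w \<longrightarrow> norm (f w) \<le> exp ((e - E) * Im w)"
    using assms unfolding cusp_growth_def by blast
  then show ?thesis
    using that[of "max y y1"] by simp
qed

lemma cusp_growth_cong:
  assumes "cusp_growth E f" "\<And>w. w \<in> upper_half \<Longrightarrow> f w = g w"
  shows "cusp_growth E g"
proof (rule cusp_growthI)
  fix R e :: real assume "e > 0"
  then obtain y0 where "y0 \<ge> 1" "\<And>w. \<bar>Re w\<bar> \<le> R \<Longrightarrow> y0 \<le> Im w \<Longrightarrow> norm (f w) \<le> exp ((e - E) * Im w)"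
    using cusp_growthE[OF assms(1)] by blast
  then show "\<exists>y0. \<forall>w. \<bar>Re w\<bar> \<le> R \<longrightarrow> y0 \<le> Im w \<longrightarrow> norm (g w) \<le> exp ((e - E) * Im w)"
    using assms(2) by (intro exI[of _ y0]) (auto simp: upper_half_def)
qed

lemma cusp_growth_zero: "cusp_growth E (\<lambda>w. 0)"
  unfolding cusp_growth_def by simp

text \<open>The slack \<open>e\<close> beats any constant once \<open>Im w\<close> is large, so
  scalar factors do not change the rate; finite sums are treated in the same way.\<close>

lemma cusp_growth_const: "cusp_growth 0 (\<lambda>w. c)"
proof (rule cusp_growthI)
  fix R e :: real assume e: "e > 0"
  have "norm c \<le> exp ((e - 0) * Im w)" if "norm c / e \<le> Im w" for w
  proof -
    have "norm c \<le> e * Im w"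
      using that e by (simp add: field_simps)
    also have "\<dots> \<le> exp (e * Im w)"
      using exp_ge_add_one_self[of "e * Im w"] by linarith
    finally show ?thesis by simp
  qed
  then show "\<exists>y0. \<forall>w. \<bar>Re w\<bar> \<le> R \<longrightarrow> y0 \<le> Im w \<longrightarrow> norm c \<le> exp ((e - 0) * Im w)"
    by blast
qed

lemma cusp_growth_id: "cusp_growth 0 (\<lambda>w. w)"
proof (rule cusp_growthI)
  fix R e :: real assume e: "e > 0"
  \<comment> \<open>The height \<open>4 / e\<^sup>2\<close> makes \<open>2 * Im w\<close> smaller
    than the quadratic Taylor term of \<open>exp (e * Im w)\<close>; the height \<open>R\<close>
    makes \<open>\<bar>Re w\<bar>\<close> at most \<open>Im w\<close>.\<close>
  have "norm w \<le> exp ((e - 0) * Im w)" if "\<bar>Re w\<bar> \<le> R" "max R (max 1 (4 / e\<^sup>2)) \<le> Im w" for w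
  proof -
    have y: "Im w \<ge> R" "Im w \<ge> 1" "Im w \<ge> 4 / e\<^sup>2"
      using that(2) by simp_all
    have "norm w \<le> \<bar>Re w\<bar> + \<bar>Im w\<bar>"
      by (rule cmod_le)
    also have "\<dots> \<le> 2 * Im w"
      using that(1) y by simp
    also have "\<dots> \<le> (e * Im w)\<^sup>2 / 2"
    proof -
      have "4 * 1 \<le> e\<^sup>2 * Im w"
        using y(3) e by (simp add: field_simps)
      then have "4 * Im w \<le> e\<^sup>2 * Im w * Im w"
        using y(2) by (intro mult_right_mono) auto
      then show ?thesis
        by (simp add: power2_eq_square algebra_simps)
    qed
    also have "\<dots> \<le> exp (e * Im w)"
    proof -
      have "0 \<le> e * Im w" using e y(2) by simp
      then show ?thesis using exp_lower_Taylor_quadratic[of "e * Im w"] by linarith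
    qed
    finally show ?thesis by simp
  qed
  then show "\<exists>y0. \<forall>w. \<bar>Re w\<bar> \<le> R \<longrightarrow> y0 \<le> Im w \<longrightarrow> norm w \<le> exp ((e - 0) * Im w)"
    by blast
qed

lemma cusp_growth_exp: "cusp_growth a (\<lambda>w. exp (\<i> * of_real a * w))"
proof (rule cusp_growthI)
  fix R e :: real assume e: "e > 0"
  have "norm (exp (\<i> * of_real a * w)) \<le> exp ((e - a) * Im w)" if "0 \<le> Im w" for w
    using that e by (simp add: norm_exp_eq_Re algebra_simps)
  then show "\<exists>y0. \<forall>w. \<bar>Re w\<bar> \<le> R \<longrightarrow> y0 \<le> Im w \<longrightarrow>
      norm (exp (\<i> * of_real a * w)) \<le> exp ((e - a) * Im w)"
    by blast
qed

lemma cusp_growth_mult: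
  assumes "cusp_growth E f" "cusp_growth E' g"
  shows "cusp_growth (E + E') (\<lambda>w. f w * g w)"
proof (rule cusp_growthI)
  fix R e :: real assume e: "e > 0"
  then have e2: "e / 2 > 0" by simp
  obtain y1 where y1: "\<And>w. \<bar>Re w\<bar> \<le> R \<Longrightarrow> y1 \<le> Im w \<Longrightarrow> norm (f w) \<le> exp ((e / 2 - E) * Im w)"
    using cusp_growthE[OF assms(1) e2] by blast
  obtain y2 where y2: "\<And>w. \<bar>Re w\<bar> \<le> R \<Longrightarrow> y2 \<le> Im w \<Longrightarrow> norm (g w) \<le> exp ((e / 2 - E') * Im w)"
    using cusp_growthE[OF assms(2) e2] by blast
  have "norm (f w * g w) \<le> exp ((e - (E + E')) * Im w)"
    if "\<bar>Re w\<bar> \<le> R" "max y1 y2 \<le> Im w" for w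
  proof -
    have "norm (f w * g w) \<le> exp ((e / 2 - E) * Im w) * exp ((e / 2 - E') * Im w)"
      unfolding norm_mult using y1[of w] y2[of w] that by (intro mult_mono) auto
    also have "\<dots> = exp ((e - (E + E')) * Im w)"
      unfolding exp_add[symmetric] by (simp add: field_simps)
    finally show ?thesis .
  qed
  then show "\<exists>y0. \<forall>w. \<bar>Re w\<bar> \<le> R \<longrightarrow> y0 \<le> Im w \<longrightarrow> norm (f w * g w) \<le> exp ((e - (E + E')) * Im w)"
    by blast
qed

lemma cusp_growth_add:
  assumes "cusp_growth E f" "cusp_growth E g"
  shows "cusp_growth E (\<lambda>w. f w + g w)"
proof (rule cusp_growthI)
  fix R e :: real assume e: "e > 0"
  then have e2: "e / 2 > 0" by simp
  obtain y1 where y1: "\<And>w. \<bar>Re w\<bar> \<le> R \<Longrightarrow> y1 \<le> Im w \<Longrightarrow> norm (f w) \<le> exp ((e / 2 - E) * Im w)"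
    using cusp_growthE[OF assms(1) e2] by blast
  obtain y2 where y2: "\<And>w. \<bar>Re w\<bar> \<le> R \<Longrightarrow> y2 \<le> Im w \<Longrightarrow> norm (g w) \<le> exp ((e / 2 - E) * Im w)"
    using cusp_growthE[OF assms(2) e2] by blast
  obtain y3 where y3: "\<And>w. \<bar>Re w\<bar> \<le> R \<Longrightarrow> y3 \<le> Im w \<Longrightarrow> norm (2 :: complex) \<le> exp ((e / 2 - 0) * Im w)"
    using cusp_growthE[OF cusp_growth_const[of 2] e2] by blast
  have "norm (f w + g w) \<le> exp ((e - E) * Im w)"
    if "\<bar>Re w\<bar> \<le> R" "max y1 (max y2 y3) \<le> Im w" for w
  proof -
    have "norm (f w + g w) \<le> 2 * exp ((e / 2 - E) * Im w)"
      using y1[of w] y2[of w] that norm_triangle_ineq[of "f w" "g w"] by auto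
    also have "\<dots> \<le> exp (e / 2 * Im w) * exp ((e / 2 - E) * Im w)"
      using y3[of w] that by (intro mult_right_mono) auto
    also have "\<dots> = exp ((e - E) * Im w)"
      unfolding exp_add[symmetric] by (simp add: field_simps)
    finally show ?thesis .
  qed
  then show "\<exists>y0. \<forall>w. \<bar>Re w\<bar> \<le> R \<longrightarrow> y0 \<le> Im w \<longrightarrow> norm (f w + g w) \<le> exp ((e - E) * Im w)"
    by blast
qed

lemma cusp_growth_mono:
  assumes "cusp_growth E f" "E' \<le> E"
  shows "cusp_growth E' f"
proof (rule cusp_growthI)
  fix R e :: real assume e: "e > 0"
  \<comment> \<open>Nonnegative heights matter: for negative \<open>Im w\<close> the comparison of
    the exponents would reverse.\<close>
  obtain y0 where y0: "y0 \<ge> 0" "\<And>w. \<bar>Re w\<bar> \<le> R \<Longrightarrow> y0 \<le> Im w \<Longrightarrow> norm (f w) \<le> exp ((e - E) * Im w)"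
    using cusp_growthE[OF assms(1) e] by blast
  have "norm (f w) \<le> exp ((e - E') * Im w)" if "\<bar>Re w\<bar> \<le> R" "y0 \<le> Im w" for w
  proof -
    have "(e - E) * Im w \<le> (e - E') * Im w"
      using assms(2) y0(1) that by (intro mult_right_mono) auto
    then show ?thesis
      using y0(2)[OF that] by (meson exp_le_cancel_iff order_trans)
  qed
  then show "\<exists>y0. \<forall>w. \<bar>Re w\<bar> \<le> R \<longrightarrow> y0 \<le> Im w \<longrightarrow> norm (f w) \<le> exp ((e - E') * Im w)"
    by blast
qed

text \<open>The map multiplies heights by \<open>s\<close>, hence the rate as well. It carries the
  strip of half-width \<open>R\<close> into the one of half-width
  \<open>s * R + \<bar>b\<bar>\<close>, so bounds on all strips are needed to get bounds on all
  strips.\<close>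

lemma cusp_growth_affine:
  fixes s b :: real
  assumes "cusp_growth E f" "s > 0"
  shows "cusp_growth (s * E) (\<lambda>w. f (of_real s * w + of_real b))"
proof (rule cusp_growthI)
  fix R e :: real assume e: "e > 0"
  then have es: "e / s > 0" using assms(2) by simp
  obtain y0 where y0: "\<And>w. \<bar>Re w\<bar> \<le> s * R + \<bar>b\<bar> \<Longrightarrow> y0 \<le> Im w \<Longrightarrow> norm (f w) \<le> exp ((e / s - E) * Im w)"
    using cusp_growthE[OF assms(1) es] by blast
  have "norm (f (of_real s * w + of_real b)) \<le> exp ((e - s * E) * Im w)"
    if "\<bar>Re w\<bar> \<le> R" "y0 / s \<le> Im w" for w
  proof -
    have "\<bar>s * Re w + b\<bar> \<le> s * \<bar>Re w\<bar> + \<bar>b\<bar>"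
      using assms(2) abs_triangle_ineq[of "s * Re w" b] by (simp add: abs_mult)
    also have "\<dots> \<le> s * R + \<bar>b\<bar>"
      using that assms(2) by simp
    finally have "norm (f (of_real s * w + of_real b)) \<le> exp ((e / s - E) * (s * Im w))"
      using y0[of "of_real s * w + of_real b"] that(2) assms(2) by (simp add: field_simps)
    also have "(e / s - E) * (s * Im w) = (e - s * E) * Im w"
      using assms(2) by (simp add: field_simps)
    finally show ?thesis .
  qed
  then show "\<exists>y0. \<forall>w. \<bar>Re w\<bar> \<le> R \<longrightarrow> y0 \<le> Im w \<longrightarrow>
      norm (f (of_real s * w + of_real b)) \<le> exp ((e - s * E) * Im w)"
    by blast
qed

lemma cusp_growth_cmult: "cusp_growth E f \<Longrightarrow> cusp_growth E (\<lambda>w. c * f w)"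
  using cusp_growth_mult[OF cusp_growth_const, of E f c] by simp

lemma cusp_growth_power_mult: "cusp_growth E f \<Longrightarrow> cusp_growth E (\<lambda>w. w ^ j * f w)"
proof (induction j)
  case (Suc j)
  then show ?case
    using cusp_growth_mult[OF cusp_growth_id, of E "\<lambda>w. w ^ j * f w"] by (simp add: mult_ac)
qed simp

lemma cusp_growth_diff:
  assumes "cusp_growth E f" "cusp_growth E g"
  shows "cusp_growth E (\<lambda>w. f w - g w)"
  using cusp_growth_add[OF assms(1) cusp_growth_cmult[OF assms(2), of "- 1"]] by simp

lemma cusp_growth_sum:
  assumes "\<And>i. i \<in> I \<Longrightarrow> cusp_growth E (f i)"
  shows "cusp_growth E (\<lambda>w. \<Sum>i\<in>I. f i w)"
  using assms
proof (induction I rule: infinite_finite_induct)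
  case (insert x F)
  then show ?case by (simp add: cusp_growth_add)
qed (simp_all add: cusp_growth_zero)

section \<open>Periodic functions\<close>

text \<open>This is log q in the coordinate in which the cusp lies at infinity. Keeping the width as
  a bare real number \<open>h\<close> frees the analysis from the group.\<close>

definition norm_log :: "real \<Rightarrow> complex \<Rightarrow> complex" where
  "norm_log h w = 2 * of_real pi * \<i> * w / of_real h"

lemma norm_log_add: "h \<noteq> 0 \<Longrightarrow> norm_log h (w + of_real h) = norm_log h w + 2 * of_real pi * \<i>"
  by (simp add: norm_log_def field_simps)

lemma Re_norm_log: "Re (norm_log h w) = - (2 * pi * Im w / h)"
  by (simp add: norm_log_def Re_divide_of_real)

lemma holomorphic_norm_log [holomorphic_intros]: "norm_log h holomorphic_on A"
  unfolding norm_log_def by (cases "h = 0") (auto intro!: holomorphic_intros)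

lemma exp_norm_log_powi:
  "exp (norm_log h w) powi n = exp (of_int n * norm_log h w)"
  by (simp add: exp_power_int)

lemma norm_exp_norm_log: "norm (exp (of_real a * norm_log h w)) = exp (- (2 * pi * a / h * Im w))"
  by (simp add: norm_exp_eq_Re Re_norm_log)

lemma norm_exp_norm_log_powi: "norm (exp (norm_log h w) powi n) = exp (- (2 * pi * of_int n / h * Im w))"
  using norm_exp_norm_log[of "of_int n" h w] by (simp add: exp_norm_log_powi)

text \<open>The dictionary between expansions and growth: exponent \<open>a\<close> of q against
  rate \<open>2 * pi * a / h\<close>.\<close>

lemma cusp_growth_exp_norm_log: "cusp_growth (2 * pi * a / h) (\<lambda>w. exp (of_real a * norm_log h w))"
proof -
  have "(\<lambda>w. exp (\<i> * of_real (2 * pi * a / h) * w)) = (\<lambda>w. exp (of_real a * norm_log h w))"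
    by (rule ext) (simp add: norm_log_def mult_ac)
  then show ?thesis
    using cusp_growth_exp[of "2 * pi * a / h"] by simp
qed

lemma upper_half_add_real: "w \<in> upper_half \<Longrightarrow> w + of_real b \<in> upper_half"
  by (simp add: upper_half_def)

lemma periodic_of_int:
  fixes f :: "complex \<Rightarrow> 'a"
  assumes per: "\<And>w. w \<in> upper_half \<Longrightarrow> f (w + of_real h) = f w" and w: "w \<in> upper_half"
  shows "f (w + of_int n * of_real h) = f w"
proof -
  have nat: "f (v + of_nat k * of_real h) = f v" if v: "v \<in> upper_half" for k v
  proof (induction k)
    case (Suc k)
    have "f (v + of_nat (Suc k) * of_real h) = f ((v + of_real (of_nat k * h)) + of_real h)"
      by (simp add: algebra_simps)
    also have "\<dots> = f (v + of_real (of_nat k * h))"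
      by (rule per[OF upper_half_add_real[OF v]])
    finally show ?case using Suc by simp
  qed simp
  show ?thesis
  proof (cases "n \<ge> 0")
    case True
    then show ?thesis using nat[OF w, of "nat n"] by simp
  next
    case False
    have "f ((w + of_real (of_int n * h)) + of_nat (nat (- n)) * of_real h) = f (w + of_real (of_int n * h))"
      by (rule nat[OF upper_half_add_real[OF w]])
    then show ?thesis using False by simp
  qed
qed

text \<open>Unordered summation needs absolute convergence, which follows from convergence at a real
  radius strictly between \<open>norm q\<close> and 1.\<close>

lemma powser_has_sum:
  fixes b :: "nat \<Rightarrow> complex"
  assumes "\<And>q. norm q < 1 \<Longrightarrow> (\<lambda>n. b n * q ^ n) sums G q" "norm q < 1"
  shows "((\<lambda>n. b n * q ^ n) has_sum G q) UNIV"
proof (rule norm_summable_imp_has_sum)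
  obtain r where r: "norm q < r" "r < 1"
    using assms(2) dense by blast
  then have "summable (\<lambda>n. b n * of_real r ^ n)"
    using assms(1)[of "of_real r"] norm_ge_zero[of q] by (intro sums_summable) auto
  then show "summable (\<lambda>n. norm (b n * q ^ n))"
    using r norm_ge_zero[of q] by (intro powser_insidea[of b "of_real r"]) auto
qed (use assms in auto)

text \<open>In the variable q the function lives on the punctured unit disc. A rate above that of
  q^(-1) makes q times the function tend to 0 at the puncture; the singularity is removable, and the
  Taylor series of the extension is the expansion.\<close>

lemma periodic_power_series:
  assumes h: "h > 0" and hol: "g holomorphic_on upper_half"
    and per: "\<And>w. w \<in> upper_half \<Longrightarrow> g (w + of_real h) = g w"
    and growth: "cusp_growth E g" and E: "E > - (2 * pi / h)"
  obtains b :: "nat \<Rightarrow> complex"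
  where "\<And>w. w \<in> upper_half \<Longrightarrow> ((\<lambda>n. b n * exp (norm_log h w) ^ n) has_sum g w) UNIV"
proof -
  \<comment> \<open>\<open>W\<close> inverts \<open>norm_log h\<close>: it turns a logarithm of q
    back into a point of the half plane.\<close>
  define W where "W = (\<lambda>l. of_real h * l / (2 * of_real pi * \<i>))"
  have W_log: "norm_log h (W l) = l" for l
    using h by (simp add: W_def norm_log_def)
  have log_W: "W (norm_log h w) = w" for w
    using h by (simp add: W_def norm_log_def)
  have Im_W: "Im (W l) = - (h / (2 * pi) * Re l)" for l
    by (simp add: W_def Im_divide power2_eq_square)
  have Re_W: "Re (W l) = h / (2 * pi) * Im l" for l
    by (simp add: W_def Re_divide power2_eq_square)
  \<comment> \<open>The principal logarithm jumps along the negative axis, but two logarithms of q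
    differ by a multiple of 2 pi i, which \<open>W\<close> turns into a multiple of the period. So
    any logarithm may replace \<open>Ln q\<close>.\<close>
  define A where "A = (\<lambda>q. g (W (Ln q)))"
  have W_upper: "W l \<in> upper_half" if "Re l < 0" for l
    using that h by (simp add: upper_half_def Im_W mult_pos_neg divide_neg_pos)
  have A_eq: "A q = g (W l)" if "q = exp l" "Re l < 0" for q l
  proof -
    have "exp (Ln q) = exp l" using that by simp
    then obtain n :: int where "Ln q = l + complex_of_real (of_int (2 * n) * pi) * \<i>"
      unfolding exp_eq by blast
    then have "W (Ln q) = W l + of_int n * of_real h"
      using h by (simp add: W_def field_simps)
    then show ?thesis
      unfolding A_def by (simp add: periodic_of_int[of g h, OF per W_upper[OF that(2)]])
  qed
  have A_hol: "A holomorphic_on ball 0 1 - {0}"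
    unfolding holomorphic_on_def
  proof
    fix q0 :: complex assume q0: "q0 \<in> ball 0 1 - {0}"
    \<comment> \<open>A neighbourhood of \<open>q0\<close> with a holomorphic branch of the
      logarithm: dividing by \<open>q0\<close> rotates the cut of \<open>Ln\<close> away from
      \<open>q0\<close>.\<close>
    define U where "U = (ball 0 1 - {0}) \<inter> ((\<lambda>q. q / q0) -` (- \<real>\<^sub>\<le>\<^sub>0))"
    have U: "open U"
      unfolding U_def using q0
      by (intro open_Int open_vimage open_Compl closed_nonpos_Reals_complex continuous_intros) auto
    have q0U: "q0 \<in> U" using q0 by (simp add: U_def)
    have expL: "exp (Ln (q / q0) + Ln q0) = q" if "q \<in> U" for q
      using that q0 by (auto simp: U_def exp_add)
    have ReL: "Re (Ln (q / q0) + Ln q0) < 0" if "q \<in> U" for q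
    proof -
      have "exp (Re (Ln (q / q0) + Ln q0)) = norm q"
        using expL[OF that] norm_exp_eq_Re by metis
      also have "\<dots> < exp 0" using that by (simp add: U_def)
      finally show ?thesis by (simp only: exp_less_cancel_iff)
    qed
    have "(\<lambda>q. g (W (Ln (q / q0) + Ln q0))) holomorphic_on U"
    proof (rule holomorphic_on_compose_gen[of _ _ g upper_half, unfolded o_def])
      show "(\<lambda>q. W (Ln (q / q0) + Ln q0)) holomorphic_on U"
        unfolding W_def using q0 by (intro holomorphic_intros) (auto simp: U_def)
    qed (use hol W_upper ReL in auto)
    then have "A holomorphic_on U"
      by (rule holomorphic_transform) (simp add: A_eq[OF expL[symmetric] ReL])
    then show "A field_differentiable at q0 within ball 0 1 - {0}"
      using holomorphic_on_imp_differentiable_at[OF _ U q0U] field_differentiable_at_within by blast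
  qed
  have lim: "((\<lambda>q. (q - 0) * A q) \<longlongrightarrow> 0) (at 0)"
  proof -
    \<comment> \<open>Half the gap between \<open>E\<close> and the critical rate of q^(-1): one
      half is spent on the growth bound, the other survives as the decay
      \<open>exp (- (e * y q))\<close>.\<close>
    define e where "e = (E + 2 * pi / h) / 2"
    have e: "e > 0" using E by (simp add: e_def)
    \<comment> \<open>Since \<open>Ln\<close> has imaginary part of modulus at most pi, the points
      \<open>W (Ln q)\<close> stay in this one strip.\<close>
    obtain y0 where y0: "\<And>w. \<bar>Re w\<bar> \<le> h / 2 \<Longrightarrow> y0 \<le> Im w \<Longrightarrow> norm (g w) \<le> exp ((e - E) * Im w)"
      using cusp_growthE[OF growth e] by blast
    define y where "y = (\<lambda>q::complex. - (h / (2 * pi)) * ln (norm q))"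
    have "filterlim (\<lambda>q::complex. norm q) (at_right 0) (at 0)"
      unfolding filterlim_at by (auto intro!: tendsto_eq_intros simp: eventually_at_filter)
    then have "filterlim (\<lambda>q::complex. ln (norm q)) at_bot (at 0)"
      by (rule filterlim_compose[OF ln_at_0])
    then have "filterlim (\<lambda>q::complex. h / (2 * pi) * ln (norm q)) at_bot (at 0)"
      using h by (intro filterlim_tendsto_pos_mult_at_bot[OF tendsto_const]) auto
    then have y_lim: "filterlim y at_top (at 0)"
      unfolding y_def by (simp add: filterlim_uminus_at_bot)
    have "eventually (\<lambda>q. norm ((q - 0) * A q) \<le> exp (- (e * y q))) (at 0)"
    proof -
      have "eventually (\<lambda>q. y0 \<le> y q) (at 0)"
        using y_lim by (simp add: filterlim_at_top)
      moreover have "eventually (\<lambda>q::complex. q \<noteq> 0) (at 0)"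
        by (simp add: eventually_at_filter)
      ultimately show ?thesis
      proof eventually_elim
        case (elim q)
        have Im: "Im (W (Ln q)) = y q"
          using elim by (simp add: Im_W y_def)
        have "\<bar>Re (W (Ln q))\<bar> \<le> h / 2"
        proof -
          have "\<bar>Im (Ln q)\<bar> \<le> pi" using elim mpi_less_Im_Ln[of q] Im_Ln_le_pi[of q] by auto
          then have "h / (2 * pi) * \<bar>Im (Ln q)\<bar> \<le> h / (2 * pi) * pi"
            using h by (intro mult_left_mono) auto
          then show ?thesis using h by (simp add: Re_W abs_mult)
        qed
        then have "norm (A q) \<le> exp ((e - E) * y q)"
          using y0 elim Im unfolding A_def by metis
        moreover have "norm q = exp (- (2 * pi / h * y q))"
          using elim h by (simp add: y_def)
        ultimately have "norm ((q - 0) * A q) \<le> exp (- (2 * pi / h * y q)) * exp ((e - E) * y q)"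
          by (simp add: norm_mult)
        also have "\<dots> = exp ((e - (E + 2 * pi / h)) * y q)"
          unfolding exp_add[symmetric] by (simp add: algebra_simps)
        also have "e - (E + 2 * pi / h) = - e"
          by (simp add: e_def field_simps)
        finally show ?case by simp
      qed
    qed
    moreover have "((\<lambda>q. exp (- (e * y q))) \<longlongrightarrow> 0) (at 0)"
    proof -
      have "filterlim (\<lambda>q. e * y q) at_top (at 0)"
        by (rule filterlim_tendsto_pos_mult_at_top[OF tendsto_const e y_lim])
      then have "filterlim (\<lambda>q. - (e * y q)) at_bot (at 0)"
        by (simp add: filterlim_uminus_at_bot)
      then show ?thesis by (rule filterlim_compose[OF exp_at_bot])
    qed
    ultimately show ?thesis by (rule Lim_null_comparison)
  qed
  obtain G where G: "G holomorphic_on ball 0 1" "\<And>q. q \<in> ball 0 1 - {0} \<Longrightarrow> G q = A q"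
    using holomorphic_on_extend_lim[OF A_hol] lim by auto
  show ?thesis
  proof (rule that[of "\<lambda>n. (deriv ^^ n) G 0 / fact n"])
    fix w assume w: "w \<in> upper_half"
    have q: "norm (exp (norm_log h w)) < 1"
      using w h by (simp add: norm_exp_eq_Re Re_norm_log upper_half_def)
    have "((\<lambda>n. (deriv ^^ n) G 0 / fact n * exp (norm_log h w) ^ n) has_sum G (exp (norm_log h w))) UNIV"
      using q by (intro powser_has_sum) (use holomorphic_power_series[OF G(1)] in auto)
    moreover have "G (exp (norm_log h w)) = g w"
      using q G(2) A_eq[of "exp (norm_log h w)" "norm_log h w"] w h
      by (simp add: log_W Re_norm_log upper_half_def)
    ultimately show "((\<lambda>n. (deriv ^^ n) G 0 / fact n * exp (norm_log h w) ^ n) has_sum g w) UNIV"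
      by simp
  qed
qed

text \<open>Multiplication by q^(-n0) brings the function into the range where the singularity is
  removable; the Taylor series found there is shifted back by \<open>n0\<close>.\<close>

lemma periodic_laurent_series:
  assumes h: "h > 0" and hol: "f holomorphic_on upper_half"
    and per: "\<And>w. w \<in> upper_half \<Longrightarrow> f (w + of_real h) = f w"
    and growth: "cusp_growth E f"
  obtains c :: "int \<Rightarrow> complex"
  where "\<And>n. 2 * pi * of_int n / h < E \<Longrightarrow> c n = 0"
    and "\<And>w. w \<in> upper_half \<Longrightarrow> ((\<lambda>n. c n * exp (norm_log h w) powi n) has_sum f w) UNIV"
proof -
  \<comment> \<open>The least integer whose rate \<open>2 * pi * n0 / h\<close> reaches
    \<open>E\<close>. Lower powers of q are excluded by the growth, and after division by q^n0 the
    remaining rate misses 0 by less than \<open>2 * pi / h\<close>.\<close>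
  define n0 where "n0 = \<lceil>E * h / (2 * pi)\<rceil>"
  define g where "g = (\<lambda>w. f w * exp (of_real (of_int (- n0)) * norm_log h w))"
  have "g holomorphic_on upper_half"
    unfolding g_def by (intro holomorphic_intros hol)
  moreover have "g (w + of_real h) = g w" if "w \<in> upper_half" for w
  proof -
    have "exp (of_real (of_int (- n0)) * norm_log h (w + of_real h)) =
        exp (of_real (of_int (- n0)) * norm_log h w + 2 * of_int (- n0) * of_real pi * \<i>)"
      using h by (simp add: norm_log_add algebra_simps)
    also have "\<dots> = exp (of_real (of_int (- n0)) * norm_log h w)"
      by (subst exp_eq) (rule exI[of _ "- n0"], simp)
    finally show ?thesis by (simp add: g_def per[OF that])
  qed
  moreover have "cusp_growth (E + 2 * pi * of_int (- n0) / h) g"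
    unfolding g_def by (rule cusp_growth_mult[OF growth cusp_growth_exp_norm_log])
  moreover have "E + 2 * pi * of_int (- n0) / h > - (2 * pi / h)"
  proof -
    have "of_int n0 < E * h / (2 * pi) + 1"
      unfolding n0_def by linarith
    then have "2 * pi * of_int n0 / h < 2 * pi * (E * h / (2 * pi) + 1) / h"
      using h by (intro divide_strict_right_mono mult_strict_left_mono) auto
    also have "\<dots> = E + 2 * pi / h"
      using h by (simp add: field_simps)
    finally show ?thesis by simp
  qed
  ultimately obtain b :: "nat \<Rightarrow> complex" where
    b: "\<And>w. w \<in> upper_half \<Longrightarrow> ((\<lambda>n. b n * exp (norm_log h w) ^ n) has_sum g w) UNIV"
    using periodic_power_series[OF h] by blast
  define c where "c = (\<lambda>n. if n \<ge> n0 then b (nat (n - n0)) else 0)"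
  show ?thesis
  proof (rule that[of c])
    fix n :: int assume "2 * pi * of_int n / h < E"
    then have "of_int n < E * h / (2 * pi)"
      using h by (simp add: field_simps)
    then have "n < n0" unfolding n0_def by linarith
    then show "c n = 0" by (simp add: c_def)
  next
    fix w assume w: "w \<in> upper_half"
    let ?q = "exp (norm_log h w)"
    have "((\<lambda>n. ?q powi n0 * (b n * ?q ^ n)) has_sum (?q powi n0 * g w)) UNIV"
      by (intro has_sum_cmult_right b w)
    moreover have "?q powi n0 * g w = f w"
      by (simp add: g_def exp_norm_log_powi exp_minus)
    moreover have "(\<lambda>n. ?q powi n0 * (b n * ?q ^ n)) = (\<lambda>n. c n * ?q powi n) \<circ> (\<lambda>k. n0 + int k)"
      by (rule ext) (simp add: c_def power_int_add)
    ultimately have "((\<lambda>n. c n * ?q powi n) has_sum f w) ((\<lambda>k. n0 + int k) ` UNIV)"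
      by (subst has_sum_reindex) (auto simp: inj_on_def)
    then show "((\<lambda>n. c n * ?q powi n) has_sum f w) UNIV"
    proof (rule has_sum_cong_neutral[THEN iffD1, rotated -1])
      fix n assume "n \<in> UNIV - (\<lambda>k. n0 + int k) ` UNIV"
      then have "n < n0"
        by (metis DiffD2 UNIV_I image_eqI le_iff_add not_le zle_iff_zadd)
      then show "c n * ?q powi n = 0" by (simp add: c_def)
    qed auto
  qed
qed

text \<open>The absolute values of the terms at \<open>\<i>\<close> serve as a majorant: for
  \<open>Im w \<ge> 1\<close>, passing from \<open>\<i>\<close> to \<open>w\<close> changes a term
  of index n \<ge> N by at most the factor by which the absolute value of q^N changes.\<close>

lemma cusp_growth_laurent_series:
  assumes h: "h > 0"
    and sm: "\<And>w. w \<in> upper_half \<Longrightarrow> (\<lambda>n. c n * exp (norm_log h w) powi n) summable_on {N..}"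
  shows "cusp_growth (2 * pi * of_int N / h) (\<lambda>w. \<Sum>\<^sub>\<infinity>n\<in>{N..}. c n * exp (norm_log h w) powi n)"
proof (rule cusp_growthI)
  fix R e :: real assume e: "e > 0"
  define S where "S = (\<Sum>\<^sub>\<infinity>n\<in>{N..}. norm (c n * exp (norm_log h \<i>) powi n))"
  define K where "K = exp (2 * pi * of_int N / h) * S"
  have i: "\<i> \<in> upper_half" by (simp add: upper_half_def)
  obtain y1 where y1: "\<And>w. \<bar>Re w\<bar> \<le> R \<Longrightarrow> y1 \<le> Im w \<Longrightarrow> norm (complex_of_real K) \<le> exp ((e - 0) * Im w)"
    using cusp_growthE[OF cusp_growth_const[of "of_real K"] e] by blast
  have "norm (\<Sum>\<^sub>\<infinity>n\<in>{N..}. c n * exp (norm_log h w) powi n) \<le> exp ((e - 2 * pi * of_int N / h) * Im w)"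
    if "\<bar>Re w\<bar> \<le> R" "max y1 1 \<le> Im w" for w
  proof -
    let ?r = "exp (- (2 * pi * of_int N / h) * (Im w - 1))"
    have w: "w \<in> upper_half" using that by (simp add: upper_half_def)
    have abs: "(\<lambda>n. norm (c n * exp (norm_log h v) powi n)) summable_on {N..}" if "v \<in> upper_half" for v
      using sm[OF that] by (simp add: summable_on_iff_abs_summable_on_complex)
    have "norm (\<Sum>\<^sub>\<infinity>n\<in>{N..}. c n * exp (norm_log h w) powi n)
        \<le> (\<Sum>\<^sub>\<infinity>n\<in>{N..}. norm (c n * exp (norm_log h w) powi n))"
      by (rule norm_infsum_bound[OF abs[OF w]])
    also have "\<dots> \<le> (\<Sum>\<^sub>\<infinity>n\<in>{N..}. norm (c n * exp (norm_log h \<i>) powi n) * ?r)"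
    proof (rule infsum_mono[OF abs[OF w]])
      show "(\<lambda>n. norm (c n * exp (norm_log h \<i>) powi n) * ?r) summable_on {N..}"
        by (intro summable_on_cmult_left abs i)
      fix n assume n: "n \<in> {N..}"
      have "norm (exp (norm_log h w) powi n) \<le> norm (exp (norm_log h \<i>) powi n) * ?r"
      proof -
        have "of_int N * (Im w - 1) \<le> of_int n * (Im w - 1)"
          using n that(2) by (intro mult_right_mono) auto
        then have "2 * pi / h * (of_int N * (Im w - 1)) \<le> 2 * pi / h * (of_int n * (Im w - 1))"
          using h by (intro mult_left_mono) auto
        then have "- (2 * pi * of_int n / h * Im w) \<le>
            - (2 * pi * of_int n / h * 1) + - (2 * pi * of_int N / h) * (Im w - 1)"
          by (simp add: algebra_simps diff_divide_distrib)
        then show ?thesis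
          unfolding norm_exp_norm_log_powi by (simp add: exp_add[symmetric])
      qed
      then show "norm (c n * exp (norm_log h w) powi n) \<le> norm (c n * exp (norm_log h \<i>) powi n) * ?r"
        by (simp add: norm_mult mult.assoc mult_left_mono)
    qed
    also have "\<dots> = S * ?r"
      unfolding S_def by (rule infsum_cmult_left) (use abs[OF i] in blast)
    also have "\<dots> = K * exp (- (2 * pi * of_int N / h) * Im w)"
    proof -
      have "?r = exp (2 * pi * of_int N / h) * exp (- (2 * pi * of_int N / h) * Im w)"
        unfolding exp_add[symmetric] by (simp only: right_diff_distrib) simp
      then show ?thesis by (simp add: K_def)
    qed
    also have "\<dots> \<le> exp (e * Im w) * exp (- (2 * pi * of_int N / h) * Im w)"
    proof (rule mult_right_mono)
      show "K \<le> exp (e * Im w)"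
        using y1[of w] that by (simp add: norm_of_real)
    qed simp
    also have "\<dots> = exp ((e - 2 * pi * of_int N / h) * Im w)"
      unfolding exp_add[symmetric] by (simp add: algebra_simps)
    finally show ?thesis .
  qed
  then show "\<exists>y0. \<forall>w. \<bar>Re w\<bar> \<le> R \<longrightarrow> y0 \<le> Im w \<longrightarrow>
      norm (\<Sum>\<^sub>\<infinity>n\<in>{N..}. c n * exp (norm_log h w) powi n) \<le> exp ((e - 2 * pi * of_int N / h) * Im w)"
    by blast
qed

section \<open>The groups acting on the upper half plane and its boundary\<close>

text \<open>The adjugate, which is the inverse on SL_2(R). Being a formula in the entries, it is
  involutive and reverses products for all matrices, and it takes the place of the abstract inverse
  in computations.\<close>

definition adj22 :: "real^2^2 \<Rightarrow> real^2^2" where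
  "adj22 A = mat22 (A $h 2 $h 2) (- (A $h 1 $h 2)) (- (A $h 2 $h 1)) (A $h 1 $h 1)"

lemma mat22_entries [simp]:
  "mat22 a b c d $h 1 $h 1 = a" "mat22 a b c d $h 1 $h 2 = b"
  "mat22 a b c d $h 2 $h 1 = c" "mat22 a b c d $h 2 $h 2 = d"
  by (simp_all add: mat22_def)

lemma id22_entries [simp]:
  "id22 $h 1 $h 1 = 1" "id22 $h 1 $h 2 = 0" "id22 $h 2 $h 1 = 0" "id22 $h 2 $h 2 = 1"
  by (simp_all add: Finite_Cartesian_Product.mat_def)

lemma mult22_entries:
  fixes A B :: "real^2^2"
  shows "(A ** B) $h i $h j = A $h i $h 1 * B $h 1 $h j + A $h i $h 2 * B $h 2 $h j"
  by (simp add: matrix_matrix_mult_def sum_2)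

lemma eq22_iff:
  fixes A B :: "real^2^2"
  shows "A = B \<longleftrightarrow> A $h 1 $h 1 = B $h 1 $h 1 \<and> A $h 1 $h 2 = B $h 1 $h 2 \<and>
    A $h 2 $h 1 = B $h 2 $h 1 \<and> A $h 2 $h 2 = B $h 2 $h 2"
  by (auto simp: Finite_Cartesian_Product.vec_eq_iff forall_2)

lemma adj22_entries [simp]:
  "adj22 A $h 1 $h 1 = A $h 2 $h 2" "adj22 A $h 1 $h 2 = - (A $h 1 $h 2)"
  "adj22 A $h 2 $h 1 = - (A $h 2 $h 1)" "adj22 A $h 2 $h 2 = A $h 1 $h 1"
  by (simp_all add: adj22_def)

lemma carrier_SL2R: "A \<in> carrier SL2R \<longleftrightarrow> A $h 1 $h 1 * A $h 2 $h 2 - A $h 1 $h 2 * A $h 2 $h 1 = 1"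
  by (simp add: SL2R_def det_2)

lemma mult_SL2R [simp]: "A \<otimes>\<^bsub>SL2R\<^esub> B = A ** B"
  by (simp add: SL2R_def)

lemma one_SL2R [simp]: "\<one>\<^bsub>SL2R\<^esub> = id22"
  by (simp add: SL2R_def)

lemma adj22_left: "A \<in> carrier SL2R \<Longrightarrow> adj22 A ** A = id22"
  by (simp add: eq22_iff mult22_entries carrier_SL2R algebra_simps)

lemma adj22_right: "A \<in> carrier SL2R \<Longrightarrow> A ** adj22 A = id22"
  by (simp add: eq22_iff mult22_entries carrier_SL2R algebra_simps)

lemma adj22_carrier: "A \<in> carrier SL2R \<Longrightarrow> adj22 A \<in> carrier SL2R"
  by (simp add: carrier_SL2R algebra_simps)

lemma adj22_adj22 [simp]: "adj22 (adj22 A) = A"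
  by (simp add: eq22_iff)

lemma adj22_mult: "adj22 (A ** B) = adj22 B ** adj22 A"
  by (simp add: eq22_iff mult22_entries algebra_simps)

lemma mult22_carrier: "A \<in> carrier SL2R \<Longrightarrow> B \<in> carrier SL2R \<Longrightarrow> A ** B \<in> carrier SL2R"
  by (simp add: SL2R_def det_mul)

lemma mult22_minus: "(- A) ** B = - (A ** B)" "A ** (- B) = - (A ** B)" for A B :: "real^2^2"
  by (simp_all add: eq22_iff mult22_entries)

lemma group_SL2R: "Group.group SL2R"
proof (rule Group.groupI)
  fix A assume A: "A \<in> carrier SL2R"
  then show "\<exists>B\<in>carrier SL2R. B \<otimes>\<^bsub>SL2R\<^esub> A = \<one>\<^bsub>SL2R\<^esub>"
    using adj22_left adj22_carrier by (auto intro!: bexI[of _ "adj22 A"])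
qed (simp_all add: mult22_carrier matrix_mul_assoc, simp add: carrier_SL2R)

lemma inv_SL2R: "A \<in> carrier SL2R \<Longrightarrow> inv\<^bsub>SL2R\<^esub> A = adj22 A"
  using Group.group.inv_equality[OF group_SL2R, of "adj22 A" A] by (simp add: adj22_left adj22_carrier)

lemma subgroup_SL2RD:
  assumes "subgroup G SL2R"
  shows "G \<subseteq> carrier SL2R" "id22 \<in> G" "\<And>A B. A \<in> G \<Longrightarrow> B \<in> G \<Longrightarrow> A ** B \<in> G"
    "\<And>A. A \<in> G \<Longrightarrow> adj22 A \<in> G"
proof -
  show sub: "G \<subseteq> carrier SL2R" by (rule subgroup.subset[OF assms])
  show "id22 \<in> G" using subgroup.one_closed[OF assms] by simp
  show "A ** B \<in> G" if "A \<in> G" "B \<in> G" for A B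
    using subgroup.m_closed[OF assms that] by simp
  show "adj22 A \<in> G" if "A \<in> G" for A
    using subgroup.m_inv_closed[OF assms that] inv_SL2R[of A] sub that by auto
qed

section \<open>The automorphy factor and the slash action\<close>

definition jfac :: "real^2^2 \<Rightarrow> complex \<Rightarrow> complex" where
  "jfac A \<tau> = of_real (A $h 2 $h 1) * \<tau> + of_real (A $h 2 $h 2)"

lemma jfac_nonzero:
  assumes "A \<in> carrier SL2R" "\<tau> \<in> upper_half"
  shows "jfac A \<tau> \<noteq> 0"
proof
  assume 0: "jfac A \<tau> = 0"
  have "A $h 2 $h 1 * Im \<tau> = 0"
    using arg_cong[OF 0, of Im] by (simp add: jfac_def)
  then have "A $h 2 $h 1 = 0" using assms(2) by (simp add: upper_half_def)
  moreover from this have "A $h 2 $h 2 = 0"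
    using 0 by (simp add: jfac_def)
  ultimately show False using assms(1) by (simp add: carrier_SL2R)
qed

lemma moebius_altdef: "moebius A \<tau> = (of_real (A $h 1 $h 1) * \<tau> + of_real (A $h 1 $h 2)) / jfac A \<tau>"
  by (simp add: moebius_def jfac_def)

lemma moebius_upper_half:
  assumes "A \<in> carrier SL2R" "\<tau> \<in> upper_half"
  shows "moebius A \<tau> \<in> upper_half"
proof -
  have "Im ((of_real (A $h 1 $h 1) * \<tau> + of_real (A $h 1 $h 2)) * cnj (jfac A \<tau>)) =
      (A $h 1 $h 1 * A $h 2 $h 2 - A $h 1 $h 2 * A $h 2 $h 1) * Im \<tau>"
    by (simp add: jfac_def algebra_simps)
  also have "\<dots> > 0"
    using assms by (simp add: carrier_SL2R upper_half_def)
  finally show ?thesis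
    by (simp add: moebius_altdef upper_half_def Im_complex_div_gt_0)
qed

lemma jfac_mult:
  assumes "B \<in> carrier SL2R" "\<tau> \<in> upper_half"
  shows "jfac (A ** B) \<tau> = jfac A (moebius B \<tau>) * jfac B \<tau>"
proof -
  have "jfac A (moebius B \<tau>) * jfac B \<tau> = of_real (A $h 2 $h 1) * (moebius B \<tau> * jfac B \<tau>)
      + of_real (A $h 2 $h 2) * jfac B \<tau>"
    by (simp add: jfac_def[of A] algebra_simps)
  also have "moebius B \<tau> * jfac B \<tau> = of_real (B $h 1 $h 1) * \<tau> + of_real (B $h 1 $h 2)"
    using jfac_nonzero[OF assms] by (simp add: moebius_altdef)
  finally show ?thesis
    by (simp add: jfac_def mult22_entries algebra_simps)
qed

lemma moebius_mult:
  assumes "A \<in> carrier SL2R" "B \<in> carrier SL2R" "\<tau> \<in> upper_half"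
  shows "moebius (A ** B) \<tau> = moebius A (moebius B \<tau>)"
proof -
  have nz: "jfac B \<tau> \<noteq> 0" "jfac A (moebius B \<tau>) \<noteq> 0"
    using jfac_nonzero moebius_upper_half assms by blast+
  have "(of_real (A $h 1 $h 1) * moebius B \<tau> + of_real (A $h 1 $h 2)) * jfac B \<tau> =
      of_real (A $h 1 $h 1) * (moebius B \<tau> * jfac B \<tau>) + of_real (A $h 1 $h 2) * jfac B \<tau>"
    by (simp add: algebra_simps)
  also have "moebius B \<tau> * jfac B \<tau> = of_real (B $h 1 $h 1) * \<tau> + of_real (B $h 1 $h 2)"
    using nz by (simp add: moebius_altdef)
  finally have "(of_real (A $h 1 $h 1) * moebius B \<tau> + of_real (A $h 1 $h 2)) * jfac B \<tau> =
      of_real ((A ** B) $h 1 $h 1) * \<tau> + of_real ((A ** B) $h 1 $h 2)"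
    by (simp add: jfac_def mult22_entries algebra_simps)
  then have "moebius (A ** B) \<tau> =
      ((of_real (A $h 1 $h 1) * moebius B \<tau> + of_real (A $h 1 $h 2)) * jfac B \<tau>) /
      (jfac A (moebius B \<tau>) * jfac B \<tau>)"
    by (simp add: moebius_altdef[of "A ** B"] jfac_mult[OF assms(2,3)])
  then show ?thesis
    using nz by (simp add: moebius_altdef[of A])
qed

lemma moebius_id [simp]: "moebius id22 \<tau> = \<tau>"
  by (simp add: moebius_def)

lemma jfac_id [simp]: "jfac id22 \<tau> = 1"
  by (simp add: jfac_def)

lemma holomorphic_moebius: "A \<in> carrier SL2R \<Longrightarrow> moebius A holomorphic_on upper_half"
  unfolding moebius_altdef using jfac_nonzero unfolding jfac_def by (intro holomorphic_intros) auto

definition scalar_slash :: "int \<Rightarrow> (complex \<Rightarrow> complex) \<Rightarrow> real^2^2 \<Rightarrow> complex \<Rightarrow> complex" where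
  "scalar_slash k f A \<tau> = jfac A \<tau> powi (- k) * f (moebius A \<tau>)"

lemma scalar_slash_mult:
  assumes "A \<in> carrier SL2R" "B \<in> carrier SL2R" "\<tau> \<in> upper_half"
  shows "scalar_slash k (scalar_slash k f A) B \<tau> = scalar_slash k f (A ** B) \<tau>"
  by (simp add: scalar_slash_def jfac_mult[OF assms(2,3)] moebius_mult[OF assms] power_int_mult_distrib)

lemma scalar_slash_cong:
  assumes "A \<in> carrier SL2R" "\<tau> \<in> upper_half" "\<And>w. w \<in> upper_half \<Longrightarrow> f w = g w"
  shows "scalar_slash k f A \<tau> = scalar_slash k g A \<tau>"
  using assms by (simp add: scalar_slash_def moebius_upper_half)

lemma holomorphic_scalar_slash:
  assumes "A \<in> carrier SL2R" "f holomorphic_on upper_half"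
  shows "scalar_slash k f A holomorphic_on upper_half"
proof -
  have "(\<lambda>\<tau>. f (moebius A \<tau>)) holomorphic_on upper_half"
    by (rule holomorphic_on_compose_gen[OF holomorphic_moebius[OF assms(1)] assms(2), unfolded o_def])
      (use assms moebius_upper_half in auto)
  moreover have "jfac A holomorphic_on upper_half"
    unfolding jfac_def by (intro holomorphic_intros)
  ultimately show ?thesis
    unfolding scalar_slash_def using jfac_nonzero[OF assms(1)]
    by (intro holomorphic_intros) auto
qed

lemma slash_index:
  assumes "A \<in> carrier SL2R" "\<tau> \<in> upper_half" "X \<in> upper_half \<rightarrow> carrier_vec m" "r < m"
  shows "slash k X A \<tau> $ r = scalar_slash k (\<lambda>\<tau>. X \<tau> $ r) A \<tau>"
proof -
  have "X (moebius A \<tau>) \<in> carrier_vec m"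
    using assms moebius_upper_half by blast
  then show ?thesis
    using assms(4) by (simp add: slash_def scalar_slash_def jfac_def)
qed

lemma slash_carrier:
  assumes "A \<in> carrier SL2R" "\<tau> \<in> upper_half" "X \<in> upper_half \<rightarrow> carrier_vec m"
  shows "slash k X A \<tau> \<in> carrier_vec m"
proof -
  have "X (moebius A \<tau>) \<in> carrier_vec m"
    using assms moebius_upper_half by blast
  then show ?thesis by (simp add: slash_def)
qed

section \<open>The matrices A_c and the action on the boundary\<close>

lemma cusp_mat_carrier: "cusp_mat \<cc> \<in> carrier SL2R"
  by (cases \<cc>) (simp_all add: carrier_SL2R)

text \<open>\<open>cusp_mat \<cc>\<close> sends infinity to \<open>\<cc>\<close>, so the condition
  says that the conjugated matrix fixes infinity, that is, is upper triangular. This trades the case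
  distinctions of the boundary action for matrix algebra.\<close>

lemma moebius_bd_iff:
  assumes "A \<in> carrier SL2R"
  shows "moebius_bd A \<cc> = \<dd> \<longleftrightarrow> (adj22 (cusp_mat \<dd>) ** A ** cusp_mat \<cc>) $h 2 $h 1 = 0"
proof -
  have det: "A $h 1 $h 1 * A $h 2 $h 2 - A $h 1 $h 2 * A $h 2 $h 1 = 1"
    using assms by (simp add: carrier_SL2R)
  have nz: "A $h 1 $h 1 * x + A $h 1 $h 2 \<noteq> 0" if "A $h 2 $h 1 * x + A $h 2 $h 2 = 0" for x
  proof
    assume 0: "A $h 1 $h 1 * x + A $h 1 $h 2 = 0"
    have "A $h 1 $h 1 * (A $h 2 $h 1 * x + A $h 2 $h 2) - A $h 2 $h 1 * (A $h 1 $h 1 * x + A $h 1 $h 2) = 1"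
      using det by (simp add: algebra_simps)
    then show False using 0 that by simp
  qed
  have nz': "A $h 1 $h 1 \<noteq> 0" if "A $h 2 $h 1 = 0"
    using that det by auto
  show ?thesis
  proof (cases \<cc>)
    case None
    then show ?thesis
      using nz' by (cases \<dd>) (auto simp: mult22_entries field_simps)
  next
    case (Some x)
    show ?thesis
    proof (cases \<dd>)
      case None
      then show ?thesis
        using Some nz[of x] by (auto simp: mult22_entries algebra_simps)
    next
      case d: (Some y)
      have "(adj22 (cusp_mat \<dd>) ** A ** cusp_mat \<cc>) $h 2 $h 1 =
          y * (A $h 2 $h 1 * x + A $h 2 $h 2) - (A $h 1 $h 1 * x + A $h 1 $h 2)"
        by (simp add: d Some mult22_entries algebra_simps)
      note entry = this
      show ?thesis
      proof (cases "A $h 2 $h 1 * x + A $h 2 $h 2 = 0")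
        case True
        then show ?thesis
          unfolding entry using nz[OF True] by (simp add: d Some)
      next
        case False
        then show ?thesis
          unfolding entry by (auto simp: d Some divide_eq_eq algebra_simps)
      qed
    qed
  qed
qed

text \<open>The conjugate of \<open>A ** B\<close> factors through \<open>cusp_mat \<dd>\<close>
  into two upper triangular matrices, and these are closed under products.\<close>

lemma moebius_bd_mult:
  assumes "A \<in> carrier SL2R" "B \<in> carrier SL2R" "moebius_bd B \<cc> = \<dd>" "moebius_bd A \<dd> = \<ee>"
  shows "moebius_bd (A ** B) \<cc> = \<ee>"
proof -
  let ?c = "cusp_mat \<cc>" and ?d = "cusp_mat \<dd>" and ?e = "cusp_mat \<ee>"
  have "adj22 ?e ** (A ** B) ** ?c = adj22 ?e ** A ** (?d ** adj22 ?d) ** B ** ?c"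
    by (simp add: adj22_right[OF cusp_mat_carrier] matrix_mul_assoc)
  also have "\<dots> = (adj22 ?e ** A ** ?d) ** (adj22 ?d ** B ** ?c)"
    by (simp add: matrix_mul_assoc)
  finally have *: "adj22 ?e ** (A ** B) ** ?c = (adj22 ?e ** A ** ?d) ** (adj22 ?d ** B ** ?c)" .
  show ?thesis
    using assms moebius_bd_iff[OF assms(1)] moebius_bd_iff[OF assms(2)]
    unfolding moebius_bd_iff[OF mult22_carrier[OF assms(1,2)]] *
    by (simp only: mult22_entries[of "adj22 ?e ** A ** ?d"])
qed

lemma moebius_bd_id [simp]: "moebius_bd id22 \<cc> = \<cc>"
  by (cases \<cc>) simp_all

lemma moebius_bd_adj22:
  assumes "A \<in> carrier SL2R" "moebius_bd A \<cc> = \<dd>"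
  shows "moebius_bd (adj22 A) \<dd> = \<cc>"
proof -
  define \<ee> where "\<ee> = moebius_bd (adj22 A) \<dd>"
  have "moebius_bd (adj22 A ** A) \<cc> = \<ee>"
    using moebius_bd_mult[OF adj22_carrier[OF assms(1)] assms] \<ee>_def by simp
  then show ?thesis
    using assms(1) by (simp add: adj22_left \<ee>_def)
qed

lemma trace_conj:
  assumes "B \<in> carrier SL2R"
  shows "Determinants.trace (adj22 B ** A ** B) = Determinants.trace A"
proof -
  have "Determinants.trace (adj22 B ** (A ** B)) = Determinants.trace ((A ** B) ** adj22 B)"
    by (rule trace_mul_sym)
  also have "(A ** B) ** adj22 B = A"
    using assms by (simp add: matrix_mul_assoc[symmetric] adj22_right)
  finally show ?thesis by (simp add: matrix_mul_assoc)
qed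

section \<open>Logarithmic expansions from growth\<close>

text \<open>The operator T - l, where T is the shift by \<open>h\<close>. Its s-th power annihilates
  the coordinates that belong to a Jordan block of size s with eigenvalue l.\<close>

definition twisted_diff :: "real \<Rightarrow> complex \<Rightarrow> (complex \<Rightarrow> complex) \<Rightarrow> complex \<Rightarrow> complex" where
  "twisted_diff h l f w = f (w + of_real h) - l * f w"

lemma twisted_diff_funpow_cong:
  assumes "\<And>w. w \<in> upper_half \<Longrightarrow> f w = g w" "w \<in> upper_half"
  shows "(twisted_diff h l ^^ s) f w = (twisted_diff h l ^^ s) g w"
  using assms(2)
proof (induction s arbitrary: w)
  case (Suc s)
  then show ?case
    by (simp add: twisted_diff_def[of h l "(twisted_diff h l ^^ s) f"]
        twisted_diff_def[of h l "(twisted_diff h l ^^ s) g"] upper_half_add_real)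
qed (use assms in auto)

lemma twisted_diff_funpow_zero: "(twisted_diff h l ^^ s) (\<lambda>w. 0) = (\<lambda>w. 0)"
  by (induction s) (auto simp: twisted_diff_def)

lemma twisted_diff_funpow_diff:
  "(twisted_diff h l ^^ s) (\<lambda>w. f w - g w) w = (twisted_diff h l ^^ s) f w - (twisted_diff h l ^^ s) g w"
proof (induction s arbitrary: w)
  case (Suc s)
  show ?case
    by (simp add: twisted_diff_def[of h l "(twisted_diff h l ^^ s) f"]
        twisted_diff_def[of h l "(twisted_diff h l ^^ s) g"]
        twisted_diff_def[of h l "(twisted_diff h l ^^ s) (\<lambda>w. f w - g w)"] Suc algebra_simps)
qed simp

lemma twisted_diff_funpow_cmult:
  "(twisted_diff h l ^^ s) (\<lambda>w. c * f w) w = c * (twisted_diff h l ^^ s) f w"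
proof (induction s arbitrary: w)
  case (Suc s)
  show ?case
    by (simp add: twisted_diff_def[of h l "(twisted_diff h l ^^ s) f"]
        twisted_diff_def[of h l "(twisted_diff h l ^^ s) (\<lambda>w. c * f w)"] Suc algebra_simps)
qed simp

lemma holomorphic_shift:
  assumes "f holomorphic_on upper_half"
  shows "(\<lambda>w. f (w + of_real b)) holomorphic_on upper_half"
  by (rule holomorphic_on_compose_gen[OF _ assms, unfolded o_def])
    (auto intro!: holomorphic_intros simp: upper_half_add_real)

lemma twisted_diff_funpow_regular:
  assumes "f holomorphic_on upper_half" "cusp_growth E f"
  shows "(twisted_diff h l ^^ s) f holomorphic_on upper_half" "cusp_growth E ((twisted_diff h l ^^ s) f)"
proof (induction s)
  case (Suc s)
  {
    case 1
    show ?case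
      using Suc by (auto simp: twisted_diff_def intro!: holomorphic_intros holomorphic_shift)
  next
    case 2
    show ?case
      using Suc cusp_growth_affine[of E "(twisted_diff h l ^^ s) f" 1 h]
      by (auto simp: twisted_diff_def[abs_def] intro!: cusp_growth_diff cusp_growth_cmult)
  }
qed (use assms in auto)

text \<open>The degree bound keeps the powers of log q below the block size when Newton polynomials
  are rewritten in monomials.\<close>

lemma gbinomial_poly:
  obtains p :: "complex poly" where "degree p \<le> k" "\<And>x. poly p x = x gchoose k"
proof -
  define p :: "complex poly" where "p = Polynomial.smult (1 / fact k) (\<Prod>i<k. [:- of_nat i, 1:])"
  have "degree (\<Prod>i<k. [:- of_nat i, 1 :: complex:]) \<le> k"
    using degree_prod_sum_le[of "{..<k}" "\<lambda>i. [:- of_nat i, 1 :: complex:]"] by simp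
  then have "degree p \<le> k"
    unfolding p_def using degree_smult_le order_trans by blast
  moreover have "poly p x = x gchoose k" for x
    by (simp add: p_def gbinomial_prod_rev poly_prod atLeast0LessThan)
  ultimately show ?thesis using that by blast
qed

lemma poly_lessThan:
  fixes p :: "complex poly"
  assumes "degree p < s"
  shows "poly p x = (\<Sum>i<s. coeff p i * x ^ i)"
  unfolding poly_altdef using assms
  by (intro sum.mono_neutral_left) (auto simp: coeff_eq_0)

text \<open>The Newton basis is adapted to the difference operator: \<open>twisted_diff h l\<close> lowers the index
  of \<open>w / h gchoose s\<close> by one.\<close>

lemma twisted_diff_funpow_gbinomial:
  assumes "h \<noteq> 0" and a: "\<And>w. w \<in> upper_half \<Longrightarrow> a (w + of_real h) = l * a w" and "w \<in> upper_half"
  shows "(twisted_diff h l ^^ s) (\<lambda>w. (w / of_real h gchoose s) * a w) w = l ^ s * a w"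
  using assms(3)
proof (induction s arbitrary: w)
  case (Suc s)
  have "twisted_diff h l (\<lambda>w. (w / of_real h gchoose Suc s) * a w) v =
      l * ((v / of_real h gchoose s) * a v)" if "v \<in> upper_half" for v
  proof -
    have "(v + of_real h) / of_real h = v / of_real h + 1"
      using assms(1) by (simp add: field_simps)
    then have "((v + of_real h) / of_real h gchoose Suc s) =
        (v / of_real h gchoose s) + (v / of_real h gchoose Suc s)"
      by (simp only: gbinomial_Suc_Suc)
    then show ?thesis
      using that by (simp add: twisted_diff_def a algebra_simps)
  qed
  then have "(twisted_diff h l ^^ s) (twisted_diff h l (\<lambda>w. (w / of_real h gchoose Suc s) * a w)) w =
      (twisted_diff h l ^^ s) (\<lambda>w. l * ((w / of_real h gchoose s) * a w)) w"
    using Suc.prems by (rule twisted_diff_funpow_cong)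
  also have "\<dots> = l * (l ^ s * a w)"
    by (simp only: twisted_diff_funpow_cmult Suc)
  finally show ?case by (simp only: funpow_Suc_right o_def power_Suc mult.assoc)
qed simp

lemma gbinomial_regular:
  fixes h :: real
  shows "(\<lambda>w. w / of_real h gchoose s) holomorphic_on A" "cusp_growth 0 (\<lambda>w. w / of_real h gchoose s)"
proof -
  obtain p :: "complex poly" where p: "\<And>x. poly p x = x gchoose s"
    using gbinomial_poly by blast
  have eq: "(w / of_real h gchoose s) =
      (\<Sum>i\<le>degree p. (coeff p i / of_real h ^ i) * (w ^ i * 1))" for w
    unfolding p[symmetric] by (simp add: poly_altdef power_divide)
  show "(\<lambda>w. w / of_real h gchoose s) holomorphic_on A"
    unfolding eq by (intro holomorphic_intros)
  show "cusp_growth 0 (\<lambda>w. w / of_real h gchoose s)"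
    unfolding eq by (intro cusp_growth_sum cusp_growth_cmult cusp_growth_power_mult cusp_growth_const)
qed

text \<open>By induction on \<open>s\<close>: the s-fold difference of f, divided by l^s, is the
  coefficient of the top Newton polynomial. After subtraction of that term, one application fewer of
  the operator annihilates the rest, and neither holomorphy nor the rate \<open>E\<close> is
  lost.\<close>

lemma twisted_decomposition:
  assumes "h > 0" "l \<noteq> 0"
  assumes "f holomorphic_on upper_half" "cusp_growth E f"
    and "\<And>w. w \<in> upper_half \<Longrightarrow> (twisted_diff h l ^^ s) f w = 0"
  obtains a where "\<And>j. j < s \<Longrightarrow> a j holomorphic_on upper_half" "\<And>j. j < s \<Longrightarrow> cusp_growth E (a j)"
    "\<And>j w. j < s \<Longrightarrow> w \<in> upper_half \<Longrightarrow> a j (w + of_real h) = l * a j w"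
    "\<And>w. w \<in> upper_half \<Longrightarrow> f w = (\<Sum>j<s. (w / of_real h gchoose j) * a j w)"
  using assms(3-5)
proof (induction s arbitrary: f thesis)
  case 0
  then show ?case by simp
next
  case (Suc s)
  define a where "a = (twisted_diff h l ^^ s) f"
  define b where "b = (\<lambda>w. inverse (l ^ s) * a w)"
  define f' where "f' = (\<lambda>w. f w - (w / of_real h gchoose s) * b w)"
  have a_reg: "a holomorphic_on upper_half" "cusp_growth E a"
    unfolding a_def using twisted_diff_funpow_regular Suc.prems(2,3) by blast+
  have a_per: "a (w + of_real h) = l * a w" if "w \<in> upper_half" for w
    using Suc.prems(4)[OF that] unfolding a_def[symmetric] funpow.simps o_def
    by (simp add: twisted_diff_def)
  have b_reg: "b holomorphic_on upper_half" "cusp_growth E b"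
    unfolding b_def using a_reg by (auto intro!: holomorphic_intros cusp_growth_cmult)
  have b_per: "b (w + of_real h) = l * b w" if "w \<in> upper_half" for w
    using a_per[OF that] by (simp add: b_def)
  have "f' holomorphic_on upper_half"
    unfolding f'_def by (intro holomorphic_intros Suc.prems b_reg gbinomial_regular)
  moreover have "cusp_growth E f'"
    unfolding f'_def using cusp_growth_mult[OF gbinomial_regular(2)[of h s] b_reg(2)] Suc.prems(3)
    by (intro cusp_growth_diff) auto
  moreover have "(twisted_diff h l ^^ s) f' w = 0" if "w \<in> upper_half" for w
    using assms(1,2) twisted_diff_funpow_gbinomial[where h = h and a = b and l = l and s = s, OF _ b_per that]
    unfolding f'_def twisted_diff_funpow_diff by (simp add: a_def[symmetric] b_def)
  ultimately obtain a' where a':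
    "\<And>j. j < s \<Longrightarrow> a' j holomorphic_on upper_half" "\<And>j. j < s \<Longrightarrow> cusp_growth E (a' j)"
    "\<And>j w. j < s \<Longrightarrow> w \<in> upper_half \<Longrightarrow> a' j (w + of_real h) = l * a' j w"
    "\<And>w. w \<in> upper_half \<Longrightarrow> f' w = (\<Sum>j<s. (w / of_real h gchoose j) * a' j w)"
    using Suc.IH by blast
  show ?case
  proof (rule Suc.prems(1)[of "\<lambda>j. if j < s then a' j else b"])
    fix w assume "w \<in> upper_half"
    have "f w = f' w + (w / of_real h gchoose s) * b w"
      by (simp add: f'_def)
    then show "f w = (\<Sum>j<Suc s. (w / of_real h gchoose j) * (if j < s then a' j else b) w)"
      using a'(4)[OF \<open>w \<in> upper_half\<close>] by simp
  qed (use a' b_reg b_per in auto)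
qed

text \<open>Unit modulus lets the definite description in \<open>mu\<close> denote: the argument in
  [0, 2 pi) supplies a value, and two values would differ by an integer.\<close>

lemma mu_bounds:
  assumes "norm l = 1"
  shows "0 \<le> mu l" "mu l < 1" "l = exp (2 * of_real pi * \<i> * of_real (mu l))"
proof -
  have ex: "0 \<le> Arg2pi l / (2 * pi) \<and> Arg2pi l / (2 * pi) < 1 \<and>
      l = exp (2 * of_real pi * \<i> * of_real (Arg2pi l / (2 * pi)))"
    using Arg2pi[of l] assms by (simp add: is_Arg_def field_simps)
  have uniq: "x = y" if "0 \<le> x \<and> x < 1 \<and> l = exp (2 * of_real pi * \<i> * of_real x)"
    "0 \<le> y \<and> y < 1 \<and> l = exp (2 * of_real pi * \<i> * of_real y)" for x y
  proof -
    have "exp (2 * of_real pi * \<i> * of_real x) = exp (2 * of_real pi * \<i> * complex_of_real y)"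
      using that by metis
    then obtain n :: int where "2 * of_real pi * \<i> * of_real x =
        2 * of_real pi * \<i> * of_real y + complex_of_real (of_int (2 * n) * pi) * \<i>"
      unfolding exp_eq by blast
    then have "2 * of_real pi * \<i> * of_real x = 2 * of_real pi * \<i> * complex_of_real (y + of_int n)"
      by (simp add: algebra_simps)
    then have "x = y + of_int n"
      by (simp only: mult_cancel_left of_real_eq_iff) simp
    then show ?thesis using that by auto
  qed
  have "0 \<le> mu l \<and> mu l < 1 \<and> l = exp (2 * of_real pi * \<i> * of_real (mu l))"
    unfolding mu_def by (rule theI') (use ex uniq in blast)
  then show "0 \<le> mu l" "mu l < 1" "l = exp (2 * of_real pi * \<i> * of_real (mu l))"
    by blast+
qed

text \<open>The Newton coefficients are regrouped into coefficients of powers of log q, and the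
  factor q^(-mu) removes the multiplier \<open>l\<close>, which leaves periodic functions with
  Laurent series. The factor shifts the rate, so the cut-off concerns mu + n instead of n.\<close>

lemma twisted_log_expansion:
  assumes h: "h > 0" and l: "norm l = 1"
    and f: "f holomorphic_on upper_half" "cusp_growth E f"
      "\<And>w. w \<in> upper_half \<Longrightarrow> (twisted_diff h l ^^ s) f w = 0"
  obtains c :: "nat \<Rightarrow> int \<Rightarrow> complex"
  where "\<And>j n. 2 * pi * (mu l + of_int n) / h < E \<Longrightarrow> c j n = 0"
    and "\<And>j w. w \<in> upper_half \<Longrightarrow> (\<lambda>n. c j n * exp (norm_log h w) powi n) summable_on UNIV"
    and "\<And>w. w \<in> upper_half \<Longrightarrow> f w = (\<Sum>j<s. norm_log h w ^ j * exp (of_real (mu l) * norm_log h w) *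
      (\<Sum>\<^sub>\<infinity>n. c j n * exp (norm_log h w) powi n))"
proof -
  have "l \<noteq> 0" using l by auto
  from twisted_decomposition[OF h this f] obtain a where
    a: "\<And>j. j < s \<Longrightarrow> a j holomorphic_on upper_half" "\<And>j. j < s \<Longrightarrow> cusp_growth E (a j)"
    "\<And>j w. j < s \<Longrightarrow> w \<in> upper_half \<Longrightarrow> a j (w + of_real h) = l * a j w"
    "\<And>w. w \<in> upper_half \<Longrightarrow> f w = (\<Sum>j<s. (w / of_real h gchoose j) * a j w)"
    by blast
  have "\<exists>p :: complex poly. degree p \<le> k \<and> (\<forall>x. poly p x = x gchoose k)" for k
    using gbinomial_poly by metis
  then obtain p :: "nat \<Rightarrow> complex poly" where
    p: "\<And>k. degree (p k) \<le> k" "\<And>k x. poly (p k) x = x gchoose k"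
    by metis
  \<comment> \<open>\<open>w / h\<close> equals log q divided by 2 pi i; once the Newton polynomials
    are expanded in monomials, \<open>A i\<close> collects everything that multiplies the i-th power
    of log q.\<close>
  define A where "A = (\<lambda>i w. \<Sum>j<s. (coeff (p j) i / (2 * of_real pi * \<i>) ^ i) * a j w)"
  define b where "b = (\<lambda>i w. A i w * exp (of_real (- mu l) * norm_log h w))"
  have f_A: "f w = (\<Sum>i<s. norm_log h w ^ i * A i w)" if "w \<in> upper_half" for w
  proof -
    have x: "w / of_real h = norm_log h w / (2 * of_real pi * \<i>)"
      by (simp add: norm_log_def)
    have "f w = (\<Sum>j<s. \<Sum>i<s. coeff (p j) i * (w / of_real h) ^ i * a j w)"
      unfolding a(4)[OF that]
    proof (rule sum.cong)
      fix j assume "j \<in> {..<s}"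
      then have "degree (p j) < s" using p(1)[of j] by simp
      then show "(w / of_real h gchoose j) * a j w = (\<Sum>i<s. coeff (p j) i * (w / of_real h) ^ i * a j w)"
        unfolding p(2)[symmetric] poly_lessThan[OF \<open>degree (p j) < s\<close>] by (simp add: sum_distrib_right)
    qed simp
    also have "\<dots> = (\<Sum>i<s. \<Sum>j<s. coeff (p j) i * (w / of_real h) ^ i * a j w)"
      by (rule sum.swap)
    also have "\<dots> = (\<Sum>i<s. norm_log h w ^ i * A i w)"
      unfolding x A_def sum_distrib_left by (simp add: power_divide mult_ac)
    finally show ?thesis .
  qed
  have A_per: "A i (w + of_real h) = l * A i w" if "w \<in> upper_half" for i w
    unfolding A_def sum_distrib_left using that a(3) by (intro sum.cong) (simp_all add: mult_ac)
  have A_reg: "A i holomorphic_on upper_half" "cusp_growth E (A i)" for i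
    unfolding A_def
    by (intro holomorphic_intros a(1), simp, simp, intro cusp_growth_sum cusp_growth_cmult a(2), simp)
  have b_hol: "b i holomorphic_on upper_half" for i
    unfolding b_def using A_reg(1) by (auto intro!: holomorphic_intros)
  have b_growth: "cusp_growth (E + 2 * pi * (- mu l) / h) (b i)" for i
    unfolding b_def by (rule cusp_growth_mult[OF A_reg(2) cusp_growth_exp_norm_log])
  have b_per: "b i (w + of_real h) = b i w" if "w \<in> upper_half" for i w
  proof -
    have "exp (of_real (- mu l) * norm_log h (w + of_real h)) =
        exp (of_real (- mu l) * norm_log h w) * exp (- (2 * of_real pi * \<i> * of_real (mu l)))"
      using h by (simp add: norm_log_add exp_add[symmetric] algebra_simps)
    also have "exp (- (2 * of_real pi * \<i> * of_real (mu l))) = inverse l"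
      by (subst mu_bounds(3)[OF l]) (simp add: exp_minus)
    finally show ?thesis
      using \<open>l \<noteq> 0\<close> by (simp add: b_def A_per[OF that])
  qed
  have "\<exists>c :: int \<Rightarrow> complex. (\<forall>n. 2 * pi * of_int n / h < E + 2 * pi * (- mu l) / h \<longrightarrow> c n = 0) \<and>
      (\<forall>w\<in>upper_half. ((\<lambda>n. c n * exp (norm_log h w) powi n) has_sum b i w) UNIV)" for i
    by (rule periodic_laurent_series[OF h b_hol b_per b_growth, of i]) blast+
  then obtain c :: "nat \<Rightarrow> int \<Rightarrow> complex" where
    c: "\<And>i n. 2 * pi * of_int n / h < E + 2 * pi * (- mu l) / h \<Longrightarrow> c i n = 0"
    "\<And>i w. w \<in> upper_half \<Longrightarrow> ((\<lambda>n. c i n * exp (norm_log h w) powi n) has_sum b i w) UNIV"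
    by metis
  show ?thesis
  proof (rule that[of c])
    fix j n assume "2 * pi * (mu l + of_int n) / h < E"
    then show "c j n = 0"
      using h by (intro c(1)) (simp add: field_simps)
  next
    fix w assume w: "w \<in> upper_half"
    have "A j w = exp (of_real (mu l) * norm_log h w) * (\<Sum>\<^sub>\<infinity>n. c j n * exp (norm_log h w) powi n)" for j
      unfolding infsumI[OF c(2)[OF w]] by (simp add: b_def exp_minus)
    then show "f w = (\<Sum>j<s. norm_log h w ^ j * exp (of_real (mu l) * norm_log h w) *
        (\<Sum>\<^sub>\<infinity>n. c j n * exp (norm_log h w) powi n))"
      unfolding f_A[OF w] by (simp add: mult.assoc)
  qed (use c(2) has_sum_imp_summable in blast)
qed

text \<open>With the ones above the diagonal, T - l takes coordinate p to coordinate p + 1 and the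
  last coordinate to 0, so the chain ends after s - p steps.\<close>

lemma jordan_block_twisted:
  fixes G :: "complex \<Rightarrow> complex Matrix.vec"
  assumes G: "\<And>w. w \<in> upper_half \<Longrightarrow> G w \<in> carrier_vec s"
    and per: "\<And>w. w \<in> upper_half \<Longrightarrow> G (w + of_real h) = jordan_block s l *\<^sub>v G w"
    and "p < s" "w \<in> upper_half"
  shows "(twisted_diff h l ^^ s) (\<lambda>w. G w $ p) w = 0"
proof -
  have step: "twisted_diff h l (\<lambda>w. G w $ p) w = (if Suc p < s then G w $ Suc p else 0)"
    if "p < s" "w \<in> upper_half" for p w
  proof -
    have "G (w + of_real h) $ p = (\<Sum>j\<in>{0..<s}. (if p = j then l else if Suc p = j then 1 else 0) * G w $ j)"
      using G[OF that(2)] that by (simp add: per scalar_prod_def)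
    also have "\<dots> = (\<Sum>j\<in>{0..<s}. (if p = j then l * G w $ j else 0) + (if Suc p = j then G w $ j else 0))"
      by (rule sum.cong) auto
    also have "\<dots> = l * G w $ p + (if Suc p < s then G w $ Suc p else 0)"
      using that by (simp add: sum.distrib)
    finally show ?thesis by (simp add: twisted_diff_def)
  qed
  have "(twisted_diff h l ^^ t) (\<lambda>w. G w $ p) w = 0" if "p < s" "s - p \<le> t" "w \<in> upper_half" for t p w
    using that
  proof (induction t arbitrary: p)
    case (Suc t)
    have "(twisted_diff h l ^^ t) (twisted_diff h l (\<lambda>w. G w $ p)) w =
        (twisted_diff h l ^^ t) (\<lambda>w. if Suc p < s then G w $ Suc p else 0) w"
      using step[OF Suc.prems(1)] Suc.prems(3) by (rule twisted_diff_funpow_cong)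
    also have "\<dots> = 0"
      using Suc by (cases "Suc p < s") (auto simp: twisted_diff_funpow_zero)
    finally show ?case by (simp only: funpow_Suc_right o_def)
  qed auto
  then show ?thesis using assms(3,4) by auto
qed

text \<open>Each coordinate lies in one diagonal block. Splitting the vector after the first block
  separates the equation, and the block index in the shorter list is one less.\<close>

lemma jordan_matrix_twisted:
  fixes G :: "complex \<Rightarrow> complex Matrix.vec"
  assumes "\<And>w. w \<in> upper_half \<Longrightarrow> G w \<in> carrier_vec (sum_list (map fst bs))"
    and "\<And>w. w \<in> upper_half \<Longrightarrow> G (w + of_real h) = jordan_matrix bs *\<^sub>v G w"
    and "p < sum_list (map fst bs)"
  shows "\<exists>i<length bs. \<forall>w\<in>upper_half. (twisted_diff h (snd (bs ! i)) ^^ fst (bs ! i)) (\<lambda>w. G w $ p) w = 0"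
  using assms
proof (induction bs arbitrary: G p)
  case (Cons b bs)
  obtain s l where b: "b = (s, l)" by force
  define n where "n = sum_list (map fst bs)"
  define G1 where "G1 = (\<lambda>w. vec_first (G w) s)"
  define G2 where "G2 = (\<lambda>w. vec_last (G w) n)"
  have Gc: "G w \<in> carrier_vec (s + n)" if "w \<in> upper_half" for w
    using Cons.prems(1)[OF that] by (simp add: b n_def)
  have split: "G w = G1 w @\<^sub>v G2 w" if "w \<in> upper_half" for w
    using Gc[OF that] by (simp add: G1_def G2_def)
  have c1: "G1 w \<in> carrier_vec s" and c2: "G2 w \<in> carrier_vec n" for w
    by (simp_all add: G1_def G2_def)
  have "G (w + of_real h) = (jordan_block s l *\<^sub>v G1 w) @\<^sub>v (jordan_matrix bs *\<^sub>v G2 w)"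
    if w: "w \<in> upper_half" for w
  proof -
    have "G (w + of_real h) = four_block_mat (jordan_block s l) (0\<^sub>m s n) (0\<^sub>m n s) (jordan_matrix bs) *\<^sub>v
        (G1 w @\<^sub>v G2 w)"
      using Cons.prems(2)[OF w] by (simp add: b jordan_matrix_Cons n_def split[OF w])
    also have "\<dots> = (jordan_block s l *\<^sub>v G1 w) @\<^sub>v (jordan_matrix bs *\<^sub>v G2 w)"
      by (rule mult_mat_vec_split[OF _ _ c1 c2]) (auto simp: n_def jordan_block_def)
    finally show ?thesis .
  qed
  then have this_eq: "G1 (w + of_real h) @\<^sub>v G2 (w + of_real h) =
      (jordan_block s l *\<^sub>v G1 w) @\<^sub>v (jordan_matrix bs *\<^sub>v G2 w)" if "w \<in> upper_half" for w
    using that split[OF upper_half_add_real[OF that, of h]] by simp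
  then have per: "G1 (w + of_real h) = jordan_block s l *\<^sub>v G1 w \<and>
      G2 (w + of_real h) = jordan_matrix bs *\<^sub>v G2 w" if "w \<in> upper_half" for w
  proof -
    have "jordan_block s l *\<^sub>v G1 w \<in> carrier_vec s"
      by (intro mult_mat_vec_carrier[OF _ c1]) (simp add: jordan_block_def)
    from this_eq[OF that, unfolded append_vec_eq[OF c1 this]] show ?thesis .
  qed
  show ?case
  proof (cases "p < s")
    case True
    have "(twisted_diff h l ^^ s) (\<lambda>w. G w $ p) w = 0" if "w \<in> upper_half" for w
    proof -
      have "(twisted_diff h l ^^ s) (\<lambda>w. G w $ p) w = (twisted_diff h l ^^ s) (\<lambda>w. G1 w $ p) w"
        using True that by (intro twisted_diff_funpow_cong) (simp_all add: G1_def vec_first_def)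
      also have "\<dots> = 0"
        using per c1 True that by (intro jordan_block_twisted) auto
      finally show ?thesis .
    qed
    then show ?thesis by (intro exI[of _ 0]) (simp add: b)
  next
    case False
    then have p: "p - s < n" using Cons.prems(3) by (simp add: b n_def)
    have "\<exists>i<length bs. \<forall>w\<in>upper_half.
        (twisted_diff h (snd (bs ! i)) ^^ fst (bs ! i)) (\<lambda>w. G2 w $ (p - s)) w = 0"
      using Cons.IH[of G2 "p - s"] c2 per p by (simp add: n_def)
    then obtain i where i: "i < length bs"
      "\<And>w. w \<in> upper_half \<Longrightarrow> (twisted_diff h (snd (bs ! i)) ^^ fst (bs ! i)) (\<lambda>w. G2 w $ (p - s)) w = 0"
      by blast
    have "(twisted_diff h (snd (bs ! i)) ^^ fst (bs ! i)) (\<lambda>w. G w $ p) w = 0" if "w \<in> upper_half" for w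
    proof -
      have "G v $ p = G2 v $ (p - s)" if "v \<in> upper_half" for v
        using False p Gc[OF that] c1[of v] c2[of v] by (simp add: split[OF that])
      then have "(twisted_diff h (snd (bs ! i)) ^^ fst (bs ! i)) (\<lambda>w. G w $ p) w =
          (twisted_diff h (snd (bs ! i)) ^^ fst (bs ! i)) (\<lambda>w. G2 w $ (p - s)) w"
        using that by (rule twisted_diff_funpow_cong)
      then show ?thesis using i(2)[OF that] by simp
    qed
    then show ?thesis using i(1) by (intro exI[of _ "Suc i"]) simp
  qed
qed simp

section \<open>Cusp stabilizers of discrete groups\<close>

lemma to_PSL_eq: "to_PSL A = {A, - A}"
  unfolding to_PSL_def r_coset_def by (auto simp: mult22_minus)

lemma to_PSL_eqD: "to_PSL A = to_PSL B \<Longrightarrow> A = B \<or> A = - B"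
  by (auto simp: to_PSL_eq doubleton_eq_iff)

lemma normal_center_SL2R: "{id22, - id22} \<lhd> SL2R"
proof -
  interpret Group.group SL2R by (rule group_SL2R)
  have carr: "id22 \<in> carrier SL2R" "- id22 \<in> carrier SL2R"
    by (simp_all add: carrier_SL2R)
  have "subgroup {id22, - id22} SL2R"
  proof (rule subgroupI)
    fix A assume "A \<in> {id22, - id22}"
    then show "inv\<^bsub>SL2R\<^esub> A \<in> {id22, - id22}"
    proof -
      have "inv\<^bsub>SL2R\<^esub> A = A"
        using \<open>A \<in> _\<close> carr inv_SL2R[of A] by (auto simp: eq22_iff[of "adj22 _"])
      then show ?thesis using \<open>A \<in> _\<close> by simp
    qed
  qed (use carr in \<open>auto simp: mult22_minus\<close>)
  then show ?thesis
    unfolding normal_inv_iff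
    using inv_SL2R by (auto simp: mult22_minus adj22_right)
qed

lemma group_hom_to_PSL: "group_hom SL2R PSL2R to_PSL"
proof -
  interpret normal "{id22, - id22}" SL2R by (rule normal_center_SL2R)
  show ?thesis
    unfolding group_hom_def group_hom_axioms_def PSL2R_def
    using factorgroup_is_group r_coset_hom_Mod group_SL2R
    by (simp add: to_PSL_def[abs_def])
qed

text \<open>\<open>h\<close> is the infimum of the positive elements. The gap \<open>d\<close> makes
  it a minimum, and division with remainder excludes anything between its multiples.\<close>

lemma discrete_subgroup_real:
  fixes L :: "real set"
  assumes diff: "\<And>x y. x \<in> L \<Longrightarrow> y \<in> L \<Longrightarrow> x - y \<in> L"
    and d: "d > 0" "\<And>x. x \<in> L \<Longrightarrow> \<bar>x\<bar> < d \<Longrightarrow> x = 0"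
    and p: "p \<in> L" "p \<noteq> 0"
  obtains h where "h > 0" "L = range (\<lambda>n::int. of_int n * h)"
proof -
  have zero: "0 \<in> L" using diff[OF p(1) p(1)] by simp
  have neg: "- x \<in> L" if "x \<in> L" for x using diff[OF zero that] by simp
  have add: "x + y \<in> L" if "x \<in> L" "y \<in> L" for x y using diff[OF that(1) neg[OF that(2)]] by simp
  define P where "P = {x \<in> L. x > 0}"
  have Pne: "P \<noteq> {}"
    using p neg[OF p(1)] by (cases "p > 0") (auto simp: P_def)
  have Pd: "d \<le> x" if "x \<in> P" for x
    using d(2)[of x] that by (force simp: P_def)
  have bdd: "bdd_below P" by (rule bdd_belowI[of _ d]) (rule Pd)
  define h where "h = Inf P"
  have hd: "d \<le> h" unfolding h_def by (rule cInf_greatest[OF Pne Pd])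
  have hle: "h \<le> x" if "x \<in> P" for x unfolding h_def by (rule cInf_lower[OF that bdd])
  have hL: "h \<in> L"
  proof -
    \<comment> \<open>Two distinct positive elements this close to the infimum would differ by less
      than \<open>d\<close>; hence the one found here is \<open>h\<close> itself.\<close>
    obtain x where x: "x \<in> P" "x < h + d"
      using cInf_lessD[OF Pne, of "h + d"] d(1) by (auto simp: h_def)
    have "x = h"
    proof (rule ccontr)
      assume "x \<noteq> h"
      then have "h < x" using hle[OF x(1)] by simp
      then obtain y where y: "y \<in> P" "y < x"
        using cInf_lessD[OF Pne, of x] by (auto simp: h_def)
      have "x - y = 0"
        using x y hle[OF y(1)] by (intro d(2) diff) (auto simp: P_def)
      then show False using y by simp
    qed
    then show ?thesis using x by (simp add: P_def)
  qed
  have h0: "h > 0" using hd d(1) by simp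
  have nat: "of_nat n * h \<in> L" for n
    by (induction n) (auto simp: algebra_simps zero intro!: add hL)
  have int: "of_int n * h \<in> L" for n
    using nat[of "nat n"] neg[OF nat[of "nat (- n)"]] by (cases "n \<ge> 0") auto
  have "x \<in> range (\<lambda>n::int. of_int n * h)" if "x \<in> L" for x
  proof -
    define r where "r = x - of_int \<lfloor>x / h\<rfloor> * h"
    have "of_int \<lfloor>x / h\<rfloor> * h \<le> x" "x < (of_int \<lfloor>x / h\<rfloor> + 1) * h"
      using h0 floor_divide_lower[of h x] floor_divide_upper[of h x] by simp_all
    then have "0 \<le> r" "r < h" by (simp_all add: r_def algebra_simps)
    moreover have "r \<in> L" unfolding r_def by (intro diff that int)
    ultimately have "r = 0" using hle[of r] by (force simp: P_def)
    then show ?thesis by (auto simp: r_def)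
  qed
  then have "L = range (\<lambda>n::int. of_int n * h)" using int by auto
  then show ?thesis using that h0 by blast
qed

text \<open>Discreteness is given in PSL_2(R). The open set that isolates the identity there is
  pulled back along the quotient map and contains a ball of SL_2(R) around the identity; the kernel
  leaves the sign open.\<close>

lemma fuchsian_isolated:
  assumes G: "G \<subseteq> carrier SL2R" "id22 \<in> G"
    and fuchs: "fuchsian_first_kind (to_PSL ` G)"
  obtains e where "e > 0" "\<And>A. A \<in> G \<Longrightarrow> dist id22 A < e \<Longrightarrow> A = id22 \<or> A = - id22"
proof -
  have "openin (subtopology PSL2R_topology (to_PSL ` G)) {to_PSL id22}"
    using fuchs G(2) by (simp add: fuchsian_first_kind_def)
  then obtain U where U: "openin PSL2R_topology U" "{to_PSL id22} = U \<inter> to_PSL ` G"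
    by (auto simp: openin_subtopology)
  have "openin (top_of_set (carrier SL2R)) {A \<in> carrier SL2R. to_PSL A \<in> U}"
    using U(1) by (simp add: PSL2R_topology_def openin_quotient_topology)
  moreover have "id22 \<in> {A \<in> carrier SL2R. to_PSL A \<in> U}"
    using U(2) G by auto
  ultimately obtain e where e: "e > 0" "ball id22 e \<inter> carrier SL2R \<subseteq> {A \<in> carrier SL2R. to_PSL A \<in> U}"
    unfolding openin_contains_ball by blast
  show ?thesis
  proof (rule that[OF e(1)])
    fix A assume A: "A \<in> G" "dist id22 A < e"
    then have "to_PSL A \<in> U \<inter> to_PSL ` G" using e(2) G(1) by auto
    then have "to_PSL A = to_PSL id22" using U(2) by blast
    then show "A = id22 \<or> A = - id22" by (rule to_PSL_eqD)
  qed
qed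

section \<open>Translations at a cusp and its stabilizer\<close>

lemma upper_unipotent_mult: "mat22 1 x 0 1 ** mat22 1 y 0 1 = mat22 1 (x + y) 0 1"
  by (simp add: eq22_iff mult22_entries)

lemma upper_unipotent_carrier: "mat22 1 x 0 1 \<in> carrier SL2R"
  by (simp add: carrier_SL2R)

lemma cusp_translation_eq: "cusp_translation \<cc> x = cusp_mat \<cc> ** mat22 1 x 0 1 ** adj22 (cusp_mat \<cc>)"
  by (simp add: cusp_translation_def inv_SL2R cusp_mat_carrier)

lemma cusp_translation_carrier: "cusp_translation \<cc> x \<in> carrier SL2R"
  unfolding cusp_translation_eq
  by (intro mult22_carrier adj22_carrier cusp_mat_carrier upper_unipotent_carrier)

lemma conj_mult22:
  assumes "S \<in> carrier SL2R"
  shows "(S ** A ** adj22 S) ** (S ** B ** adj22 S) = S ** (A ** B) ** adj22 S"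
proof -
  have "(S ** A ** adj22 S) ** (S ** B ** adj22 S) = S ** A ** (adj22 S ** S) ** B ** adj22 S"
    by (simp add: matrix_mul_assoc)
  then show ?thesis
    using assms by (simp add: adj22_left matrix_mul_assoc)
qed

lemma cusp_translation_add: "cusp_translation \<cc> x ** cusp_translation \<cc> y = cusp_translation \<cc> (x + y)"
  unfolding cusp_translation_eq conj_mult22[OF cusp_mat_carrier] upper_unipotent_mult ..

lemma cusp_translation_0: "cusp_translation \<cc> 0 = id22"
proof -
  have "mat22 1 0 0 1 = id22" by (simp add: eq22_iff)
  then show ?thesis by (simp add: cusp_translation_eq adj22_right cusp_mat_carrier)
qed

lemma adj22_cusp_translation: "adj22 (cusp_translation \<cc> x) = cusp_translation \<cc> (- x)"
proof -
  have "adj22 (mat22 1 x 0 1) = mat22 1 (- x) 0 1"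
    by (simp add: eq22_iff)
  then show ?thesis by (simp add: cusp_translation_eq adj22_mult matrix_mul_assoc)
qed

lemma trace_cusp_translation: "Determinants.trace (cusp_translation \<cc> x) = 2"
  using trace_conj[OF adj22_carrier[OF cusp_mat_carrier], of \<cc> "mat22 1 x 0 1"]
  by (simp add: cusp_translation_eq matrix_mul_assoc Determinants.trace_def sum_2)

lemma moebius_bd_cusp_translation: "moebius_bd (cusp_translation \<cc> x) \<cc> = \<cc>"
  unfolding moebius_bd_iff[OF cusp_translation_carrier] cusp_translation_eq
  using carrier_SL2R[of "cusp_mat \<cc>"] cusp_mat_carrier[of \<cc>]
  by (cases \<cc>) (simp_all add: mult22_entries algebra_simps)

text \<open>The trace 2 tells a translation from the negative of one. The disjunction is the form in
  which equality in PSL_2(R) becomes available.\<close>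

lemma cusp_translation_eqD:
  assumes "cusp_translation \<cc> x = A \<or> cusp_translation \<cc> x = - A" "A = cusp_translation \<cc> y"
  shows "x = y"
proof -
  have "cusp_translation \<cc> x \<noteq> - cusp_translation \<cc> y"
  proof
    assume "cusp_translation \<cc> x = - cusp_translation \<cc> y"
    then have "Determinants.trace (cusp_translation \<cc> x) = - Determinants.trace (cusp_translation \<cc> y)"
      by (simp add: Determinants.trace_def sum_2)
    then show False by (simp add: trace_cusp_translation)
  qed
  then have "cusp_translation \<cc> x = cusp_translation \<cc> y"
    using assms by auto
  then show ?thesis
    by (cases \<cc>) (auto simp: cusp_translation_eq eq22_iff mult22_entries)
qed

text \<open>A translation differs from the identity by \<open>x\<close> times a fixed matrix. Thus
  isolation of the identity in the group isolates 0 among the translation lengths.\<close>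

lemma dist_cusp_translation:
  obtains N where "N > 0" "\<And>x. dist id22 (cusp_translation \<cc> x) \<le> N * \<bar>x\<bar>"
proof -
  define M where "M = cusp_mat \<cc> ** mat22 0 1 0 0 ** adj22 (cusp_mat \<cc>)"
  have "cusp_translation \<cc> x - id22 = x *\<^sub>R M" for x
    using carrier_SL2R[of "cusp_mat \<cc>"] cusp_mat_carrier[of \<cc>]
    by (simp add: cusp_translation_eq M_def eq22_iff mult22_entries algebra_simps)
  moreover have "dist id22 (cusp_translation \<cc> x) = norm (cusp_translation \<cc> x - id22)" for x
    by (simp add: dist_norm norm_minus_commute)
  ultimately have "dist id22 (cusp_translation \<cc> x) = \<bar>x\<bar> * norm M" for x
    by simp
  then have "dist id22 (cusp_translation \<cc> x) \<le> (norm M + 1) * \<bar>x\<bar>" for x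
    by (simp add: algebra_simps)
  then show ?thesis
    using that[of "norm M + 1"] by (simp add: add_nonneg_pos)
qed

lemma fixing_cusp:
  assumes "A \<in> carrier SL2R" "moebius_bd A \<cc> = \<cc>"
  obtains a b d where "a * d = 1" "A = cusp_mat \<cc> ** mat22 a b 0 d ** adj22 (cusp_mat \<cc>)"
    "Determinants.trace A = a + d"
proof -
  define B where "B = adj22 (cusp_mat \<cc>) ** A ** cusp_mat \<cc>"
  have c: "cusp_mat \<cc> \<in> carrier SL2R" by (rule cusp_mat_carrier)
  have "B \<in> carrier SL2R"
    unfolding B_def by (intro mult22_carrier adj22_carrier c assms)
  moreover have B21: "B $h 2 $h 1 = 0"
    using assms moebius_bd_iff by (simp add: B_def)
  ultimately have "B $h 1 $h 1 * B $h 2 $h 2 = 1" by (simp add: carrier_SL2R)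
  moreover have B: "B = mat22 (B $h 1 $h 1) (B $h 1 $h 2) 0 (B $h 2 $h 2)"
    using B21 by (simp add: eq22_iff)
  have "cusp_mat \<cc> ** B ** adj22 (cusp_mat \<cc>) =
      (cusp_mat \<cc> ** adj22 (cusp_mat \<cc>)) ** A ** (cusp_mat \<cc> ** adj22 (cusp_mat \<cc>))"
    by (simp add: B_def matrix_mul_assoc)
  then have "A = cusp_mat \<cc> ** mat22 (B $h 1 $h 1) (B $h 1 $h 2) 0 (B $h 2 $h 2) ** adj22 (cusp_mat \<cc>)"
    unfolding B[symmetric] by (simp add: adj22_right[OF c])
  moreover have "Determinants.trace A = B $h 1 $h 1 + B $h 2 $h 2"
    unfolding trace_conj[OF c, symmetric, of A] B_def[symmetric]
    by (simp add: Determinants.trace_def sum_2)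
  ultimately show ?thesis by (rule that)
qed

text \<open>Conjugated to infinity, the diagonal entries have product 1 and sum 2 or -2, so both are
  1 or both are -1.\<close>

lemma parabolic_fixing_cusp:
  assumes "A \<in> carrier SL2R" "moebius_bd A \<cc> = \<cc>" "parabolic A"
  obtains x where "A = cusp_translation \<cc> x \<or> A = - cusp_translation \<cc> x"
proof -
  obtain a b d where abd: "a * d = 1" "A = cusp_mat \<cc> ** mat22 a b 0 d ** adj22 (cusp_mat \<cc>)"
    "Determinants.trace A = a + d"
    using fixing_cusp[OF assms(1,2)] by blast
  have "a + d = 2 \<or> a + d = - 2" using assms(3) abd(3) by (simp add: parabolic_def)
  then have "(a - 1) * (a - 1) = 0 \<or> (a + 1) * (a + 1) = 0"
  proof
    assume "a + d = 2"
    then have "a * (2 - a) = 1" using abd(1) by (metis add_diff_cancel_left')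
    then show ?thesis by (simp add: algebra_simps)
  next
    assume "a + d = - 2"
    then have "a * (- 2 - a) = 1" using abd(1) by (metis add_diff_cancel_left')
    then show ?thesis by (simp add: algebra_simps)
  qed
  then have "a = 1 \<and> d = 1 \<or> a = - 1 \<and> d = - 1"
    using abd(1) by (auto simp: add_eq_0_iff)
  then show ?thesis
  proof
    assume "a = 1 \<and> d = 1"
    then show ?thesis using that[of b] abd(2) by (simp add: cusp_translation_eq)
  next
    assume ad: "a = - 1 \<and> d = - 1"
    then have "mat22 a b 0 d = - mat22 1 (- b) 0 1" by (simp add: eq22_iff)
    then show ?thesis using that[of "- b"] abd(2) by (simp add: cusp_translation_eq mult22_minus)
  qed
qed

lemma int_pow_cusp_translation:
  "to_PSL (cusp_translation \<cc> h) [^]\<^bsub>PSL2R\<^esub> (n :: int) = to_PSL (cusp_translation \<cc> (of_int n * h))"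
proof -
  interpret group_hom SL2R PSL2R to_PSL by (rule group_hom_to_PSL)
  have nat: "cusp_translation \<cc> h [^]\<^bsub>SL2R\<^esub> (n :: nat) = cusp_translation \<cc> (of_nat n * h)" for n
    by (induction n) (simp_all add: cusp_translation_0 cusp_translation_add algebra_simps)
  have "cusp_translation \<cc> h [^]\<^bsub>SL2R\<^esub> n = cusp_translation \<cc> (of_int n * h)"
  proof (cases n rule: int_cases2)
    case (nonneg k)
    then show ?thesis using nat[of k] int_pow_int[of SL2R "cusp_translation \<cc> h" k] by simp
  next
    case (nonpos k)
    have "cusp_translation \<cc> h [^]\<^bsub>SL2R\<^esub> (- int k) = inv\<^bsub>SL2R\<^esub> (cusp_translation \<cc> h [^]\<^bsub>SL2R\<^esub> k)"
      using group.int_pow_neg_int[OF group_SL2R cusp_translation_carrier] by blast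
    also have "\<dots> = cusp_translation \<cc> (- (of_nat k * h))"
      unfolding nat by (simp add: inv_SL2R[OF cusp_translation_carrier] adj22_cusp_translation)
    finally show ?thesis using nonpos by simp
  qed
  then show ?thesis
    using hom_int_pow[OF cusp_translation_carrier, of \<cc> h n] by simp
qed

text \<open>This shows that the definite description in \<open>cusp_width\<close> denotes. The
  translation lengths in \<open>G\<close> form a discrete subgroup of the reals, nonzero because
  \<open>\<cc>\<close> is a cusp. The point is that the stabilizer contains nothing else up to sign:
  a hyperbolic element fixing \<open>\<cc>\<close> would rescale this subgroup.\<close>

lemma cusp_width_exists:
  assumes sub: "subgroup G SL2R" and neg: "- id22 \<in> G"
    and fuchs: "fuchsian_first_kind (to_PSL ` G)" and cusp: "\<cc> \<in> cusps G"
  shows "cusp_width G \<cc> > 0" "cusp_gen G \<cc> \<in> G"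
proof -
  note G = subgroup_SL2RD[OF sub]
  have negG: "- A \<in> G" if "A \<in> G" for A
    using G(3)[OF neg that] by (simp add: mult22_minus)
  define L where "L = {x. cusp_translation \<cc> x \<in> G}"
  have diff: "x - y \<in> L" if "x \<in> L" "y \<in> L" for x y
    using G(3)[of "cusp_translation \<cc> x" "adj22 (cusp_translation \<cc> y)"]
      G(4)[of "cusp_translation \<cc> y"] that
    by (simp add: L_def adj22_cusp_translation cusp_translation_add)
  obtain e where e: "e > 0" "\<And>A. A \<in> G \<Longrightarrow> dist id22 A < e \<Longrightarrow> A = id22 \<or> A = - id22"
    using fuchsian_isolated[OF G(1,2) fuchs] by blast
  obtain N where N: "N > 0" "\<And>x. dist id22 (cusp_translation \<cc> x) \<le> N * \<bar>x\<bar>"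
    using dist_cusp_translation by blast
  have disc: "x = 0" if "x \<in> L" "\<bar>x\<bar> < e / N" for x
  proof -
    have "dist id22 (cusp_translation \<cc> x) < e"
      using N(2)[of x] that(2) N(1) by (simp add: field_simps)
    then have "cusp_translation \<cc> x = id22 \<or> cusp_translation \<cc> x = - id22"
      using e(2) that(1) by (simp add: L_def)
    then show ?thesis
      by (rule cusp_translation_eqD) (simp add: cusp_translation_0)
  qed
  obtain A where A: "A \<in> G" "parabolic A" "A \<noteq> id22" "A \<noteq> - id22" "moebius_bd A \<cc> = \<cc>"
    using cusp by (auto simp: cusps_def)
  obtain p where p: "A = cusp_translation \<cc> p \<or> A = - cusp_translation \<cc> p"
    using parabolic_fixing_cusp[OF _ A(5,2)] A(1) G(1) by blast
  have pL: "p \<in> L" using p A(1) negG[of A] by (auto simp: L_def)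
  have p0: "p \<noteq> 0" using p A(3,4) cusp_translation_0 by auto
  obtain h where h: "h > 0" "L = range (\<lambda>n::int. of_int n * h)"
    using discrete_subgroup_real[OF diff divide_pos_pos[OF e(1) N(1)] disc pL p0] by blast
  have hL: "h \<in> L" unfolding h(2) by (rule image_eqI[of _ _ 1]) auto
  have stab: "\<exists>x\<in>L. B = cusp_translation \<cc> x \<or> B = - cusp_translation \<cc> x"
    if B: "B \<in> G" "moebius_bd B \<cc> = \<cc>" for B
  proof -
    have Bc: "B \<in> carrier SL2R" using B(1) G(1) by blast
    obtain a b d where abd: "a * d = 1" "B = cusp_mat \<cc> ** mat22 a b 0 d ** adj22 (cusp_mat \<cc>)"
      "Determinants.trace B = a + d"
      using fixing_cusp[OF Bc B(2)] by blast
    have adj: "adj22 B = cusp_mat \<cc> ** mat22 d (- b) 0 a ** adj22 (cusp_mat \<cc>)"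
    proof -
      have "adj22 (mat22 a b 0 d) = mat22 d (- b) 0 a" by (simp add: eq22_iff)
      then show ?thesis by (simp add: abd(2) adj22_mult matrix_mul_assoc)
    qed
    \<comment> \<open>Conjugation by \<open>B\<close> and by its inverse multiplies translation
      lengths by \<open>a * a\<close> and \<open>d * d\<close>. Both images of \<open>h\<close> are
      again multiples of \<open>h\<close>, so both factors are integers; their product is 1.\<close>
    have "mat22 a b 0 d ** mat22 1 h 0 1 ** mat22 d (- b) 0 a = mat22 1 (a * a * h) 0 1"
      "mat22 d (- b) 0 a ** mat22 1 h 0 1 ** mat22 a b 0 d = mat22 1 (d * d * h) 0 1"
      using abd(1) by (simp_all add: eq22_iff mult22_entries algebra_simps)
    then have "B ** cusp_translation \<cc> h ** adj22 B = cusp_translation \<cc> (a * a * h)"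
      "adj22 B ** cusp_translation \<cc> h ** B = cusp_translation \<cc> (d * d * h)"
      unfolding adj by (simp_all add: abd(2) cusp_translation_eq conj_mult22[OF cusp_mat_carrier])
    moreover have "B ** cusp_translation \<cc> h ** adj22 B \<in> G" "adj22 B ** cusp_translation \<cc> h ** B \<in> G"
      using hL G(3,4) B(1) by (simp_all add: L_def)
    ultimately have "a * a * h \<in> L" "d * d * h \<in> L" by (simp_all add: L_def)
    then obtain n n' :: int where n: "a * a = of_int n" "d * d = of_int n'"
      using h by auto
    have "real_of_int (n * n') = (a * d) * (a * d)" using n by (simp add: algebra_simps flip: n)
    then have "n * n' = 1" using abd(1) by (simp flip: of_int_mult)
    moreover have "n \<ge> 0" using zero_le_square[of a] unfolding n by simp
    ultimately have "n = 1" using zmult_eq_1_iff by force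
    then have "a = 1 \<or> a = - 1" using n(1) square_eq_1_iff[of a] by simp
    then have "parabolic B" using abd(1,3) by (auto simp: parabolic_def)
    then obtain x where x: "B = cusp_translation \<cc> x \<or> B = - cusp_translation \<cc> x"
      using parabolic_fixing_cusp[OF Bc B(2)] by blast
    then have "x \<in> L" using B(1) negG[of B] by (auto simp: L_def)
    then show ?thesis using x by blast
  qed
  interpret group_hom SL2R PSL2R to_PSL by (rule group_hom_to_PSL)
  have gen: "generate PSL2R {to_PSL (cusp_translation \<cc> x)} =
      (\<lambda>n::int. to_PSL (cusp_translation \<cc> (of_int n * x))) ` UNIV" for x
    using H.generate_pow[OF hom_closed[OF cusp_translation_carrier]]
    by (auto simp: int_pow_cusp_translation)
  have image: "to_PSL ` {A \<in> G. moebius_bd A \<cc> = \<cc>} = (\<lambda>x. to_PSL (cusp_translation \<cc> x)) ` L"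
  proof
    have "to_PSL (- A) = to_PSL A" for A by (auto simp: to_PSL_eq)
    then show "to_PSL ` {A \<in> G. moebius_bd A \<cc> = \<cc>} \<subseteq> (\<lambda>x. to_PSL (cusp_translation \<cc> x)) ` L"
      using stab by fastforce
    show "(\<lambda>x. to_PSL (cusp_translation \<cc> x)) ` L \<subseteq> to_PSL ` {A \<in> G. moebius_bd A \<cc> = \<cc>}"
      using moebius_bd_cusp_translation by (auto simp: L_def)
  qed
  have "cusp_width G \<cc> = h"
    unfolding cusp_width_def
  proof (rule the_equality)
    show "h > 0 \<and> to_PSL ` {A \<in> G. moebius_bd A \<cc> = \<cc>} = generate PSL2R {to_PSL (cusp_translation \<cc> h)}"
      unfolding image gen h(2) image_image using h(1) by simp
  next
    fix h' assume h': "h' > 0 \<and>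
      to_PSL ` {A \<in> G. moebius_bd A \<cc> = \<cc>} = generate PSL2R {to_PSL (cusp_translation \<cc> h')}"
    then have eq: "(\<lambda>n::int. to_PSL (cusp_translation \<cc> (of_int n * h))) ` UNIV =
        (\<lambda>n::int. to_PSL (cusp_translation \<cc> (of_int n * h'))) ` UNIV"
      unfolding image gen h(2) image_image by simp
    \<comment> \<open>Generators of the same cyclic group are integer multiples of each other;
      positivity will make them equal.\<close>
    have multiple: "\<exists>n::int. x = of_int n * y"
      if range: "(\<lambda>n::int. to_PSL (cusp_translation \<cc> (of_int n * x))) ` UNIV =
        (\<lambda>n::int. to_PSL (cusp_translation \<cc> (of_int n * y))) ` UNIV" for x y
    proof -
      have "to_PSL (cusp_translation \<cc> x) \<in> (\<lambda>n::int. to_PSL (cusp_translation \<cc> (of_int n * x))) ` UNIV"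
        by (rule image_eqI[of _ _ 1]) auto
      then obtain n :: int where "to_PSL (cusp_translation \<cc> x) = to_PSL (cusp_translation \<cc> (of_int n * y))"
        unfolding range by blast
      then have "x = of_int n * y" by (rule cusp_translation_eqD[OF to_PSL_eqD refl])
      then show ?thesis by blast
    qed
    obtain n :: int where n: "h = of_int n * h'" using multiple[OF eq] by blast
    obtain n' :: int where n': "h' = of_int n' * h" using multiple[OF eq[symmetric]] by blast
    have "of_int (n * n') * h' = of_int n' * (of_int n * h')"
      by simp
    also have "\<dots> = h'" unfolding n[symmetric] n'[symmetric] ..
    finally have "n * n' = 1" using h' by (simp flip: of_int_mult)
    moreover have "n > 0" using n h(1) h' by (simp add: zero_less_mult_iff)
    ultimately have "n = 1" using zmult_eq_1_iff by force
    then show "h' = h" using n by simp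
  qed
  then show "cusp_width G \<cc> > 0" "cusp_gen G \<cc> \<in> G"
    using h(1) hL by (simp_all add: cusp_gen_def L_def)
qed

section \<open>Expansion of a vector from the Jordan form of its multiplier\<close>

lemma has_sum_sum_finite:
  fixes f :: "'a \<Rightarrow> 'b \<Rightarrow> complex"
  assumes "finite I" "\<And>i. i \<in> I \<Longrightarrow> (f i has_sum s i) A"
  shows "((\<lambda>x. \<Sum>i\<in>I. f i x) has_sum (\<Sum>i\<in>I. s i)) A"
  using assms by (induction I rule: finite_induct) (auto intro!: has_sum_add)

text \<open>Blocks of a Jordan form have positive size, so each listed eigenvalue is a root of the
  characteristic polynomial.\<close>

lemma jordan_nf_eigenvalue:
  fixes T :: "complex mat"
  assumes "T \<in> carrier_mat m m" "jordan_nf T bs" "i < length bs"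
  shows "eigenvalue T (snd (bs ! i))"
proof -
  have mem: "bs ! i \<in> set bs" using assms(3) by simp
  then have "fst (bs ! i) \<noteq> 0"
    using assms(2) unfolding jordan_nf_def by (metis image_eqI)
  then have "poly (char_poly T) (snd (bs ! i)) = 0"
    unfolding jordan_nf_char_poly[OF assms(2)] poly_prod_list prod_list_zero_iff
    using mem by (force simp: image_iff split_beta)
  then show ?thesis using eigenvalue_root_char_poly[OF assms(1)] by simp
qed

abbreviation log_series ::
  "real \<Rightarrow> (nat \<times> complex) list \<Rightarrow> (nat \<Rightarrow> nat \<Rightarrow> int \<Rightarrow> complex Matrix.vec) \<Rightarrow> int set \<Rightarrow> nat \<Rightarrow> complex \<Rightarrow> complex" where
  "log_series h bs C K r w \<equiv> (\<Sum>i<length bs. \<Sum>j<fst (bs ! i).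
     norm_log h w ^ j * exp (of_real (mu (snd (bs ! i))) * norm_log h w) *
     (\<Sum>\<^sub>\<infinity>n\<in>K. C i j n $ r * exp (norm_log h w) powi n))"

text \<open>In the coordinates \<open>Q *\<^sub>v F w\<close> of a Jordan basis each component
  belongs to one block and expands with the eigenvalue of that block; multiplication by
  \<open>P\<close> recombines the components block by block.\<close>

lemma log_series_exists:
  fixes F :: "complex \<Rightarrow> complex Matrix.vec"
  assumes h: "h > 0" and T: "T \<in> carrier_mat m m" and jnf: "jordan_nf T bs"
    and unimod: "\<And>i. i < length bs \<Longrightarrow> norm (snd (bs ! i)) = 1"
    and F: "\<And>w. w \<in> upper_half \<Longrightarrow> F w \<in> carrier_vec m"
    and hol: "\<And>r. r < m \<Longrightarrow> (\<lambda>w. F w $ r) holomorphic_on upper_half"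
    and growth: "\<And>r. r < m \<Longrightarrow> cusp_growth E (\<lambda>w. F w $ r)"
    and per: "\<And>w. w \<in> upper_half \<Longrightarrow> F (w + of_real h) = T *\<^sub>v F w"
  obtains C :: "nat \<Rightarrow> nat \<Rightarrow> int \<Rightarrow> complex Matrix.vec"
  where "\<And>i j n. C i j n \<in> carrier_vec m"
    and "\<And>i j n. 2 * pi * (mu (snd (bs ! i)) + of_int n) / h < E \<Longrightarrow> C i j n = 0\<^sub>v m"
    and "\<And>i j w r. w \<in> upper_half \<Longrightarrow> r < m \<Longrightarrow>
      (\<lambda>n. C i j n $ r * exp (norm_log h w) powi n) summable_on UNIV"
    and "\<And>w r. w \<in> upper_half \<Longrightarrow> r < m \<Longrightarrow> F w $ r =
      log_series h bs C UNIV r w"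
proof -
  obtain P Q where "similar_mat_wit T (jordan_matrix bs) P Q"
    using jnf by (auto simp: jordan_nf_def similar_mat_def)
  note wit = similar_mat_witD2[OF T this]
  have m: "m = sum_list (map fst bs)"
    using wit(5) by auto
  define G where "G = (\<lambda>w. Q *\<^sub>v F w)"
  have Gc: "G w \<in> carrier_vec m" for w
    unfolding G_def using wit(7) by (intro carrier_vecI) auto
  have F_G: "F w = P *\<^sub>v G w" if "w \<in> upper_half" for w
  proof -
    have "P *\<^sub>v G w = (P * Q) *\<^sub>v F w"
      unfolding G_def by (rule assoc_mult_mat_vec[symmetric, OF wit(6,7) F[OF that]])
    then show ?thesis using F[OF that] by (simp add: wit(1))
  qed
  have G_index: "G w $ p = (\<Sum>r<m. Q $$ (p, r) * F w $ r)" if "w \<in> upper_half" "p < m" for p w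
    unfolding G_def using that wit(7) F[OF that(1)] by (simp add: scalar_prod_def atLeast0LessThan)
  have G_per: "G (w + of_real h) = jordan_matrix bs *\<^sub>v G w" if w: "w \<in> upper_half" for w
  proof -
    have "G (w + of_real h) = Q *\<^sub>v ((P * jordan_matrix bs * Q) *\<^sub>v F w)"
      unfolding G_def per[OF w] wit(3)[symmetric] ..
    also have "(P * jordan_matrix bs * Q) *\<^sub>v F w = (P * jordan_matrix bs) *\<^sub>v G w"
      unfolding G_def by (rule assoc_mult_mat_vec[OF mult_carrier_mat[OF wit(6,5)] wit(7) F[OF w]])
    also have "\<dots> = P *\<^sub>v (jordan_matrix bs *\<^sub>v G w)"
      by (rule assoc_mult_mat_vec[OF wit(6,5) Gc])
    also have "Q *\<^sub>v \<dots> = (Q * P) *\<^sub>v (jordan_matrix bs *\<^sub>v G w)"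
      by (rule assoc_mult_mat_vec[symmetric, OF wit(7,6) mult_mat_vec_carrier[OF wit(5) Gc]])
    also have "\<dots> = jordan_matrix bs *\<^sub>v G w"
      unfolding wit(2) by (rule one_mult_mat_vec[OF mult_mat_vec_carrier[OF wit(5) Gc]])
    finally show ?thesis .
  qed
  have G_hol: "(\<lambda>w. G w $ p) holomorphic_on upper_half" if "p < m" for p
    by (rule holomorphic_transform[of "\<lambda>w. \<Sum>r<m. Q $$ (p, r) * F w $ r"])
      (auto intro!: holomorphic_intros hol simp: G_index that)
  have G_growth: "cusp_growth E (\<lambda>w. G w $ p)" if "p < m" for p
    by (rule cusp_growth_cong[of _ "\<lambda>w. \<Sum>r<m. Q $$ (p, r) * F w $ r"])
      (auto intro!: cusp_growth_sum cusp_growth_cmult growth simp: G_index that)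
  \<comment> \<open>The block index and the coefficients are bundled so that both can be chosen at
    once for every coordinate.\<close>
  define good where "good = (\<lambda>p i c. i < length bs \<and>
      (\<forall>j n. 2 * pi * (mu (snd (bs ! i)) + of_int n) / h < E \<longrightarrow> c j n = 0) \<and>
      (\<forall>j. \<forall>w\<in>upper_half. (\<lambda>n. c j n * exp (norm_log h w) powi n) summable_on UNIV) \<and>
      (\<forall>w\<in>upper_half. G w $ p = (\<Sum>j<fst (bs ! i). norm_log h w ^ j *
        exp (of_real (mu (snd (bs ! i))) * norm_log h w) *
        (\<Sum>\<^sub>\<infinity>n. c j n * exp (norm_log h w) powi n))))"
  have "\<exists>i c. good p i c" if p: "p < m" for p
  proof -
    obtain i where i: "i < length bs"
      "\<And>w. w \<in> upper_half \<Longrightarrow> (twisted_diff h (snd (bs ! i)) ^^ fst (bs ! i)) (\<lambda>w. G w $ p) w = 0"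
      using jordan_matrix_twisted[of G bs h p] Gc G_per p by (auto simp: m)
    show ?thesis
      unfolding good_def by (rule twisted_log_expansion[OF h unimod[OF i(1)] G_hol[OF p] G_growth[OF p] i(2)])
        (use i(1) in blast)+
  qed
  then obtain ix c where good: "\<And>p. p < m \<Longrightarrow> good p (ix p) (c p)"
    by metis
  have ix: "\<And>p. p < m \<Longrightarrow> ix p < length bs"
    and c0: "\<And>p j n. p < m \<Longrightarrow> 2 * pi * (mu (snd (bs ! ix p)) + of_int n) / h < E \<Longrightarrow> c p j n = 0"
    and csum: "\<And>p j w. p < m \<Longrightarrow> w \<in> upper_half \<Longrightarrow>
      (\<lambda>n. c p j n * exp (norm_log h w) powi n) summable_on UNIV"
    and cG: "\<And>p w. p < m \<Longrightarrow> w \<in> upper_half \<Longrightarrow> G w $ p = (\<Sum>j<fst (bs ! ix p). norm_log h w ^ j *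
        exp (of_real (mu (snd (bs ! ix p))) * norm_log h w) *
        (\<Sum>\<^sub>\<infinity>n. c p j n * exp (norm_log h w) powi n))"
    using good unfolding good_def by blast+
  \<comment> \<open>Block \<open>i\<close> gathers only the coordinates that \<open>ix\<close>
    assigns to it, weighted with the entries of row \<open>r\<close> of \<open>P\<close>.\<close>
  define C where "C = (\<lambda>i j n. Matrix.vec m (\<lambda>r. \<Sum>p<m. if ix p = i then P $$ (r, p) * c p j n else 0))"
  have C_sum: "((\<lambda>n. C i j n $ r * exp (norm_log h w) powi n) has_sum
      (\<Sum>p<m. if ix p = i then P $$ (r, p) * (\<Sum>\<^sub>\<infinity>n. c p j n * exp (norm_log h w) powi n) else 0)) UNIV"
    if w: "w \<in> upper_half" and r: "r < m" for i j w r
  proof -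
    have eq: "C i j n $ r * exp (norm_log h w) powi n =
        (\<Sum>p<m. if ix p = i then P $$ (r, p) * (c p j n * exp (norm_log h w) powi n) else 0)" for n
    proof -
      have "C i j n $ r = (\<Sum>p<m. if ix p = i then P $$ (r, p) * c p j n else 0)"
        using r by (simp add: C_def)
      then show ?thesis
        by (simp only: sum_distrib_right) (rule sum.cong, simp_all)
    qed
    have "((\<lambda>n. if ix p = i then P $$ (r, p) * (c p j n * exp (norm_log h w) powi n) else 0) has_sum
        (if ix p = i then P $$ (r, p) * (\<Sum>\<^sub>\<infinity>n. c p j n * exp (norm_log h w) powi n) else 0)) UNIV"
      if "p \<in> {..<m}" for p
    proof (cases "ix p = i")
      case True
      have "(\<lambda>n. c p j n * exp (norm_log h w) powi n) summable_on UNIV"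
        using csum[OF _ w] that by simp
      from has_sum_cmult_right[OF has_sum_infsum[OF this], of "P $$ (r, p)"] True
      show ?thesis by simp
    qed simp
    then show ?thesis
      unfolding eq by (rule has_sum_sum_finite[OF finite_lessThan])
  qed
  show ?thesis
  proof (rule that[of C])
    show "C i j n = 0\<^sub>v m" if "2 * pi * (mu (snd (bs ! i)) + of_int n) / h < E" for i j n
      using c0 that by (auto simp: C_def intro!: eq_vecI sum.neutral)
    show "(\<lambda>n. C i j n $ r * exp (norm_log h w) powi n) summable_on UNIV"
      if "w \<in> upper_half" "r < m" for i j w r
      using C_sum[OF that] has_sum_imp_summable by blast
    fix w r assume w: "w \<in> upper_half" and r: "r < m"
    let ?e = "\<lambda>i j. norm_log h w ^ j * exp (of_real (mu (snd (bs ! i))) * norm_log h w)"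
    let ?S = "\<lambda>p j. \<Sum>\<^sub>\<infinity>n. c p j n * exp (norm_log h w) powi n"
    have "F w $ r = (\<Sum>p<m. P $$ (r, p) * G w $ p)"
      unfolding F_G[OF w] using r wit(6) Gc[of w] by (simp add: scalar_prod_def atLeast0LessThan)
    also have "\<dots> = (\<Sum>p<m. \<Sum>i<length bs. if ix p = i then
        (\<Sum>j<fst (bs ! i). ?e i j * (P $$ (r, p) * ?S p j)) else 0)"
      using ix by (intro sum.cong refl) (simp add: cG w sum_distrib_left mult_ac)
    also have "\<dots> = (\<Sum>p<m. \<Sum>i<length bs. \<Sum>j<fst (bs ! i).
        ?e i j * (if ix p = i then P $$ (r, p) * ?S p j else 0))"
      by (intro sum.cong refl) auto
    also have "\<dots> = (\<Sum>i<length bs. \<Sum>p<m. \<Sum>j<fst (bs ! i).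
        ?e i j * (if ix p = i then P $$ (r, p) * ?S p j else 0))"
      by (rule sum.swap)
    also have "\<dots> = (\<Sum>i<length bs. \<Sum>j<fst (bs ! i). \<Sum>p<m.
        ?e i j * (if ix p = i then P $$ (r, p) * ?S p j else 0))"
      by (intro sum.cong refl sum.swap)
    also have "\<dots> = (\<Sum>i<length bs. \<Sum>j<fst (bs ! i). ?e i j *
        (\<Sum>\<^sub>\<infinity>n. C i j n $ r * exp (norm_log h w) powi n))"
      unfolding infsumI[OF C_sum[OF w r]] sum_distrib_left ..
    finally show "F w $ r = (\<Sum>i<length bs. \<Sum>j<fst (bs ! i). ?e i j *
        (\<Sum>\<^sub>\<infinity>n. C i j n $ r * exp (norm_log h w) powi n))" .
  qed (simp add: C_def)
qed

section \<open>The coordinate at a cusp\<close>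

definition cusp_sign :: "int \<Rightarrow> real option \<Rightarrow> complex" where
  "cusp_sign k \<cc> = (case \<cc> of None \<Rightarrow> 1 | Some _ \<Rightarrow> (- 1) powi k)"

lemma cusp_sign_mult_self: "cusp_sign k \<cc> * cusp_sign k \<cc> = 1"
  by (cases \<cc>) (simp_all add: cusp_sign_def flip: power_int_mult_distrib)

text \<open>For a finite cusp x and \<tau> = x - 1/w, the prefactor of the expansion is (-w)^k,
  whereas the automorphy factor of A_c is w. This is the origin of the sign.\<close>

lemma cusp_factor_moebius:
  assumes "w \<in> upper_half"
  shows "cusp_factor k \<cc> (moebius (cusp_mat \<cc>) w) = cusp_sign k \<cc> * jfac (cusp_mat \<cc>) w powi k"
proof (cases \<cc>)
  case None
  then show ?thesis by (simp add: cusp_sign_def)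
next
  case (Some x)
  have "w \<noteq> 0" using assms by (auto simp: upper_half_def)
  then have "moebius (cusp_mat \<cc>) w - of_real x = inverse (- w)"
    by (simp add: Some moebius_def field_simps)
  then have "cusp_factor k \<cc> (moebius (cusp_mat \<cc>) w) = inverse (- w) powi (- k)"
    by (simp add: Some)
  also have "\<dots> = (- 1 * w) powi k"
    unfolding power_int_minus power_int_inverse by simp
  also have "\<dots> = (- 1) powi k * jfac (cusp_mat \<cc>) w powi k"
    by (simp only: power_int_mult_distrib) (simp add: Some jfac_def)
  finally show ?thesis by (simp add: Some cusp_sign_def)
qed

lemma log_q_moebius:
  assumes "w \<in> upper_half"
  shows "log_q G \<cc> (moebius (cusp_mat \<cc>) w) = norm_log (cusp_width G \<cc>) w"
  using moebius_mult[OF adj22_carrier[OF cusp_mat_carrier] cusp_mat_carrier assms, of \<cc> \<cc>]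
  by (simp add: log_q_def norm_log_def inv_SL2R cusp_mat_carrier adj22_left)

lemma upper_half_moebius_image:
  assumes "A \<in> carrier SL2R"
  shows "(\<forall>\<tau>\<in>upper_half. R \<tau>) \<longleftrightarrow> (\<forall>w\<in>upper_half. R (moebius A w))"
proof
  assume R: "\<forall>w\<in>upper_half. R (moebius A w)"
  show "\<forall>\<tau>\<in>upper_half. R \<tau>"
  proof
    fix \<tau> assume \<tau>: "\<tau> \<in> upper_half"
    have "R (moebius A (moebius (adj22 A) \<tau>))"
      using R moebius_upper_half[OF adj22_carrier[OF assms] \<tau>] by blast
    then show "R \<tau>"
      by (simp add: moebius_mult[OF assms adj22_carrier[OF assms] \<tau>, symmetric] adj22_right assms)
  qed
qed (use moebius_upper_half[OF assms] in blast)

text \<open>In the coordinate \<open>w\<close> with \<open>\<tau> = A\<^sub>\<cc> w\<close>, the prefactor of the expansion becomes the slash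
  action of \<open>A\<^sub>\<cc>\<close> up to a sign.\<close>

lemma log_expansion_altdef:
  "log_expansion G m k \<rho> X \<cc> M bs C \<longleftrightarrow>
     jordan_nf (\<rho> (cusp_gen G \<cc>)) bs \<and> (\<forall>i j n. C i j n \<in> carrier_vec m) \<and>
     (\<forall>w\<in>upper_half. \<forall>r<m.
        (\<forall>i<length bs. \<forall>j<fst (bs ! i).
           (\<lambda>n. C i j n $ r * exp (norm_log (cusp_width G \<cc>) w) powi n) summable_on {- M..}) \<and>
        scalar_slash k (\<lambda>\<tau>. X \<tau> $ r) (cusp_mat \<cc>) w = cusp_sign k \<cc> *
          log_series (cusp_width G \<cc>) bs C {- M..} r w)"
proof -
  have slash: "X (moebius (cusp_mat \<cc>) w) $ r = cusp_factor k \<cc> (moebius (cusp_mat \<cc>) w) * S \<longleftrightarrow>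
      scalar_slash k (\<lambda>\<tau>. X \<tau> $ r) (cusp_mat \<cc>) w = cusp_sign k \<cc> * S"
    if w: "w \<in> upper_half" for w r S
  proof -
    have j: "jfac (cusp_mat \<cc>) w \<noteq> 0"
      by (rule jfac_nonzero[OF cusp_mat_carrier w])
    have "X (moebius (cusp_mat \<cc>) w) $ r = cusp_sign k \<cc> * jfac (cusp_mat \<cc>) w powi k * S \<longleftrightarrow>
        jfac (cusp_mat \<cc>) w powi (- k) * X (moebius (cusp_mat \<cc>) w) $ r = cusp_sign k \<cc> * S"
      using j by (simp add: power_int_minus field_simps)
    then show ?thesis
      by (simp add: cusp_factor_moebius[OF w] scalar_slash_def)
  qed
  show ?thesis
    unfolding log_expansion_def
    by (subst upper_half_moebius_image[OF cusp_mat_carrier[of \<cc>]])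
      (simp add: log_q_moebius loc_q_def slash cong: conj_cong ball_cong)
qed

section \<open>Automorphic forms characterized by growth\<close>

abbreviation cusp_component ::
  "int \<Rightarrow> (complex \<Rightarrow> complex Matrix.vec) \<Rightarrow> real option \<Rightarrow> nat \<Rightarrow> complex \<Rightarrow> complex" where
  "cusp_component k X \<cc> r \<equiv> scalar_slash k (\<lambda>\<tau>. X \<tau> $ r) (cusp_mat \<cc>)"

lemma scalar_slash_shift:
  assumes "A \<in> carrier SL2R" "w \<in> upper_half"
  shows "scalar_slash k f A (w + of_real x) = scalar_slash k f (A ** mat22 1 x 0 1) w"
proof -
  have "scalar_slash k f (A ** mat22 1 x 0 1) w = scalar_slash k (scalar_slash k f A) (mat22 1 x 0 1) w"
    by (rule scalar_slash_mult[OF assms(1) upper_unipotent_carrier assms(2), symmetric])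
  also have "\<dots> = scalar_slash k f A (w + of_real x)"
    by (simp add: scalar_slash_def[of k "scalar_slash k f A"] jfac_def moebius_def)
  finally show ?thesis ..
qed

text \<open>A shift of the coordinate \<open>w\<close> is the action of the cusp translation on
  \<tau>, because the two matrices are conjugate by \<open>cusp_mat \<cc>\<close>. Through this
  identity the value of the representation at the cusp generator becomes the multiplier of the
  shift.\<close>

lemma scalar_slash_cusp_translation:
  assumes "w \<in> upper_half"
  shows "scalar_slash k f (cusp_mat \<cc>) (w + of_real x) =
    scalar_slash k (scalar_slash k f (cusp_translation \<cc> x)) (cusp_mat \<cc>) w"
proof -
  have "cusp_translation \<cc> x ** cusp_mat \<cc> =
      cusp_mat \<cc> ** mat22 1 x 0 1 ** (adj22 (cusp_mat \<cc>) ** cusp_mat \<cc>)"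
    by (simp add: cusp_translation_eq matrix_mul_assoc)
  then have "cusp_translation \<cc> x ** cusp_mat \<cc> = cusp_mat \<cc> ** mat22 1 x 0 1"
    by (simp add: adj22_left cusp_mat_carrier)
  then show ?thesis
    by (simp add: scalar_slash_shift scalar_slash_mult cusp_mat_carrier cusp_translation_carrier assms)
qed

section \<open>Groups with well-defined cusp widths, and their scalar functions\<close>

locale cuspidal_group =
  fixes G :: "(real^2^2) set"
  assumes subgroup: "subgroup G SL2R"
    and neg_id: "- id22 \<in> G"
    and fuchsian: "fuchsian_first_kind (to_PSL ` G)"
begin

lemmas group_facts = subgroup_SL2RD[OF subgroup]

lemma cusp_width_pos: "\<cc> \<in> cusps G \<Longrightarrow> cusp_width G \<cc> > 0"
  and cusp_gen_mem: "\<cc> \<in> cusps G \<Longrightarrow> cusp_gen G \<cc> \<in> G"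
  using cusp_width_exists[OF subgroup neg_id fuchsian] by blast+

text \<open>The scalar case of the equivalence between expansions and growth: the multiplier is
  trivial, so a plain Laurent series in q remains.\<close>

lemma automorphic_functions_altdef:
  "automorphic_functions G = {f \<in> extensional upper_half. f holomorphic_on upper_half \<and>
     (\<forall>A\<in>G. \<forall>\<tau>\<in>upper_half. f (moebius A \<tau>) = f \<tau>) \<and>
     (\<forall>\<cc>\<in>cusps G. \<exists>E. cusp_growth E (scalar_slash 0 f (cusp_mat \<cc>)))}"
proof -
  have "(\<exists>(M :: int) a. \<forall>\<tau>\<in>upper_half. ((\<lambda>n. a n * loc_q G \<cc> \<tau> powi n) has_sum f \<tau>) {- M..}) \<longleftrightarrow>
      (\<exists>E. cusp_growth E (scalar_slash 0 f (cusp_mat \<cc>)))" (is "?L \<longleftrightarrow> ?R")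
    if \<cc>: "\<cc> \<in> cusps G" and hol: "f holomorphic_on upper_half"
      and inv: "\<forall>A\<in>G. \<forall>\<tau>\<in>upper_half. f (moebius A \<tau>) = f \<tau>" for f \<cc>
  proof -
    define h where "h = cusp_width G \<cc>"
    define g where "g = scalar_slash 0 f (cusp_mat \<cc>)"
    have h: "h > 0" unfolding h_def by (rule cusp_width_pos[OF \<cc>])
    have g: "g w = f (moebius (cusp_mat \<cc>) w)" for w
      by (simp add: g_def scalar_slash_def)
    have L: "?L \<longleftrightarrow> (\<exists>(M :: int) a. \<forall>w\<in>upper_half. ((\<lambda>n. a n * exp (norm_log h w) powi n) has_sum g w) {- M..})"
      by (subst upper_half_moebius_image[OF cusp_mat_carrier[of \<cc>]])
        (simp add: g loc_q_def log_q_moebius h_def)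
    show ?thesis
    proof
      assume ?L
      then obtain M :: int and a where
        a: "\<And>w. w \<in> upper_half \<Longrightarrow> ((\<lambda>n. a n * exp (norm_log h w) powi n) has_sum g w) {- M..}"
        unfolding L by blast
      have "cusp_growth (2 * pi * of_int (- M) / h) (\<lambda>w. \<Sum>\<^sub>\<infinity>n\<in>{- M..}. a n * exp (norm_log h w) powi n)"
        by (rule cusp_growth_laurent_series[OF h]) (use a has_sum_imp_summable in blast)
      then have "cusp_growth (2 * pi * of_int (- M) / h) g"
        by (rule cusp_growth_cong) (simp add: infsumI[OF a])
      then show ?R unfolding g_def by blast
    next
      assume ?R
      then obtain E where E: "cusp_growth E g" unfolding g_def by blast
      have g_hol: "g holomorphic_on upper_half"
        unfolding g_def by (rule holomorphic_scalar_slash[OF cusp_mat_carrier hol])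
      have g_per: "g (w + of_real h) = g w" if w: "w \<in> upper_half" for w
      proof -
        have "g (w + of_real h) = scalar_slash 0 (scalar_slash 0 f (cusp_gen G \<cc>)) (cusp_mat \<cc>) w"
          unfolding g_def h_def cusp_gen_def by (rule scalar_slash_cusp_translation[OF w])
        also have "\<dots> = f (moebius (cusp_gen G \<cc>) (moebius (cusp_mat \<cc>) w))"
          by (simp add: scalar_slash_def)
        also have "\<dots> = g w"
          unfolding g using inv cusp_gen_mem[OF \<cc>] moebius_upper_half[OF cusp_mat_carrier w] by blast
        finally show ?thesis .
      qed
      obtain c :: "int \<Rightarrow> complex" where c: "\<And>n. 2 * pi * of_int n / h < E \<Longrightarrow> c n = 0"
        "\<And>w. w \<in> upper_half \<Longrightarrow> ((\<lambda>n. c n * exp (norm_log h w) powi n) has_sum g w) UNIV"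
        using periodic_laurent_series[OF h g_hol g_per E] by blast
      \<comment> \<open>Chosen with \<open>- M \<le> E * h / (2 * pi)\<close>, so that every index
        below \<open>- M\<close> has rate below \<open>E\<close> and its coefficient
        vanishes.\<close>
      define M where "M = \<lceil>- (E * h / (2 * pi))\<rceil>"
      have zero: "c n = 0" if "n < - M" for n
      proof -
        have "of_int n < - real_of_int M" using that by linarith
        also have "- real_of_int M \<le> E * h / (2 * pi)"
          unfolding M_def by linarith
        finally show ?thesis using h by (intro c(1)) (simp add: field_simps)
      qed
      have "((\<lambda>n. c n * exp (norm_log h w) powi n) has_sum g w) {- M..}" if "w \<in> upper_half" for w
        by (rule has_sum_cong_neutral[THEN iffD1, OF _ _ _ c(2)[OF that]]) (auto simp: zero)
      then show ?L unfolding L by blast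
    qed
  qed
  note iff = this
  show ?thesis
    unfolding automorphic_functions_def by (rule Collect_cong, rule conj_cong[OF refl], rule conj_cong[OF refl], rule conj_cong[OF refl],
      rule ball_cong[OF refl]) (rule iff)
qed

end

section \<open>Vector-valued forms: expansions against growth\<close>

locale cuspidal_rep = cuspidal_group +
  fixes m :: nat and \<rho> :: rep
  assumes rep_carrier: "A \<in> G \<Longrightarrow> \<rho> A \<in> carrier_mat m m"
    and unimodular: "\<cc> \<in> cusps G \<Longrightarrow> eigenvalue (\<rho> (cusp_gen G \<cc>)) l \<Longrightarrow> norm l = 1"
begin

definition pre_forms :: "int \<Rightarrow> (complex \<Rightarrow> complex Matrix.vec) set" where
  "pre_forms k = {X \<in> upper_half \<rightarrow>\<^sub>E carrier_vec m.
     (\<forall>r<m. (\<lambda>\<tau>. X \<tau> $ r) holomorphic_on upper_half) \<and>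
     (\<forall>A\<in>G. \<forall>\<tau>\<in>upper_half. slash k X A \<tau> = \<rho> A *\<^sub>v X \<tau>)}"

text \<open>The set \<open>Es\<close> of permitted rates selects the kind of form. The rate may vary
  with the cusp and the component; since minima stay in \<open>Es\<close>, it can be made uniform in
  the component.\<close>

definition growth_forms :: "real set \<Rightarrow> int \<Rightarrow> (complex \<Rightarrow> complex Matrix.vec) set" where
  "growth_forms Es k = {X \<in> pre_forms k. \<forall>\<cc>\<in>cusps G. \<forall>r<m.
     \<exists>E\<in>Es. cusp_growth E (cusp_component k X \<cc> r)}"

lemma jordan_unimodular:
  assumes "\<cc> \<in> cusps G" "jordan_nf (\<rho> (cusp_gen G \<cc>)) bs" "i < length bs"
  shows "norm (snd (bs ! i)) = 1"
  using unimodular[OF assms(1) jordan_nf_eigenvalue[OF rep_carrier[OF cusp_gen_mem[OF assms(1)]] assms(2,3)]] .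

text \<open>If all exponents that occur have rate at least \<open>E\<close>, so has the sum: each
  series can be started at its first index of such a rate, and the powers of log q cost
  nothing.\<close>

lemma expansion_growth:
  assumes \<cc>: "\<cc> \<in> cusps G" and expansion: "log_expansion G m k \<rho> X \<cc> M bs C" and r: "r < m"
    and E: "\<And>i j n. i < length bs \<Longrightarrow> j < fst (bs ! i) \<Longrightarrow> - M \<le> n \<Longrightarrow> C i j n \<noteq> 0\<^sub>v m \<Longrightarrow>
      E \<le> 2 * pi * (mu (snd (bs ! i)) + of_int n) / cusp_width G \<cc>"
  shows "cusp_growth E (cusp_component k X \<cc> r)"
proof -
  define h where "h = cusp_width G \<cc>"
  have h: "h > 0" unfolding h_def by (rule cusp_width_pos[OF \<cc>])
  let ?u = "cusp_sign k \<cc>"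
  have "\<forall>w\<in>upper_half. \<forall>r<m.
      (\<forall>i<length bs. \<forall>j<fst (bs ! i).
         (\<lambda>n. C i j n $ r * exp (norm_log h w) powi n) summable_on {- M..}) \<and>
      cusp_component k X \<cc> r w = ?u *
        log_series h bs C {- M..} r w"
    using expansion unfolding log_expansion_altdef h_def by (elim conjE)
  note conj = this[rule_format, OF _ r]
  note sm = conj[THEN conjunct1, rule_format] and eq = conj[THEN conjunct2]
  have "cusp_growth E (\<lambda>w. norm_log h w ^ j * exp (of_real (mu (snd (bs ! i))) * norm_log h w) *
      (\<Sum>\<^sub>\<infinity>n\<in>{- M..}. C i j n $ r * exp (norm_log h w) powi n))"
    if i: "i < length bs" and j: "j < fst (bs ! i)" for i j
  proof -
    define \<mu> where "\<mu> = mu (snd (bs ! i))"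
    \<comment> \<open>The first index from \<open>- M\<close> on whose exponent \<mu> + n has rate
      at least \<open>E\<close>; all earlier coefficients vanish.\<close>
    define N where "N = max (- M) \<lceil>E * h / (2 * pi) - \<mu>\<rceil>"
    have N: "- M \<le> N" by (simp add: N_def)
    have zero: "C i j n $ r = 0" if n: "n \<in> {- M..} - {N..}" for n
    proof -
      have "of_int n < E * h / (2 * pi) - \<mu>"
        using n by (auto simp: N_def not_le less_ceiling_iff)
      then have "2 * pi * (\<mu> + of_int n) / h < E"
        using h by (simp add: field_simps)
      then have "C i j n = 0\<^sub>v m"
        using E[OF i j, of n] n by (force simp: \<mu>_def h_def)
      then show ?thesis using r by simp
    qed
    have tail: "(\<Sum>\<^sub>\<infinity>n\<in>{- M..}. C i j n $ r * exp (norm_log h w) powi n) =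
        (\<Sum>\<^sub>\<infinity>n\<in>{N..}. C i j n $ r * exp (norm_log h w) powi n)" for w
      using N zero by (intro infsum_cong_neutral) auto
    have "(\<lambda>n. C i j n $ r * exp (norm_log h w) powi n) summable_on {N..}" if "w \<in> upper_half" for w
      by (rule summable_on_subset_banach[OF sm[OF that i j]]) (use N in auto)
    then have sum_growth: "cusp_growth (2 * pi * of_int N / h)
        (\<lambda>w. \<Sum>\<^sub>\<infinity>n\<in>{- M..}. C i j n $ r * exp (norm_log h w) powi n)"
      unfolding tail by (rule cusp_growth_laurent_series[OF h])
    have "cusp_growth (2 * pi * \<mu> / h) (\<lambda>w. (2 * of_real pi * \<i> / of_real h) ^ j *
        (w ^ j * exp (of_real \<mu> * norm_log h w)))"
      by (intro cusp_growth_cmult cusp_growth_power_mult cusp_growth_exp_norm_log)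
    also have "(\<lambda>w. (2 * of_real pi * \<i> / of_real h) ^ j * (w ^ j * exp (of_real \<mu> * norm_log h w))) =
        (\<lambda>w. norm_log h w ^ j * exp (of_real \<mu> * norm_log h w))"
      by (rule ext) (simp add: norm_log_def power_mult_distrib power_divide)
    finally have "cusp_growth (2 * pi * \<mu> / h + 2 * pi * of_int N / h)
        (\<lambda>w. norm_log h w ^ j * exp (of_real \<mu> * norm_log h w) *
          (\<Sum>\<^sub>\<infinity>n\<in>{- M..}. C i j n $ r * exp (norm_log h w) powi n))"
      using sum_growth by (rule cusp_growth_mult)
    moreover have "E \<le> 2 * pi * \<mu> / h + 2 * pi * of_int N / h"
    proof -
      have "E * h / (2 * pi) - \<mu> \<le> of_int N"
        unfolding N_def by linarith
      then show ?thesis using h by (simp add: field_simps)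
    qed
    ultimately show ?thesis
      unfolding \<mu>_def by (rule cusp_growth_mono)
  qed
  then have "cusp_growth E (\<lambda>w. ?u * log_series h bs C {- M..} r w)"
    by (intro cusp_growth_cmult cusp_growth_sum) auto
  then show ?thesis
    by (rule cusp_growth_cong) (simp add: eq)
qed

text \<open>Transported to infinity, the form satisfies the assumptions of
  \<open>log_series_exists\<close>. The condition on \<open>M\<close> states that indices below
  \<open>- M\<close> have rate below \<open>E\<close> whatever \<mu> < 1 is, so the two-sided series
  can be cut there.\<close>

lemma expansion_exists:
  assumes \<cc>: "\<cc> \<in> cusps G" and X: "X \<in> pre_forms k"
    and growth: "\<And>r. r < m \<Longrightarrow> cusp_growth E (cusp_component k X \<cc> r)"
    and M: "\<And>\<mu> n. \<lbrakk>\<mu> < 1; n < - M\<rbrakk> \<Longrightarrow> 2 * pi * (\<mu> + of_int n) / cusp_width G \<cc> < E"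
  obtains bs C where "log_expansion G m k \<rho> X \<cc> M bs C"
    "\<forall>i j n. 2 * pi * (mu (snd (bs ! i)) + of_int n) / cusp_width G \<cc> < E \<longrightarrow> C i j n = 0\<^sub>v m"
proof -
  define h where "h = cusp_width G \<cc>"
  have h: "h > 0" unfolding h_def by (rule cusp_width_pos[OF \<cc>])
  let ?A = "cusp_mat \<cc>" and ?T = "\<rho> (cusp_gen G \<cc>)"
  have tG: "cusp_gen G \<cc> \<in> G" by (rule cusp_gen_mem[OF \<cc>])
  then have tc: "cusp_gen G \<cc> \<in> carrier SL2R" using group_facts(1) by blast
  have T: "?T \<in> carrier_mat m m" by (rule rep_carrier[OF tG])
  have Xc: "X \<in> upper_half \<rightarrow> carrier_vec m" using X by (auto simp: pre_forms_def)
  obtain bs where bs: "jordan_nf ?T bs"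
    using char_poly_factorized[OF T] jordan_nf_exists[OF T] by blast
  have unimod: "norm (snd (bs ! i)) = 1" if "i < length bs" for i
    by (rule jordan_unimodular[OF \<cc> bs that])
  define F where "F = slash k X ?A"
  have F_index: "F w $ r = cusp_component k X \<cc> r w" if "w \<in> upper_half" "r < m" for w r
    unfolding F_def by (rule slash_index[OF cusp_mat_carrier that(1) Xc that(2)])
  have Fc: "F w \<in> carrier_vec m" if "w \<in> upper_half" for w
    unfolding F_def by (rule slash_carrier[OF cusp_mat_carrier that Xc])
  have F_hol: "(\<lambda>w. F w $ r) holomorphic_on upper_half" if "r < m" for r
    by (rule holomorphic_transform[OF holomorphic_scalar_slash[OF cusp_mat_carrier[of \<cc>]]])
      (use X that F_index in \<open>auto simp: pre_forms_def\<close>)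
  have F_growth: "cusp_growth E (\<lambda>w. F w $ r)" if "r < m" for r
    by (rule cusp_growth_cong[OF growth[OF that]]) (simp add: F_index that)
  \<comment> \<open>The shift by \<open>h\<close> is the slash action of the cusp generator, which
    automorphy turns into the constant matrix \<open>?T\<close>.\<close>
  have F_per: "F (w + of_real h) = ?T *\<^sub>v F w" if w: "w \<in> upper_half" for w
  proof (rule eq_vecI)
    have dim: "dim_vec (?T *\<^sub>v F w) = m" using T by simp
    then show "dim_vec (F (w + of_real h)) = dim_vec (?T *\<^sub>v F w)"
      using Fc[OF upper_half_add_real[OF w, of h]] by simp
    fix r assume "r < dim_vec (?T *\<^sub>v F w)"
    then have r: "r < m" using dim by simp
    have Aw: "moebius ?A w \<in> upper_half" by (rule moebius_upper_half[OF cusp_mat_carrier w])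
    have "F (w + of_real h) $ r = cusp_component k X \<cc> r (w + of_real h)"
      by (rule F_index[OF upper_half_add_real[OF w] r])
    also have "\<dots> = scalar_slash k (scalar_slash k (\<lambda>\<tau>. X \<tau> $ r) (cusp_gen G \<cc>)) ?A w"
      unfolding h_def cusp_gen_def by (rule scalar_slash_cusp_translation[OF w])
    also have "\<dots> = jfac ?A w powi (- k) * slash k X (cusp_gen G \<cc>) (moebius ?A w) $ r"
      unfolding slash_index[OF tc Aw Xc r] by (simp add: scalar_slash_def[of k _ ?A])
    also have "slash k X (cusp_gen G \<cc>) (moebius ?A w) = ?T *\<^sub>v X (moebius ?A w)"
      using X tG Aw by (auto simp: pre_forms_def)
    also have "jfac ?A w powi (- k) * (?T *\<^sub>v X (moebius ?A w)) $ r =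
        (jfac ?A w powi (- k) \<cdot>\<^sub>v (?T *\<^sub>v X (moebius ?A w))) $ r"
      using T r by simp
    also have "jfac ?A w powi (- k) \<cdot>\<^sub>v (?T *\<^sub>v X (moebius ?A w)) = ?T *\<^sub>v F w"
      unfolding F_def slash_def jfac_def[symmetric]
      by (rule mult_mat_vec[OF T Pi_mem[OF Xc Aw], symmetric])
    finally show "F (w + of_real h) $ r = (?T *\<^sub>v F w) $ r" .
  qed
  obtain C :: "nat \<Rightarrow> nat \<Rightarrow> int \<Rightarrow> complex Matrix.vec" where
    Cc: "\<And>i j n. C i j n \<in> carrier_vec m"
    and C0: "\<And>i j n. 2 * pi * (mu (snd (bs ! i)) + of_int n) / h < E \<Longrightarrow> C i j n = 0\<^sub>v m"
    and Csm: "\<And>i j w r. w \<in> upper_half \<Longrightarrow> r < m \<Longrightarrow>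
      (\<lambda>n. C i j n $ r * exp (norm_log h w) powi n) summable_on UNIV"
    and CF: "\<And>w r. w \<in> upper_half \<Longrightarrow> r < m \<Longrightarrow> F w $ r =
      log_series h bs C UNIV r w"
  proof (rule log_series_exists[OF h T bs unimod Fc F_hol F_growth F_per], goal_cases)
    case (6 C)
    from 6(2-5) show ?case by (rule 6(1))
  qed assumption+
  let ?u = "cusp_sign k \<cc>"
  \<comment> \<open>The sign of the prefactor is absorbed into the coefficients; it squares to
    1.\<close>
  define C' where "C' = (\<lambda>i j n. ?u \<cdot>\<^sub>v C i j n)"
  have C'_index: "C' i j n $ r = ?u * C i j n $ r" if "r < m" for i j n r
    using Cc[of i j n] that by (simp add: C'_def)
  have inf: "(\<Sum>\<^sub>\<infinity>n\<in>{- M..}. C' i j n $ r * exp (norm_log h w) powi n) =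
      ?u * (\<Sum>\<^sub>\<infinity>n. C i j n $ r * exp (norm_log h w) powi n)"
    if "i < length bs" "r < m" "w \<in> upper_half" for i j r w
  proof -
    have "C i j n $ r = 0" if "n < - M" for n
      using C0[OF M[OF mu_bounds(2)[OF unimod[OF \<open>i < length bs\<close>]] that, folded h_def]] \<open>r < m\<close> by simp
    then have "(\<Sum>\<^sub>\<infinity>n\<in>{- M..}. C' i j n $ r * exp (norm_log h w) powi n) =
        (\<Sum>\<^sub>\<infinity>n. C' i j n $ r * exp (norm_log h w) powi n)"
      using \<open>r < m\<close> by (intro infsum_cong_neutral) (auto simp: C'_index)
    also have "\<dots> = ?u * (\<Sum>\<^sub>\<infinity>n. C i j n $ r * exp (norm_log h w) powi n)"
      unfolding C'_index[OF \<open>r < m\<close>] mult.assoc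
      by (rule infsum_cmult_right) (rule Csm[OF \<open>w \<in> upper_half\<close> \<open>r < m\<close>])
    finally show ?thesis .
  qed
  show ?thesis
  proof (rule that[of bs C'])
    show "log_expansion G m k \<rho> X \<cc> M bs C'"
      unfolding log_expansion_altdef h_def[symmetric]
    proof (intro conjI allI ballI impI bs)
      show "C' i j n \<in> carrier_vec m" for i j n using Cc by (simp add: C'_def)
    next
      fix w r i j assume w: "w \<in> upper_half" and r: "r < m"
      have "(\<lambda>n. ?u * (C i j n $ r * exp (norm_log h w) powi n)) summable_on UNIV"
        by (intro summable_on_cmult_right Csm[OF w r])
      then show "(\<lambda>n. C' i j n $ r * exp (norm_log h w) powi n) summable_on {- M..}"
        unfolding C'_index[OF r] mult.assoc by (rule summable_on_subset_banach) simp
    next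
      fix w r assume w: "w \<in> upper_half" and r: "r < m"
      have "?u * log_series h bs C' {- M..} r w =
          (?u * ?u) * log_series h bs C UNIV r w"
        using inf[OF _ r w] by (simp add: sum_distrib_left mult_ac)
      then show "cusp_component k X \<cc> r w = ?u * log_series h bs C' {- M..} r w"
        unfolding F_index[OF w r, symmetric] CF[OF w r] cusp_sign_mult_self by simp
    qed
  next
    show "\<forall>i j n. 2 * pi * (mu (snd (bs ! i)) + of_int n) / cusp_width G \<cc> < E \<longrightarrow> C' i j n = 0\<^sub>v m"
      using C0 unfolding C'_def h_def by (auto intro!: eq_vecI)
  qed
qed

text \<open>Finitely many rates have a minimum, which lies in \<open>Es\<close> again, and lowering
  a rate weakens the bound.\<close>

lemma uniform_growth:
  assumes "finite I" "Es \<noteq> {}" "\<And>i. i \<in> I \<Longrightarrow> \<exists>E\<in>Es. cusp_growth E (f i)"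
  obtains E where "E \<in> Es" "\<forall>i\<in>I. cusp_growth E (f i)"
proof -
  have "\<exists>E\<in>Es. \<forall>i\<in>I. cusp_growth E (f i)"
    using assms(1,3)
  proof (induction I rule: finite_induct)
    case empty
    then show ?case using assms(2) by blast
  next
    case (insert x I)
    then obtain E E' where "E \<in> Es" "\<forall>i\<in>I. cusp_growth E (f i)" "E' \<in> Es" "cusp_growth E' (f x)"
      by blast
    then show ?case
      by (intro bexI[of _ "min E E'"]) (auto simp: min_def intro: cusp_growth_mono)
  qed
  then show ?thesis using that by blast
qed

lemma growth_forms_uniform:
  assumes "X \<in> growth_forms Es k" "Es \<noteq> {}" "\<cc> \<in> cusps G"
  obtains E where "E \<in> Es" "\<forall>r<m. cusp_growth E (cusp_component k X \<cc> r)"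
proof -
  have "\<exists>E\<in>Es. cusp_growth E (cusp_component k X \<cc> r)" if "r \<in> {..<m}" for r
    using assms(1,3) that by (simp add: growth_forms_def)
  then obtain E where E: "E \<in> Es" "\<forall>r\<in>{..<m}. cusp_growth E (cusp_component k X \<cc> r)"
    by (rule uniform_growth[OF finite_lessThan assms(2)])
  show ?thesis by (rule that[OF E(1)]) (use E(2) in simp)
qed

text \<open>As mu is nonnegative, a series that starts at \<open>- M\<close> has no exponent below
  \<open>- M\<close>; conversely, any rate bounds the order of the pole.\<close>

lemma weakly_hol_vvafs_eq: "weakly_hol_vvafs G m k \<rho> = growth_forms UNIV k"
proof -
  have "(\<exists>M bs C. log_expansion G m k \<rho> X \<cc> M bs C) \<longleftrightarrow>
      (\<forall>r<m. \<exists>E. cusp_growth E (cusp_component k X \<cc> r))"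
    if X: "X \<in> pre_forms k" and \<cc>: "\<cc> \<in> cusps G" for X \<cc>
  proof
    assume "\<exists>M bs C. log_expansion G m k \<rho> X \<cc> M bs C"
    then obtain M bs C where exp: "log_expansion G m k \<rho> X \<cc> M bs C" by blast
    then have bs: "jordan_nf (\<rho> (cusp_gen G \<cc>)) bs" by (simp add: log_expansion_def)
    have "2 * pi * of_int (- M) / cusp_width G \<cc> \<le> 2 * pi * (mu (snd (bs ! i)) + of_int n) / cusp_width G \<cc>"
      if "i < length bs" "- M \<le> n" for i n
    proof (intro divide_right_mono mult_left_mono)
      show "of_int (- M) \<le> mu (snd (bs ! i)) + of_int n"
        using mu_bounds(1)[OF jordan_unimodular[OF \<cc> bs that(1)]] that(2) by linarith
    qed (use cusp_width_pos[OF \<cc>] in auto)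
    then show "\<forall>r<m. \<exists>E. cusp_growth E (cusp_component k X \<cc> r)"
      using expansion_growth[OF \<cc> exp] by blast
  next
    assume "\<forall>r<m. \<exists>E. cusp_growth E (cusp_component k X \<cc> r)"
    then have "\<exists>E\<in>UNIV. cusp_growth E (cusp_component k X \<cc> r)" if "r \<in> {..<m}" for r
      using that by simp
    then obtain E where E: "\<forall>r\<in>{..<m}. cusp_growth E (cusp_component k X \<cc> r)"
      by (rule uniform_growth[OF finite_lessThan UNIV_not_empty])
    \<comment> \<open>For an integer n below \<open>- M\<close> and \<mu> < 1, the sum \<mu> + n is
      still below \<open>- M\<close>, hence of rate below \<open>E\<close>.\<close>
    define M where "M = \<lceil>- (E * cusp_width G \<cc> / (2 * pi))\<rceil>"
    have order: "2 * pi * (\<mu> + of_int n) / cusp_width G \<cc> < E" if "\<mu> < 1" "n < - M" for \<mu> n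
    proof -
      have "\<mu> + of_int n < - real_of_int M" using that by linarith
      also have "\<dots> \<le> E * cusp_width G \<cc> / (2 * pi)" unfolding M_def by linarith
      finally show ?thesis using cusp_width_pos[OF \<cc>] by (simp add: field_simps)
    qed
    show "\<exists>M bs C. log_expansion G m k \<rho> X \<cc> M bs C"
    proof (rule expansion_exists[OF \<cc> X, where E = E and M = M])
      fix bs C assume "log_expansion G m k \<rho> X \<cc> M bs C"
      then show ?thesis by (intro exI)
    qed (use E order in simp_all)
  qed
  note iff = this
  have "growth_forms UNIV k =
      {X \<in> pre_forms k. \<forall>\<cc>\<in>cusps G. \<exists>M bs C. log_expansion G m k \<rho> X \<cc> M bs C}"
    unfolding growth_forms_def bex_UNIV
    by (rule Collect_cong, rule conj_cong[OF refl], rule ball_cong[OF refl]) (rule iff[symmetric])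
  moreover have "weakly_hol_vvafs G m k \<rho> =
      {X \<in> pre_forms k. \<forall>\<cc>\<in>cusps G. \<exists>M bs C. log_expansion G m k \<rho> X \<cc> M bs C}"
    unfolding weakly_hol_vvafs_def pre_forms_def by (simp only: mem_Collect_eq conj_assoc)
  ultimately show ?thesis by simp
qed

lemma growth_forms_mono: "Es \<subseteq> Es' \<Longrightarrow> growth_forms Es k \<subseteq> growth_forms Es' k"
  unfolding growth_forms_def by blast

text \<open>Serves holomorphic and cusp forms alike: their condition \<open>P\<close> has to be
  compared with growth at one cusp at a time, since weak holomorphy is already known to be a growth
  condition.\<close>

lemma growth_forms_eqI:
  assumes "Es \<noteq> {}"
    and "\<And>X \<cc> E. X \<in> pre_forms k \<Longrightarrow> \<cc> \<in> cusps G \<Longrightarrow> E \<in> Es \<Longrightarrow>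
      (\<And>r. r < m \<Longrightarrow> cusp_growth E (cusp_component k X \<cc> r)) \<Longrightarrow> P X \<cc>"
    and "\<And>X \<cc> r. X \<in> pre_forms k \<Longrightarrow> \<cc> \<in> cusps G \<Longrightarrow> P X \<cc> \<Longrightarrow> r < m \<Longrightarrow>
      \<exists>E\<in>Es. cusp_growth E (cusp_component k X \<cc> r)"
  shows "{X \<in> weakly_hol_vvafs G m k \<rho>. \<forall>\<cc>\<in>cusps G. P X \<cc>} = growth_forms Es k"
proof
  show "{X \<in> weakly_hol_vvafs G m k \<rho>. \<forall>\<cc>\<in>cusps G. P X \<cc>} \<subseteq> growth_forms Es k"
    unfolding weakly_hol_vvafs_eq using assms(3) by (auto simp: growth_forms_def)
  show "growth_forms Es k \<subseteq> {X \<in> weakly_hol_vvafs G m k \<rho>. \<forall>\<cc>\<in>cusps G. P X \<cc>}"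
  proof
    fix X assume X: "X \<in> growth_forms Es k"
    then have pre: "X \<in> pre_forms k" by (simp add: growth_forms_def)
    have "P X \<cc>" if \<cc>: "\<cc> \<in> cusps G" for \<cc>
    proof -
      obtain E where E: "E \<in> Es" "\<forall>r<m. cusp_growth E (cusp_component k X \<cc> r)"
        by (rule growth_forms_uniform[OF X assms(1) \<cc>])
      show ?thesis by (rule assms(2)[OF pre \<cc> E(1)]) (use E(2) in simp)
    qed
    then show "X \<in> {X \<in> weakly_hol_vvafs G m k \<rho>. \<forall>\<cc>\<in>cusps G. P X \<cc>}"
      unfolding weakly_hol_vvafs_eq using X growth_forms_mono[of Es UNIV] by blast
  qed
qed

text \<open>Because 0 \<le> mu < 1, an exponent mu + n is nonnegative exactly when the integer n is.
  Rate 0 therefore cuts the series at n = 0.\<close>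

lemma hol_vvafs_eq: "hol_vvafs G m k \<rho> = growth_forms {0} k"
  unfolding hol_vvafs_def
proof (rule growth_forms_eqI)
  fix X \<cc> E assume X: "X \<in> pre_forms k" and \<cc>: "\<cc> \<in> cusps G" and "E \<in> {0 :: real}"
    and growth: "\<And>r. r < m \<Longrightarrow> cusp_growth E (cusp_component k X \<cc> r)"
  have order: "2 * pi * (\<mu> + of_int n) / cusp_width G \<cc> < E" if "\<mu> < 1" "n < - 0" for \<mu> n
  proof -
    have "\<mu> + of_int n < 0" using that by linarith
    then show ?thesis
      using cusp_width_pos[OF \<cc>] \<open>E \<in> {0}\<close> by (auto intro!: divide_neg_pos mult_pos_neg)
  qed
  show "\<exists>M bs C. log_expansion G m k \<rho> X \<cc> M bs C \<and> M \<le> 0"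
  proof (rule expansion_exists[OF \<cc> X, where E = E and M = 0])
    fix bs C assume "log_expansion G m k \<rho> X \<cc> 0 bs C"
    then show ?thesis by (intro exI conjI) (assumption, rule order_refl)
  qed (use growth order in simp_all)
next
  fix X \<cc> r assume X: "X \<in> pre_forms k" and \<cc>: "\<cc> \<in> cusps G" and r: "r < m"
    and "\<exists>M bs C. log_expansion G m k \<rho> X \<cc> M bs C \<and> M \<le> 0"
  then obtain M bs C where exp: "log_expansion G m k \<rho> X \<cc> M bs C" and "M \<le> 0" by blast
  then have bs: "jordan_nf (\<rho> (cusp_gen G \<cc>)) bs" by (simp add: log_expansion_def)
  have "0 \<le> 2 * pi * (mu (snd (bs ! i)) + of_int n) / cusp_width G \<cc>" if "i < length bs" "- M \<le> n" for i n
  proof -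
    have "0 \<le> mu (snd (bs ! i)) + of_int n"
      using mu_bounds(1)[OF jordan_unimodular[OF \<cc> bs that(1)]] that(2) \<open>M \<le> 0\<close> by simp
    then show ?thesis using cusp_width_pos[OF \<cc>] by simp
  qed
  then show "\<exists>E\<in>{0}. cusp_growth E (cusp_component k X \<cc> r)"
    using expansion_growth[OF \<cc> exp r] by blast
qed simp

text \<open>A positive rate kills every exponent \<le> 0. Conversely, only finitely many values of
  mu occur, so the positive exponents stay away from 0, and this gap yields a positive rate.\<close>

lemma cusp_vvafs_eq: "cusp_vvafs G m k \<rho> = growth_forms {0<..} k"
  unfolding cusp_vvafs_def
proof (rule growth_forms_eqI)
  fix X \<cc> E assume X: "X \<in> pre_forms k" and \<cc>: "\<cc> \<in> cusps G" and "E \<in> {0 :: real<..}"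
    and growth: "\<And>r. r < m \<Longrightarrow> cusp_growth E (cusp_component k X \<cc> r)"
  have le: "2 * pi * (\<mu> + of_int n) / cusp_width G \<cc> < E" if "\<mu> + of_int n \<le> 0" for \<mu> n
  proof -
    have "2 * pi * (\<mu> + of_int n) / cusp_width G \<cc> \<le> 0"
      using cusp_width_pos[OF \<cc>] that by (simp add: divide_le_0_iff mult_le_0_iff)
    then show ?thesis using \<open>E \<in> {0<..}\<close> by simp
  qed
  have "2 * pi * (\<mu> + of_int n) / cusp_width G \<cc> < E" if "\<mu> < 1" "n < - 0" for \<mu> n
    using that by (intro le) linarith
  then obtain bs C where "log_expansion G m k \<rho> X \<cc> 0 bs C"
    "\<forall>i j n. 2 * pi * (mu (snd (bs ! i)) + of_int n) / cusp_width G \<cc> < E \<longrightarrow> C i j n = 0\<^sub>v m"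
    using expansion_exists[OF \<cc> X growth, of 0] by blast
  then show "\<exists>M bs C. log_expansion G m k \<rho> X \<cc> M bs C \<and> M \<le> 0 \<and>
      (\<forall>i<length bs. \<forall>j<fst (bs ! i). \<forall>n. mu (snd (bs ! i)) + of_int n \<le> 0 \<longrightarrow> C i j n = 0\<^sub>v m)"
    using le by blast
next
  fix X \<cc> r assume X: "X \<in> pre_forms k" and \<cc>: "\<cc> \<in> cusps G" and r: "r < m"
    and "\<exists>M bs C. log_expansion G m k \<rho> X \<cc> M bs C \<and> M \<le> 0 \<and>
      (\<forall>i<length bs. \<forall>j<fst (bs ! i). \<forall>n. mu (snd (bs ! i)) + of_int n \<le> 0 \<longrightarrow> C i j n = 0\<^sub>v m)"
  then obtain M bs C where exp: "log_expansion G m k \<rho> X \<cc> M bs C" and M: "M \<le> 0"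
    and C0: "\<forall>i<length bs. \<forall>j<fst (bs ! i). \<forall>n. mu (snd (bs ! i)) + of_int n \<le> 0 \<longrightarrow> C i j n = 0\<^sub>v m"
    by blast
  then have bs: "jordan_nf (\<rho> (cusp_gen G \<cc>)) bs" by (simp add: log_expansion_def)
  \<comment> \<open>Lower bounds for the exponents that occur: the positive values of mu when n = 0,
    and 1 when n \<ge> 1. The element 1 also keeps the set nonempty.\<close>
  define S where "S = insert 1 {\<mu> \<in> (\<lambda>i. mu (snd (bs ! i))) ` {..<length bs}. \<mu> > 0}"
  have S: "finite S" "S \<noteq> {}" unfolding S_def by auto
  have S_pos: "Min S > 0" using S by (subst Min_gr_iff) (auto simp: S_def)
  define E where "E = 2 * pi * Min S / cusp_width G \<cc>"
  have "E \<le> 2 * pi * (mu (snd (bs ! i)) + of_int n) / cusp_width G \<cc>"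
    if i: "i < length bs" and j: "j < fst (bs ! i)" and n: "- M \<le> n" and C: "C i j n \<noteq> 0\<^sub>v m" for i j n
  proof -
    have mu: "0 \<le> mu (snd (bs ! i))" by (rule mu_bounds(1)[OF jordan_unimodular[OF \<cc> bs i]])
    have pos: "mu (snd (bs ! i)) + of_int n > 0" using C0 i j C by force
    have "Min S \<le> mu (snd (bs ! i)) + of_int n"
    proof (cases "n = 0")
      case True
      then show ?thesis using S(1) i pos by (intro Min_le) (auto simp: S_def)
    next
      case False
      then have "n \<ge> 1" using n M by linarith
      then have "1 \<le> mu (snd (bs ! i)) + of_int n" using mu by linarith
      moreover have "Min S \<le> 1" using S(1) by (intro Min_le) (auto simp: S_def)
      ultimately show ?thesis by linarith
    qed
    then show ?thesis
      unfolding E_def using cusp_width_pos[OF \<cc>] by (intro divide_right_mono mult_left_mono) auto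
  qed
  then have "cusp_growth E (cusp_component k X \<cc> r)"
    using expansion_growth[OF \<cc> exp r] by blast
  moreover have "E > 0" unfolding E_def using S_pos cusp_width_pos[OF \<cc>] by simp
  ultimately show "\<exists>E\<in>{0<..}. cusp_growth E (cusp_component k X \<cc> r)"
    by auto
qed auto

end

section \<open>Modules of automorphic forms\<close>

lemma slash_altdef: "slash k X A \<tau> = jfac A \<tau> powi (- k) \<cdot>\<^sub>v X (moebius A \<tau>)"
  by (simp add: slash_def jfac_def)

lemma scalar_slash_weight_0 [simp]: "scalar_slash 0 f A \<tau> = f (moebius A \<tau>)"
  by (simp add: scalar_slash_def)

lemma moebius_cusp_mat_upper_half [simp]: "w \<in> upper_half \<Longrightarrow> moebius (cusp_mat \<cc>) w \<in> upper_half"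
  by (rule moebius_upper_half[OF cusp_mat_carrier])

section \<open>The ring of scalar automorphic functions\<close>

context cuspidal_group
begin

lemma moebius_mem: "A \<in> G \<Longrightarrow> \<tau> \<in> upper_half \<Longrightarrow> moebius A \<tau> \<in> upper_half"
  using group_facts(1) moebius_upper_half by blast

lemma automorphic_functionsD:
  assumes "f \<in> automorphic_functions G"
  shows "f \<in> extensional upper_half" "f holomorphic_on upper_half"
    "\<And>A \<tau>. A \<in> G \<Longrightarrow> \<tau> \<in> upper_half \<Longrightarrow> f (moebius A \<tau>) = f \<tau>"
    "\<And>\<cc>. \<cc> \<in> cusps G \<Longrightarrow> \<exists>E. cusp_growth E (scalar_slash 0 f (cusp_mat \<cc>))"
  using assms unfolding automorphic_functions_altdef by auto

lemma automorphic_functionsI: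
  assumes "f holomorphic_on upper_half"
    and "\<And>A \<tau>. A \<in> G \<Longrightarrow> \<tau> \<in> upper_half \<Longrightarrow> f (moebius A \<tau>) = f \<tau>"
    and "\<And>\<cc>. \<cc> \<in> cusps G \<Longrightarrow> \<exists>E. cusp_growth E (scalar_slash 0 f (cusp_mat \<cc>))"
  shows "(\<lambda>\<tau>\<in>upper_half. f \<tau>) \<in> automorphic_functions G"
proof -
  have "(\<lambda>\<tau>\<in>upper_half. f \<tau>) holomorphic_on upper_half"
    by (rule holomorphic_transform[OF assms(1)]) simp
  moreover have "\<exists>E. cusp_growth E (scalar_slash 0 (\<lambda>\<tau>\<in>upper_half. f \<tau>) (cusp_mat \<cc>))"
    if "\<cc> \<in> cusps G" for \<cc>
  proof -
    obtain E where "cusp_growth E (scalar_slash 0 f (cusp_mat \<cc>))"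
      using assms(3)[OF \<open>\<cc> \<in> cusps G\<close>] by blast
    then have "cusp_growth E (scalar_slash 0 (\<lambda>\<tau>\<in>upper_half. f \<tau>) (cusp_mat \<cc>))"
      by (rule cusp_growth_cong) simp
    then show ?thesis by blast
  qed
  ultimately show ?thesis
    unfolding automorphic_functions_altdef using assms(2) moebius_mem by simp
qed

lemma automorphic_functions_const: "(\<lambda>\<tau>\<in>upper_half. c) \<in> automorphic_functions G"
proof (rule automorphic_functionsI)
  show "\<exists>E. cusp_growth E (scalar_slash 0 (\<lambda>_. c) (cusp_mat \<cc>))" for \<cc>
    using cusp_growth_const[of c] by (intro exI[of _ 0]) (simp add: scalar_slash_weight_0[abs_def])
qed simp_all

lemma automorphic_functions_add:
  assumes "f \<in> automorphic_functions G" "g \<in> automorphic_functions G"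
  shows "(\<lambda>\<tau>\<in>upper_half. f \<tau> + g \<tau>) \<in> automorphic_functions G"
proof (rule automorphic_functionsI)
  note f = automorphic_functionsD[OF assms(1)] and g = automorphic_functionsD[OF assms(2)]
  show "(\<lambda>\<tau>. f \<tau> + g \<tau>) holomorphic_on upper_half"
    by (intro holomorphic_intros f g)
  show "f (moebius A \<tau>) + g (moebius A \<tau>) = f \<tau> + g \<tau>" if "A \<in> G" "\<tau> \<in> upper_half" for A \<tau>
    using f(3)[OF that] g(3)[OF that] by simp
  fix \<cc> assume \<cc>: "\<cc> \<in> cusps G"
  obtain E where E: "cusp_growth E (scalar_slash 0 f (cusp_mat \<cc>))" using f(4)[OF \<cc>] by blast
  obtain E' where E': "cusp_growth E' (scalar_slash 0 g (cusp_mat \<cc>))" using g(4)[OF \<cc>] by blast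
  have "cusp_growth (min E E') (\<lambda>w. scalar_slash 0 f (cusp_mat \<cc>) w + scalar_slash 0 g (cusp_mat \<cc>) w)"
    by (rule cusp_growth_add[OF cusp_growth_mono[OF E] cusp_growth_mono[OF E']]) auto
  then have "cusp_growth (min E E') (scalar_slash 0 (\<lambda>\<tau>. f \<tau> + g \<tau>) (cusp_mat \<cc>))"
    by (rule cusp_growth_cong) simp
  then show "\<exists>E. cusp_growth E (scalar_slash 0 (\<lambda>\<tau>. f \<tau> + g \<tau>) (cusp_mat \<cc>))" by blast
qed

lemma automorphic_functions_mult:
  assumes "f \<in> automorphic_functions G" "g \<in> automorphic_functions G"
  shows "(\<lambda>\<tau>\<in>upper_half. f \<tau> * g \<tau>) \<in> automorphic_functions G"
proof (rule automorphic_functionsI)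
  note f = automorphic_functionsD[OF assms(1)] and g = automorphic_functionsD[OF assms(2)]
  show "(\<lambda>\<tau>. f \<tau> * g \<tau>) holomorphic_on upper_half"
    by (intro holomorphic_intros f g)
  show "f (moebius A \<tau>) * g (moebius A \<tau>) = f \<tau> * g \<tau>" if "A \<in> G" "\<tau> \<in> upper_half" for A \<tau>
    using f(3)[OF that] g(3)[OF that] by simp
  fix \<cc> assume \<cc>: "\<cc> \<in> cusps G"
  obtain E where E: "cusp_growth E (scalar_slash 0 f (cusp_mat \<cc>))" using f(4)[OF \<cc>] by blast
  obtain E' where E': "cusp_growth E' (scalar_slash 0 g (cusp_mat \<cc>))" using g(4)[OF \<cc>] by blast
  have "cusp_growth (E + E') (scalar_slash 0 (\<lambda>\<tau>. f \<tau> * g \<tau>) (cusp_mat \<cc>))"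
    by (rule cusp_growth_cong[OF cusp_growth_mult[OF E E']]) simp
  then show "\<exists>E. cusp_growth E (scalar_slash 0 (\<lambda>\<tau>. f \<tau> * g \<tau>) (cusp_mat \<cc>))" by blast
qed

lemma restrict_automorphic_function:
  "f \<in> automorphic_functions G \<Longrightarrow> (\<lambda>\<tau>\<in>upper_half. f \<tau>) = f"
  using automorphic_functionsD(1) extensional_restrict by blast

lemma cring_automorphic_ring: "Ring.cring (automorphic_ring G)"
proof (rule cringI)
  show "abelian_group (automorphic_ring G)"
  proof (rule abelian_groupI)
    fix f assume f: "f \<in> carrier (automorphic_ring G)"
    then have f': "f \<in> automorphic_functions G" by (simp add: automorphic_ring_def)
    have "(\<lambda>\<tau>\<in>upper_half. (\<lambda>\<tau>\<in>upper_half. - 1) \<tau> * f \<tau>) \<in> automorphic_functions G"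
      by (rule automorphic_functions_mult[OF automorphic_functions_const f'])
    then show "\<exists>g\<in>carrier (automorphic_ring G). g \<oplus>\<^bsub>automorphic_ring G\<^esub> f = \<zero>\<^bsub>automorphic_ring G\<^esub>"
      by (intro bexI[of _ "\<lambda>\<tau>\<in>upper_half. (\<lambda>\<tau>\<in>upper_half. - 1) \<tau> * f \<tau>"])
        (auto simp: automorphic_ring_def fun_eq_iff restrict_def)
    show "\<zero>\<^bsub>automorphic_ring G\<^esub> \<oplus>\<^bsub>automorphic_ring G\<^esub> f = f"
      using restrict_automorphic_function[OF f']
      by (simp add: automorphic_ring_def restrict_def fun_eq_iff cong: if_cong)
  qed (simp_all add: automorphic_ring_def automorphic_functions_add automorphic_functions_const,
      simp_all add: fun_eq_iff restrict_def algebra_simps)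
  show "Group.comm_monoid (automorphic_ring G)"
  proof (rule comm_monoidI)
    fix f assume "f \<in> carrier (automorphic_ring G)"
    then have "f \<in> automorphic_functions G" by (simp add: automorphic_ring_def)
    from restrict_automorphic_function[OF this]
    show "\<one>\<^bsub>automorphic_ring G\<^esub> \<otimes>\<^bsub>automorphic_ring G\<^esub> f = f"
      by (simp add: automorphic_ring_def restrict_def fun_eq_iff cong: if_cong)
  qed (simp_all add: automorphic_ring_def automorphic_functions_mult automorphic_functions_const,
      simp_all add: fun_eq_iff restrict_def algebra_simps)
qed (auto simp: automorphic_ring_def fun_eq_iff restrict_def algebra_simps)

end

section \<open>Modules of forms of prescribed growth\<close>

context cuspidal_rep
begin

lemma growth_formsD:
  fixes X :: "complex \<Rightarrow> complex Matrix.vec"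
  assumes "X \<in> growth_forms Es k"
  shows "X \<in> upper_half \<rightarrow>\<^sub>E carrier_vec m" "\<And>\<tau>. \<tau> \<in> upper_half \<Longrightarrow> X \<tau> \<in> carrier_vec m"
    "\<And>r. r < m \<Longrightarrow> (\<lambda>\<tau>. X \<tau> $ r) holomorphic_on upper_half"
    "\<And>A \<tau>. A \<in> G \<Longrightarrow> \<tau> \<in> upper_half \<Longrightarrow> slash k X A \<tau> = \<rho> A *\<^sub>v X \<tau>"
    "\<And>\<cc> r. \<cc> \<in> cusps G \<Longrightarrow> r < m \<Longrightarrow> \<exists>E\<in>Es. cusp_growth E (cusp_component k X \<cc> r)"
  using assms unfolding growth_forms_def pre_forms_def by auto

lemma growth_formsI:
  fixes X :: "complex \<Rightarrow> complex Matrix.vec"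
  assumes "\<And>\<tau>. \<tau> \<in> upper_half \<Longrightarrow> X \<tau> \<in> carrier_vec m"
    "\<And>r. r < m \<Longrightarrow> (\<lambda>\<tau>. X \<tau> $ r) holomorphic_on upper_half"
    "\<And>A \<tau>. A \<in> G \<Longrightarrow> \<tau> \<in> upper_half \<Longrightarrow> slash k X A \<tau> = \<rho> A *\<^sub>v X \<tau>"
    "\<And>\<cc> r. \<cc> \<in> cusps G \<Longrightarrow> r < m \<Longrightarrow> \<exists>E\<in>Es. cusp_growth E (cusp_component k X \<cc> r)"
  shows "(\<lambda>\<tau>\<in>upper_half. X \<tau>) \<in> growth_forms Es k"
proof -
  have "(\<lambda>\<tau>. (\<lambda>\<tau>\<in>upper_half. X \<tau>) \<tau> $ r) holomorphic_on upper_half" if "r < m" for r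
    by (rule holomorphic_transform[OF assms(2)[OF that]]) simp
  moreover have "slash k (\<lambda>\<tau>\<in>upper_half. X \<tau>) A \<tau> = \<rho> A *\<^sub>v (\<lambda>\<tau>\<in>upper_half. X \<tau>) \<tau>"
    if "A \<in> G" "\<tau> \<in> upper_half" for A \<tau>
    using assms(3)[OF that] moebius_mem[OF that] that by (simp add: slash_altdef)
  moreover have "\<exists>E\<in>Es. cusp_growth E (cusp_component k (\<lambda>\<tau>\<in>upper_half. X \<tau>) \<cc> r)"
    if \<cc>: "\<cc> \<in> cusps G" and r: "r < m" for \<cc> r
  proof -
    obtain E where E: "E \<in> Es" "cusp_growth E (cusp_component k X \<cc> r)"
      using assms(4)[OF \<cc> r] by blast
    have "cusp_growth E (cusp_component k (\<lambda>\<tau>\<in>upper_half. X \<tau>) \<cc> r)"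
      by (rule cusp_growth_cong[OF E(2)]) (simp add: scalar_slash_def)
    then show ?thesis using E(1) by blast
  qed
  ultimately show ?thesis
    using assms(1) unfolding growth_forms_def pre_forms_def by auto
qed

lemma growth_forms_add:
  assumes "X \<in> growth_forms Es k" "Y \<in> growth_forms Es k"
  shows "(\<lambda>\<tau>\<in>upper_half. X \<tau> + Y \<tau>) \<in> growth_forms Es k"
proof (rule growth_formsI)
  note X = growth_formsD[OF assms(1)] and Y = growth_formsD[OF assms(2)]
  show "X \<tau> + Y \<tau> \<in> carrier_vec m" if "\<tau> \<in> upper_half" for \<tau>
    using X(2) Y(2) that by simp
  have index: "(X \<tau> + Y \<tau>) $ r = X \<tau> $ r + Y \<tau> $ r" if "\<tau> \<in> upper_half" "r < m" for \<tau> r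
    using Y(2)[OF that(1)] that(2) by simp
  show "(\<lambda>\<tau>. (X \<tau> + Y \<tau>) $ r) holomorphic_on upper_half" if "r < m" for r
    by (rule holomorphic_transform[OF holomorphic_on_add[OF X(3)[OF that] Y(3)[OF that]]])
      (simp add: index that)
  show "slash k (\<lambda>\<tau>. X \<tau> + Y \<tau>) A \<tau> = \<rho> A *\<^sub>v (X \<tau> + Y \<tau>)" if "A \<in> G" "\<tau> \<in> upper_half" for A \<tau>
    using X(4)[OF that] Y(4)[OF that] X(2) Y(2) moebius_mem[OF that] that rep_carrier[OF that(1)]
    by (simp add: slash_altdef smult_add_distrib_vec[of _ m] mult_add_distrib_mat_vec[of _ m m])
  fix \<cc> r assume \<cc>: "\<cc> \<in> cusps G" and r: "r < m"
  obtain E E' where E: "E \<in> Es" "cusp_growth E (cusp_component k X \<cc> r)"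
    and E': "E' \<in> Es" "cusp_growth E' (cusp_component k Y \<cc> r)"
    using X(5)[OF \<cc> r] Y(5)[OF \<cc> r] by blast
  have "cusp_growth (min E E') (\<lambda>w. cusp_component k X \<cc> r w + cusp_component k Y \<cc> r w)"
    by (rule cusp_growth_add[OF cusp_growth_mono[OF E(2)] cusp_growth_mono[OF E'(2)]]) auto
  then have "cusp_growth (min E E') (cusp_component k (\<lambda>\<tau>. X \<tau> + Y \<tau>) \<cc> r)"
    by (rule cusp_growth_cong) (use r in \<open>simp add: scalar_slash_def index algebra_simps\<close>)
  moreover have "min E E' \<in> Es" using E(1) E'(1) by (simp add: min_def)
  ultimately show "\<exists>E\<in>Es. cusp_growth E (cusp_component k (\<lambda>\<tau>. X \<tau> + Y \<tau>) \<cc> r)" by blast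
qed

lemma growth_forms_zero:
  assumes "Es \<noteq> {}"
  shows "(\<lambda>\<tau>\<in>upper_half. 0\<^sub>v m) \<in> growth_forms Es k"
proof (rule growth_formsI)
  show "(\<lambda>\<tau>. 0\<^sub>v m $ r :: complex) holomorphic_on upper_half" for r
    by simp
  show "slash k (\<lambda>\<tau>. 0\<^sub>v m) A \<tau> = \<rho> A *\<^sub>v 0\<^sub>v m" if "A \<in> G" for A \<tau>
    using rep_carrier[OF that] by (intro eq_vecI) (auto simp: slash_altdef scalar_prod_def)
  fix \<cc> r assume r: "r < m"
  obtain E where "E \<in> Es" using assms by blast
  moreover have "cusp_growth E (cusp_component k (\<lambda>\<tau>. 0\<^sub>v m) \<cc> r)"
    by (rule cusp_growth_cong[OF cusp_growth_zero]) (use r in \<open>simp add: scalar_slash_def\<close>)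
  ultimately show "\<exists>E\<in>Es. cusp_growth E (cusp_component k (\<lambda>\<tau>. 0\<^sub>v m) \<cc> r)" by blast
qed simp

text \<open>The condition on \<open>E'\<close> covers two uses: constants, of rate 0, act for every
  \<open>Es\<close>, which gives negatives; arbitrary automorphic functions act when all rates are
  permitted.\<close>

lemma growth_forms_smult:
  assumes X: "X \<in> growth_forms Es k" and hol: "f holomorphic_on upper_half"
    and inv: "\<And>A \<tau>. A \<in> G \<Longrightarrow> \<tau> \<in> upper_half \<Longrightarrow> f (moebius A \<tau>) = f \<tau>"
    and growth: "\<And>\<cc>. \<cc> \<in> cusps G \<Longrightarrow>
      \<exists>E'. cusp_growth E' (scalar_slash 0 f (cusp_mat \<cc>)) \<and> (\<forall>E\<in>Es. E' + E \<in> Es)"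
  shows "(\<lambda>\<tau>\<in>upper_half. f \<tau> \<cdot>\<^sub>v X \<tau>) \<in> growth_forms Es k"
proof (rule growth_formsI)
  note X = growth_formsD[OF X]
  show "f \<tau> \<cdot>\<^sub>v X \<tau> \<in> carrier_vec m" if "\<tau> \<in> upper_half" for \<tau>
    using X(2) that by simp
  have index: "(f \<tau> \<cdot>\<^sub>v X \<tau>) $ r = f \<tau> * X \<tau> $ r" if "\<tau> \<in> upper_half" "r < m" for \<tau> r
    using X(2)[OF that(1)] that(2) by simp
  show "(\<lambda>\<tau>. (f \<tau> \<cdot>\<^sub>v X \<tau>) $ r) holomorphic_on upper_half" if "r < m" for r
    by (rule holomorphic_transform[OF holomorphic_on_mult[OF hol X(3)[OF that]]])
      (simp add: index that)
  show "slash k (\<lambda>\<tau>. f \<tau> \<cdot>\<^sub>v X \<tau>) A \<tau> = \<rho> A *\<^sub>v (f \<tau> \<cdot>\<^sub>v X \<tau>)" if "A \<in> G" "\<tau> \<in> upper_half" for A \<tau>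
  proof -
    have "slash k (\<lambda>\<tau>. f \<tau> \<cdot>\<^sub>v X \<tau>) A \<tau> = f \<tau> \<cdot>\<^sub>v slash k X A \<tau>"
      by (simp add: slash_altdef inv[OF that] smult_smult_assoc mult.commute)
    also have "\<dots> = \<rho> A *\<^sub>v (f \<tau> \<cdot>\<^sub>v X \<tau>)"
      unfolding X(4)[OF that] by (rule mult_mat_vec[OF rep_carrier[OF that(1)] X(2)[OF that(2)], symmetric])
    finally show ?thesis .
  qed
  fix \<cc> r assume \<cc>: "\<cc> \<in> cusps G" and r: "r < m"
  obtain E where E: "E \<in> Es" "cusp_growth E (cusp_component k X \<cc> r)"
    using X(5)[OF \<cc> r] by blast
  obtain E' where E': "cusp_growth E' (scalar_slash 0 f (cusp_mat \<cc>))" "\<forall>E\<in>Es. E' + E \<in> Es"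
    using growth[OF \<cc>] by blast
  have "cusp_growth (E' + E) (cusp_component k (\<lambda>\<tau>. f \<tau> \<cdot>\<^sub>v X \<tau>) \<cc> r)"
    by (rule cusp_growth_cong[OF cusp_growth_mult[OF E'(1) E(2)]])
      (use r in \<open>simp add: scalar_slash_def[of k] index\<close>)
  then show "\<exists>E\<in>Es. cusp_growth E (cusp_component k (\<lambda>\<tau>. f \<tau> \<cdot>\<^sub>v X \<tau>) \<cc> r)"
    using E(1) E'(2) by blast
qed

text \<open>Forms are extensional, so module laws have to be checked on the half plane only.\<close>

lemma growth_forms_ext:
  assumes "X \<in> growth_forms Es k" "Y \<in> extensional upper_half" "\<And>\<tau>. \<tau> \<in> upper_half \<Longrightarrow> Y \<tau> = X \<tau>"
  shows "Y = X"
  using assms growth_formsD(1)[OF assms(1)] by (intro extensionalityI[of _ upper_half]) (auto simp: PiE_def)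

lemma abelian_group_growth_forms:
  assumes "Es \<noteq> {}"
  shows "abelian_group (vvaf_module m (growth_forms Es k))"
proof -
  let ?M = "vvaf_module m (growth_forms Es k)"
  show ?thesis
  proof (rule abelian_groupI)
    fix X assume "X \<in> carrier ?M"
    then have X: "X \<in> growth_forms Es k" by (simp add: vvaf_module_def)
    note X' = growth_formsD(2)[OF X]
    have "(\<lambda>\<tau>\<in>upper_half. - 1 \<cdot>\<^sub>v X \<tau>) \<in> growth_forms Es k"
    proof (rule growth_forms_smult[OF X])
      show "\<exists>E'. cusp_growth E' (scalar_slash 0 (\<lambda>\<tau>. - 1) (cusp_mat \<cc>)) \<and> (\<forall>E\<in>Es. E' + E \<in> Es)" for \<cc>
        using cusp_growth_const[of "- 1"] by (intro exI[of _ 0]) (simp add: scalar_slash_weight_0[abs_def])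
    qed simp_all
    moreover have "- 1 \<cdot>\<^sub>v X \<tau> + X \<tau> = 0\<^sub>v m" if "\<tau> \<in> upper_half" for \<tau>
      using X'[OF that] by (intro eq_vecI) auto
    ultimately show "\<exists>Y\<in>carrier ?M.
        Y \<oplus>\<^bsub>?M\<^esub> X = \<zero>\<^bsub>?M\<^esub>"
      by (intro bexI[of _ "\<lambda>\<tau>\<in>upper_half. - 1 \<cdot>\<^sub>v X \<tau>"]) (auto simp: vvaf_module_def cong: restrict_cong)
    show "\<zero>\<^bsub>?M\<^esub> \<oplus>\<^bsub>?M\<^esub> X = X"
      unfolding vvaf_module_def using X' by (intro growth_forms_ext[OF X]) simp_all
    fix Y assume "Y \<in> carrier ?M"
    then have Y: "Y \<in> growth_forms Es k" by (simp add: vvaf_module_def)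
    note Y' = growth_formsD(2)[OF Y]
    show "X \<oplus>\<^bsub>?M\<^esub> Y \<in> carrier ?M"
      using growth_forms_add[OF X Y] by (simp add: vvaf_module_def)
    show "X \<oplus>\<^bsub>?M\<^esub> Y = Y \<oplus>\<^bsub>?M\<^esub> X"
      using X' Y' by (auto simp: vvaf_module_def comm_add_vec[of _ m] intro!: restrict_ext)
    fix Z assume "Z \<in> carrier ?M"
    then have "Z \<in> growth_forms Es k" by (simp add: vvaf_module_def)
    note Z' = growth_formsD(2)[OF this]
    show "X \<oplus>\<^bsub>?M\<^esub> Y \<oplus>\<^bsub>?M\<^esub> Z =
        X \<oplus>\<^bsub>?M\<^esub> (Y \<oplus>\<^bsub>?M\<^esub> Z)"
      using X' Y' Z' by (auto simp: vvaf_module_def assoc_add_vec[of _ m] intro!: restrict_ext)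
  next
    show "\<zero>\<^bsub>?M\<^esub> \<in> carrier ?M"
      using growth_forms_zero[OF assms] by (simp add: vvaf_module_def)
  qed
qed

text \<open>The scalars belong to a possibly larger group \<Gamma>, since forms for H have to become
  a module over the ring of G. This works because cusps of the smaller group are cusps of the larger
  one.\<close>

lemma module_growth_forms:
  assumes \<Gamma>: "cuspidal_group \<Gamma>" "G \<subseteq> \<Gamma>"
  shows "Module.module (automorphic_ring \<Gamma>) (vvaf_module m (growth_forms UNIV k))"
proof (rule moduleI)
  let ?M = "vvaf_module m (growth_forms UNIV k)"
  interpret \<Gamma>: cuspidal_group \<Gamma> by (rule \<Gamma>(1))
  show "Ring.cring (automorphic_ring \<Gamma>)" by (rule \<Gamma>.cring_automorphic_ring)
  show "abelian_group ?M" by (rule abelian_group_growth_forms) simp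
  fix X assume "X \<in> carrier ?M"
  then have X: "X \<in> growth_forms UNIV k" by (simp add: vvaf_module_def)
  note X' = growth_formsD(2)[OF X]
  show "\<one>\<^bsub>automorphic_ring \<Gamma>\<^esub> \<odot>\<^bsub>?M\<^esub> X = X"
    unfolding vvaf_module_def automorphic_ring_def using X' by (intro growth_forms_ext[OF X]) simp_all
  fix f assume "f \<in> carrier (automorphic_ring \<Gamma>)"
  then have "f \<in> automorphic_functions \<Gamma>" by (simp add: automorphic_ring_def)
  note f = \<Gamma>.automorphic_functionsD[OF this]
  have "cusps G \<subseteq> cusps \<Gamma>" using \<Gamma>(2) by (auto simp: cusps_def)
  then have "(\<lambda>\<tau>\<in>upper_half. f \<tau> \<cdot>\<^sub>v X \<tau>) \<in> growth_forms UNIV k"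
    using f \<Gamma>(2) by (intro growth_forms_smult[OF X]) auto
  then show "f \<odot>\<^bsub>?M\<^esub> X \<in> carrier ?M" by (simp add: vvaf_module_def)
  show "f \<odot>\<^bsub>?M\<^esub> (X \<oplus>\<^bsub>?M\<^esub> Y) = f \<odot>\<^bsub>?M\<^esub> X \<oplus>\<^bsub>?M\<^esub> f \<odot>\<^bsub>?M\<^esub> Y" if "Y \<in> carrier ?M" for Y
  proof -
    have "Y \<in> growth_forms UNIV k" using that by (simp add: vvaf_module_def)
    from growth_formsD(2)[OF this] X' show ?thesis
      by (auto simp: vvaf_module_def smult_add_distrib_vec[of _ m] intro!: restrict_ext)
  qed
  fix g
  show "(f \<oplus>\<^bsub>automorphic_ring \<Gamma>\<^esub> g) \<odot>\<^bsub>?M\<^esub> X = f \<odot>\<^bsub>?M\<^esub> X \<oplus>\<^bsub>?M\<^esub> g \<odot>\<^bsub>?M\<^esub> X"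
    by (auto simp: vvaf_module_def automorphic_ring_def add_smult_distrib_vec intro!: restrict_ext)
  show "f \<otimes>\<^bsub>automorphic_ring \<Gamma>\<^esub> g \<odot>\<^bsub>?M\<^esub> X = f \<odot>\<^bsub>?M\<^esub> (g \<odot>\<^bsub>?M\<^esub> X)"
    by (auto simp: vvaf_module_def automorphic_ring_def smult_smult_assoc intro!: restrict_ext)
qed

end

section \<open>Induced representations\<close>

text \<open>With both cusps moved to infinity, \<open>A\<close> becomes an upper triangular
  \<open>B\<close> with diagonal a, 1/a and corner b. It acts by w -> a^2 w + a b with a constant
  automorphy factor, so the rate is multiplied by a^2. Relative cusp widths never have to be
  named.\<close>

lemma cusp_growth_slash:
  assumes A: "A \<in> carrier SL2R" "moebius_bd A \<cc> = \<dd>"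
    and growth: "cusp_growth E (scalar_slash k f (cusp_mat \<dd>))"
  obtains s where "s > 0" "cusp_growth (s * E) (scalar_slash k (scalar_slash k f A) (cusp_mat \<cc>))"
proof -
  define B where "B = adj22 (cusp_mat \<dd>) ** A ** cusp_mat \<cc>"
  have B: "B \<in> carrier SL2R"
    unfolding B_def by (intro mult22_carrier adj22_carrier cusp_mat_carrier A)
  have B21: "B $h 2 $h 1 = 0"
    using A moebius_bd_iff by (simp add: B_def)
  have det: "B $h 1 $h 1 * B $h 2 $h 2 = 1"
    using B B21 by (simp add: carrier_SL2R)
  then have nz: "B $h 1 $h 1 \<noteq> 0" "B $h 2 $h 2 \<noteq> 0" by auto
  have B22: "B $h 2 $h 2 = inverse (B $h 1 $h 1)"
    using det nz by (simp add: field_simps)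
  define s where "s = (B $h 1 $h 1)\<^sup>2"
  define b where "b = B $h 1 $h 1 * B $h 1 $h 2"
  have s: "s > 0" using nz by (simp add: s_def)
  have moebius: "moebius B w = of_real s * w + of_real b" for w
    by (simp add: moebius_def B21 B22 s_def b_def field_simps power2_eq_square)
  have "cusp_mat \<dd> ** B = (cusp_mat \<dd> ** adj22 (cusp_mat \<dd>)) ** A ** cusp_mat \<cc>"
    by (simp add: B_def matrix_mul_assoc)
  then have AB: "A ** cusp_mat \<cc> = cusp_mat \<dd> ** B"
    by (simp add: adj22_right cusp_mat_carrier)
  have "cusp_growth (s * E) (\<lambda>w. of_real (B $h 2 $h 2) powi (- k) *
      scalar_slash k f (cusp_mat \<dd>) (of_real s * w + of_real b))"
    by (intro cusp_growth_cmult cusp_growth_affine growth s)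
  then have "cusp_growth (s * E) (scalar_slash k (scalar_slash k f A) (cusp_mat \<cc>))"
  proof (rule cusp_growth_cong)
    fix w assume w: "w \<in> upper_half"
    have "scalar_slash k (scalar_slash k f A) (cusp_mat \<cc>) w = scalar_slash k f (cusp_mat \<dd> ** B) w"
      unfolding AB[symmetric] by (rule scalar_slash_mult[OF A(1) cusp_mat_carrier w])
    also have "\<dots> = scalar_slash k (scalar_slash k f (cusp_mat \<dd>)) B w"
      by (rule scalar_slash_mult[OF cusp_mat_carrier B w, symmetric])
    also have "\<dots> = of_real (B $h 2 $h 2) powi (- k) *
        scalar_slash k f (cusp_mat \<dd>) (of_real s * w + of_real b)"
      by (simp add: scalar_slash_def[of k _ B] jfac_def B21 moebius)
    finally show "of_real (B $h 2 $h 2) powi (- k) *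
        scalar_slash k f (cusp_mat \<dd>) (of_real s * w + of_real b) =
        scalar_slash k (scalar_slash k f A) (cusp_mat \<cc>) w" ..
  qed
  then show ?thesis using that s by blast
qed

lemma adj22_cancel: "A \<in> carrier SL2R \<Longrightarrow> adj22 A ** (A ** B) = B" for B :: "real^2^2"
  by (simp add: matrix_mul_assoc adj22_left)

lemma slash_mult:
  assumes "A \<in> carrier SL2R" "B \<in> carrier SL2R" "\<tau> \<in> upper_half"
  shows "slash k (slash k X A) B \<tau> = slash k X (A ** B) \<tau>"
  by (simp add: slash_altdef jfac_mult[OF assms(2,3)] moebius_mult[OF assms] power_int_mult_distrib
      smult_smult_assoc mult.commute)

lemma slash_id [simp]: "slash k X id22 \<tau> = X \<tau>"
  by (simp add: slash_altdef)

lemma slash_cong: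
  assumes "A \<in> carrier SL2R" "\<tau> \<in> upper_half" "\<And>w. w \<in> upper_half \<Longrightarrow> X w = Y w"
  shows "slash k X A \<tau> = slash k Y A \<tau>"
  using assms by (simp add: slash_altdef moebius_upper_half)

section \<open>Vectors of length d m as d blocks of length m\<close>

definition block :: "nat \<Rightarrow> complex Matrix.vec \<Rightarrow> nat \<Rightarrow> complex Matrix.vec" where
  "block m v a = Matrix.vec m (\<lambda>i. v $ (a * m + i))"

lemma block_carrier [simp]: "block m v a \<in> carrier_vec m"
  by (simp add: block_def)

lemma block_index_less: "a < d \<Longrightarrow> i < m \<Longrightarrow> a * m + i < d * (m :: nat)"
  by (metis add.commute add_less_le_mono less_eq_Suc_le mult_Suc mult_le_mono1 order_less_le_trans add_less_cancel_right)

lemma block_smult: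
  assumes "v \<in> carrier_vec (d * m)" "a < d"
  shows "block m (c \<cdot>\<^sub>v v) a = c \<cdot>\<^sub>v block m v a"
  using assms block_index_less[of a d _ m] by (intro eq_vecI) (auto simp: block_def)

lemma block_add:
  assumes "v \<in> carrier_vec (d * m)" "w \<in> carrier_vec (d * m)" "a < d"
  shows "block m (v + w) a = block m v a + block m w a"
  using assms block_index_less[of a d _ m] by (intro eq_vecI) (auto simp: block_def)

lemma block_eqI:
  assumes "v \<in> carrier_vec (d * m)" "w \<in> carrier_vec (d * m)" "\<And>a. a < d \<Longrightarrow> block m v a = block m w a"
  shows "v = w"
proof (rule eq_vecI)
  fix r assume "r < dim_vec w"
  then have r: "r < d * m" using assms(2) by simp
  then have "m > 0" "r div m < d" by (auto simp: less_mult_imp_div_less intro: Nat.gr0I)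
  then have "block m v (r div m) $ (r mod m) = block m w (r div m) $ (r mod m)"
    using assms(3) by simp
  then show "v $ r = w $ r"
    using \<open>m > 0\<close> by (simp add: block_def)
qed (use assms in simp)

lemma sum_blocks:
  fixes f :: "nat \<Rightarrow> complex"
  shows "(\<Sum>s<d * m. f s) = (\<Sum>b<d. \<Sum>j<m. f (b * m + j))"
proof -
  have "sum f {b * m..<b * m + m} = (\<Sum>j<m. f (b * m + j))" for b
    by (rule sum.reindex_bij_witness[where i = "\<lambda>j. b * m + j" and j = "\<lambda>s. s - b * m"]) auto
  then show ?thesis
    using sum.nat_group[of f m d] by simp
qed

section \<open>The induced representation as a block permutation matrix\<close>

locale induction_data =
  fixes G H :: "(real^2^2) set" and \<rho> :: rep and m d :: nat and \<gamma> :: "nat \<Rightarrow> real^2^2"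
  assumes subgroup_G: "subgroup G SL2R"
    and subgroup_H: "subgroup H (SL2R\<lparr>carrier := G\<rparr>)"
    and neg_id_H: "- id22 \<in> H"
    and fuchsian_H: "fuchsian_first_kind (to_PSL ` H)"
    and fuchsian_G: "fuchsian_first_kind (to_PSL ` G)"
    and rep: "representation H m \<rho>"
    and unimodular_H: "unimodular_at_parabolics H \<rho>"
    and transversal: "left_transversal G H d \<gamma>"
begin

abbreviation ind_rep :: rep where "ind_rep \<equiv> induced_rep H m d \<gamma> \<rho>"

lemmas G_facts = subgroup_SL2RD[OF subgroup_G]

lemma subgroup_H_SL2R: "subgroup H SL2R"
  using Group.group.incl_subgroup[OF group_SL2R subgroup_G subgroup_H] .

lemmas H_facts = subgroup_SL2RD[OF subgroup_H_SL2R]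

lemma H_subset: "H \<subseteq> G"
  using subgroup.subset[OF subgroup_H] by simp

lemma cuspidal_group_G: "cuspidal_group G"
  by (rule cuspidal_group.intro) (use subgroup_G fuchsian_G neg_id_H H_subset in auto)

lemma cuspidal_group_H: "cuspidal_group H"
  by (rule cuspidal_group.intro) (use subgroup_H_SL2R fuchsian_H neg_id_H in auto)

lemma \<gamma>_mem: "a < d \<Longrightarrow> \<gamma> a \<in> G"
  using transversal by (simp add: left_transversal_def)

lemma \<gamma>_carrier: "a < d \<Longrightarrow> \<gamma> a \<in> carrier SL2R"
  using \<gamma>_mem G_facts(1) by blast

lemma rep_carrier_H: "A \<in> H \<Longrightarrow> \<rho> A \<in> carrier_mat m m"
  and rep_mult: "A \<in> H \<Longrightarrow> B \<in> H \<Longrightarrow> \<rho> (A ** B) = \<rho> A * \<rho> B"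
  and rep_id: "\<rho> id22 = 1\<^sub>m m"
proof -
  have hom: "\<rho> \<in> hom (SL2R\<lparr>carrier := H\<rparr>) (GL m)"
    using rep by (simp add: representation_def)
  have Units: "Units (ring_mat TYPE(complex) m ()) \<subseteq> carrier_mat m m"
    by (auto simp: Units_def ring_mat_def)
  show "A \<in> H \<Longrightarrow> \<rho> A \<in> carrier_mat m m"
    using hom_in_carrier[OF hom, of A] Units by (auto simp: GL_def units_of_def)
  show "A \<in> H \<Longrightarrow> B \<in> H \<Longrightarrow> \<rho> (A ** B) = \<rho> A * \<rho> B"
    using hom_mult[OF hom, of A B] by (simp add: GL_def units_of_def ring_mat_def)
  interpret R: Ring.ring "ring_mat TYPE(complex) m ()" by (rule ring_mat)
  have "Group.group (SL2R\<lparr>carrier := H\<rparr>)"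
    by (rule subgroup.subgroup_is_group[OF subgroup_H_SL2R group_SL2R])
  moreover have "Group.group (GL m)" unfolding GL_def by (rule R.units_group)
  ultimately have "\<rho> \<one>\<^bsub>SL2R\<lparr>carrier := H\<rparr>\<^esub> = \<one>\<^bsub>GL m\<^esub>"
    using group_hom.hom_one[of "SL2R\<lparr>carrier := H\<rparr>" "GL m" \<rho>] hom
    by (simp add: group_hom_def group_hom_axioms_def)
  then show "\<rho> id22 = 1\<^sub>m m"
    by (simp add: GL_def units_of_def ring_mat_def)
qed

lemma coset_mem_iff:
  assumes "A \<in> G" "B \<in> G"
  shows "A <#\<^bsub>SL2R\<^esub> H = B <#\<^bsub>SL2R\<^esub> H \<longleftrightarrow> adj22 A ** B \<in> H"
proof -
  have c: "A \<in> carrier SL2R" "B \<in> carrier SL2R" using assms G_facts(1) by blast+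
  have cancel: "adj22 A ** (A ** C) = C" "A ** (adj22 A ** C) = C" for C
    using c(1) by (simp_all add: matrix_mul_assoc adj22_left adj22_right)
  have cancel': "adj22 B ** (B ** C) = C" "B ** (adj22 B ** C) = C" for C
    using c(2) by (simp_all add: matrix_mul_assoc adj22_left adj22_right)
  show ?thesis
  proof
    assume "A <#\<^bsub>SL2R\<^esub> H = B <#\<^bsub>SL2R\<^esub> H"
    moreover have "B \<in> B <#\<^bsub>SL2R\<^esub> H"
      using H_facts(2) by (force simp: l_coset_def)
    ultimately obtain C where "C \<in> H" "B = A ** C" by (auto simp: l_coset_def)
    then show "adj22 A ** B \<in> H" by (simp add: cancel)
  next
    assume AB: "adj22 A ** B \<in> H"
    then have BA: "adj22 B ** A \<in> H" using H_facts(4)[OF AB] by (simp add: adj22_mult)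
    have "A ** C \<in> B <#\<^bsub>SL2R\<^esub> H" if "C \<in> H" for C
      using H_facts(3)[OF BA that] by (auto simp: l_coset_def matrix_mul_assoc[symmetric] cancel'
        intro!: bexI[of _ "adj22 B ** A ** C"])
    moreover have "B ** C \<in> A <#\<^bsub>SL2R\<^esub> H" if "C \<in> H" for C
      using H_facts(3)[OF AB that] by (auto simp: l_coset_def matrix_mul_assoc[symmetric] cancel
        intro!: bexI[of _ "adj22 A ** B ** C"])
    ultimately show "A <#\<^bsub>SL2R\<^esub> H = B <#\<^bsub>SL2R\<^esub> H"
      by (fastforce simp: l_coset_def)
  qed
qed

lemma transversal_ex1:
  assumes "A \<in> G"
  shows "\<exists>!b. b < d \<and> adj22 A ** \<gamma> b \<in> H"
proof -
  have bij: "bij_betw (\<lambda>a. \<gamma> a <#\<^bsub>SL2R\<^esub> H) {..<d} (lcosets\<^bsub>SL2R\<lparr>carrier := G\<rparr>\<^esub> H)"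
    using transversal by (simp add: left_transversal_def)
  have "A <#\<^bsub>SL2R\<^esub> H \<in> lcosets\<^bsub>SL2R\<lparr>carrier := G\<rparr>\<^esub> H"
    using assms by (auto simp: LCOSETS_def l_coset_def)
  then obtain b where b: "b < d" "A <#\<^bsub>SL2R\<^esub> H = \<gamma> b <#\<^bsub>SL2R\<^esub> H"
    using bij by (auto simp: bij_betw_def)
  show ?thesis
  proof (rule ex1I[of _ b])
    show "b < d \<and> adj22 A ** \<gamma> b \<in> H"
      using b coset_mem_iff[OF assms \<gamma>_mem[OF b(1)]] by simp
    fix c assume c: "c < d \<and> adj22 A ** \<gamma> c \<in> H"
    then have "\<gamma> c <#\<^bsub>SL2R\<^esub> H = \<gamma> b <#\<^bsub>SL2R\<^esub> H"
      using coset_mem_iff[OF assms \<gamma>_mem] b(2) by auto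
    then show "c = b" using bij b(1) c by (auto simp: bij_betw_def inj_on_def)
  qed
qed

text \<open>Elements of \<open>G\<close> permute the cosets, so each block row of the induced matrix
  contains exactly one block that is given by \<open>\<rho>\<close>.\<close>

lemma block_ex1:
  assumes "A \<in> G" "a < d"
  shows "\<exists>!b. b < d \<and> adj22 (\<gamma> a) ** A ** \<gamma> b \<in> H"
  using transversal_ex1[of "adj22 A ** \<gamma> a"] G_facts(3,4) \<gamma>_mem[OF assms(2)] assms(1)
  by (simp add: adj22_mult)

lemma d_pos: "d > 0"
  using transversal_ex1[OF G_facts(2)] by auto

lemma adj_\<gamma>_mult:
  assumes "c < d"
  shows "(A ** \<gamma> c) ** (adj22 (\<gamma> c) ** B) = A ** B"
proof -
  have "(A ** \<gamma> c) ** (adj22 (\<gamma> c) ** B) = A ** (\<gamma> c ** adj22 (\<gamma> c)) ** B"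
    by (simp add: matrix_mul_assoc)
  then show ?thesis by (simp add: adj22_right \<gamma>_carrier[OF assms])
qed

lemma induced_rep_carrier: "ind_rep A \<in> carrier_mat (d * m) (d * m)"
  by (simp add: induced_rep_def)

text \<open>A single block of row \<open>a\<close> survives in the matrix product, so on blocks the
  induced matrix acts through one value of \<open>\<rho>\<close>. Later computations with induced
  matrices rest on this formula.\<close>

lemma induced_rep_block:
  assumes v: "v \<in> carrier_vec (d * m)" and A: "A \<in> G" and ab: "a < d" "b < d"
    and mem: "adj22 (\<gamma> a) ** A ** \<gamma> b \<in> H"
  shows "block m (ind_rep A *\<^sub>v v) a = \<rho> (adj22 (\<gamma> a) ** A ** \<gamma> b) *\<^sub>v block m v b"
proof (rule eq_vecI)
  let ?B = "\<lambda>b. adj22 (\<gamma> a) ** A ** \<gamma> b"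
  note \<rho>B = rep_carrier_H[OF mem]
  show "dim_vec (block m (ind_rep A *\<^sub>v v) a) = dim_vec (\<rho> (?B b) *\<^sub>v block m v b)"
    using \<rho>B by (simp add: block_def)
  fix i assume "i < dim_vec (\<rho> (?B b) *\<^sub>v block m v b)"
  then have i: "i < m" using \<rho>B by simp
  have less: "a * m + i < d * m" by (rule block_index_less[OF ab(1) i])
  have entry: "ind_rep A $$ (a * m + i, c * m + j) = (if c = b then \<rho> (?B b) $$ (i, j) else 0)"
    if "c < d" "j < m" for c j
  proof -
    have "ind_rep A $$ (a * m + i, c * m + j) = (if ?B c \<in> H then \<rho> (?B c) $$ (i, j) else 0)"
      using block_index_less[OF that] less that i
      by (simp add: induced_rep_def Let_def inv_SL2R \<gamma>_carrier ab)
    also have "?B c \<in> H \<longleftrightarrow> c = b"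
      using block_ex1[OF A ab(1)] ab(2) mem that(1) by blast
    finally show ?thesis by auto
  qed
  have "block m (ind_rep A *\<^sub>v v) a $ i = (\<Sum>s<d * m. ind_rep A $$ (a * m + i, s) * v $ s)"
    using i less v induced_rep_carrier[of A] by (simp add: block_def scalar_prod_def atLeast0LessThan)
  also have "\<dots> = (\<Sum>c<d. \<Sum>j<m. ind_rep A $$ (a * m + i, c * m + j) * v $ (c * m + j))"
    by (rule sum_blocks)
  also have "\<dots> = (\<Sum>c<d. if c = b then (\<Sum>j<m. \<rho> (?B b) $$ (i, j) * v $ (b * m + j)) else 0)"
    by (intro sum.cong refl) (simp add: entry)
  also have "\<dots> = (\<Sum>j<m. \<rho> (?B b) $$ (i, j) * v $ (b * m + j))"
    using ab(2) by simp
  also have "\<dots> = (\<rho> (?B b) *\<^sub>v block m v b) $ i"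
    using i \<rho>B by (simp add: scalar_prod_def block_def atLeast0LessThan)
  finally show "block m (ind_rep A *\<^sub>v v) a $ i = (\<rho> (?B b) *\<^sub>v block m v b) $ i" .
qed

section \<open>Parabolic elements of G, seen from H\<close>

lemma cusp_translation_nat_mem:
  assumes "cusp_translation \<cc> x \<in> G"
  shows "cusp_translation \<cc> (of_nat n * x) \<in> G"
proof (induction n)
  case (Suc n)
  then show ?case
    using G_facts(3)[OF Suc assms] by (simp add: cusp_translation_add algebra_simps)
qed (simp add: cusp_translation_0 G_facts(2))

text \<open>Pigeonhole on the cosets of the powers of the translation.\<close>

lemma conj_cusp_translation_mem:
  assumes T: "cusp_translation \<cc> x \<in> G" and a: "a < d"
  obtains n where "n > 0" "adj22 (\<gamma> a) ** cusp_translation \<cc> (of_nat n * x) ** \<gamma> a \<in> H"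
proof -
  let ?T = "\<lambda>n::nat. cusp_translation \<cc> (of_nat n * x)"
  have "\<exists>b. b < d \<and> adj22 (\<gamma> a) ** ?T n ** \<gamma> b \<in> H" for n
    using block_ex1[OF cusp_translation_nat_mem[OF T] a] by blast
  then obtain b where b: "\<And>n. b n < d" "\<And>n. adj22 (\<gamma> a) ** ?T n ** \<gamma> (b n) \<in> H"
    by metis
  have "b ` {..d} \<subseteq> {..<d}" using b(1) by auto
  then have "card (b ` {..d}) \<le> d" using card_mono[of "{..<d}"] by simp
  then have "\<not> inj_on b {..d}" using card_image[of b "{..d}"] by auto
  then obtain i j where "b i = b j" "i < j"
    unfolding inj_on_def by (metis linorder_neqE_nat)
  \<comment> \<open>Dividing one element of \<open>H\<close> by the other cancels their common
    representative and leaves the exponent \<open>j - i\<close>.\<close>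
  have "adj22 (adj22 (\<gamma> a) ** ?T i ** \<gamma> (b i)) \<in> H" using b(2) H_facts(4) by blast
  then have "(adj22 (\<gamma> a) ** ?T j ** \<gamma> (b j)) ** adj22 (adj22 (\<gamma> a) ** ?T i ** \<gamma> (b i)) \<in> H"
    using b(2) H_facts(3) by blast
  also have "adj22 (adj22 (\<gamma> a) ** ?T i ** \<gamma> (b i)) = adj22 (\<gamma> (b j)) ** (cusp_translation \<cc> (- (of_nat i * x)) ** \<gamma> a)"
    by (simp add: adj22_mult adj22_cusp_translation \<open>b i = b j\<close>)
  also have "(adj22 (\<gamma> a) ** ?T j ** \<gamma> (b j)) ** \<dots> =
      adj22 (\<gamma> a) ** ?T j ** (cusp_translation \<cc> (- (of_nat i * x)) ** \<gamma> a)"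
    by (rule adj_\<gamma>_mult[OF b(1)])
  also have "\<dots> = adj22 (\<gamma> a) ** (?T j ** cusp_translation \<cc> (- (of_nat i * x))) ** \<gamma> a"
    by (simp add: matrix_mul_assoc)
  also have "?T j ** cusp_translation \<cc> (- (of_nat i * x)) = ?T (j - i)"
    using \<open>i < j\<close> by (simp add: cusp_translation_add of_nat_diff algebra_simps)
  finally show ?thesis using that[of "j - i"] \<open>i < j\<close> by simp
qed

text \<open>Each application of the translation passes from block to block along the permuted
  cosets. The values of \<open>\<rho>\<close> on the way multiply up to a single one, and the
  eigenvector equation contributes a factor \<open>l\<close> per step. The induction runs through
  arbitrary end blocks \<open>b\<close>; the case of interest is the closed path
  \<open>b = a\<close>.\<close>

lemma induced_eigenvector:
  assumes T: "cusp_translation \<cc> x \<in> G" and v: "v \<in> carrier_vec (d * m)"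
    and eigen: "ind_rep (cusp_translation \<cc> x) *\<^sub>v v = l \<cdot>\<^sub>v v"
    and a: "a < d" and "b < d" and "adj22 (\<gamma> a) ** cusp_translation \<cc> (of_nat n * x) ** \<gamma> b \<in> H"
  shows "\<rho> (adj22 (\<gamma> a) ** cusp_translation \<cc> (of_nat n * x) ** \<gamma> b) *\<^sub>v block m v b = l ^ n \<cdot>\<^sub>v block m v a"
  using assms(5,6)
proof (induction n arbitrary: b)
  case 0
  have "adj22 (\<gamma> a) ** id22 ** \<gamma> a \<in> H"
    using a H_facts(2) by (simp add: adj22_left \<gamma>_carrier)
  moreover have "adj22 (\<gamma> a) ** id22 ** \<gamma> b \<in> H"
    using 0(2) by (simp add: cusp_translation_0)
  ultimately have "b = a"
    using block_ex1[OF G_facts(2) a] 0(1) a by blast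
  then show ?case
    using a by (simp add: cusp_translation_0 adj22_left \<gamma>_carrier rep_id)
next
  case (Suc n)
  let ?T = "cusp_translation \<cc>"
  \<comment> \<open>The coset reached after \<open>n\<close> steps; inserting its representative
    splits off the last step.\<close>
  obtain c where c: "c < d" "adj22 (\<gamma> a) ** ?T (of_nat n * x) ** \<gamma> c \<in> H"
    using block_ex1[OF cusp_translation_nat_mem[OF T] a] by blast
  have factor: "adj22 (\<gamma> a) ** ?T (of_nat (Suc n) * x) ** \<gamma> b =
      (adj22 (\<gamma> a) ** ?T (of_nat n * x) ** \<gamma> c) ** (adj22 (\<gamma> c) ** ?T x ** \<gamma> b)"
  proof -
    have "(adj22 (\<gamma> a) ** ?T (of_nat n * x) ** \<gamma> c) ** (adj22 (\<gamma> c) ** (?T x ** \<gamma> b)) =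
        adj22 (\<gamma> a) ** ?T (of_nat n * x) ** (?T x ** \<gamma> b)"
      by (rule adj_\<gamma>_mult[OF c(1)])
    also have "\<dots> = adj22 (\<gamma> a) ** (?T (of_nat n * x) ** ?T x) ** \<gamma> b"
      by (simp add: matrix_mul_assoc)
    also have "?T (of_nat n * x) ** ?T x = ?T (of_nat (Suc n) * x)"
      by (simp add: cusp_translation_add algebra_simps)
    finally show ?thesis by (simp add: matrix_mul_assoc)
  qed
  have quot: "adj22 (\<gamma> c) ** ?T x ** \<gamma> b \<in> H"
  proof -
    let ?A = "adj22 (\<gamma> a) ** ?T (of_nat n * x) ** \<gamma> c"
    have "adj22 ?A ** (?A ** (adj22 (\<gamma> c) ** ?T x ** \<gamma> b)) \<in> H"
      using Suc.prems(2) H_facts(3)[OF H_facts(4)[OF c(2)]] unfolding factor by blast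
    moreover have "?A \<in> carrier SL2R" using c(2) H_facts(1) by blast
    ultimately show ?thesis
      by (simp only: adj22_cancel)
  qed
  have "\<rho> (adj22 (\<gamma> a) ** ?T (of_nat (Suc n) * x) ** \<gamma> b) *\<^sub>v block m v b =
      \<rho> (adj22 (\<gamma> a) ** ?T (of_nat n * x) ** \<gamma> c) *\<^sub>v (\<rho> (adj22 (\<gamma> c) ** ?T x ** \<gamma> b) *\<^sub>v block m v b)"
    unfolding factor rep_mult[OF c(2) quot]
    by (rule assoc_mult_mat_vec[OF rep_carrier_H[OF c(2)] rep_carrier_H[OF quot] block_carrier])
  also have "\<rho> (adj22 (\<gamma> c) ** ?T x ** \<gamma> b) *\<^sub>v block m v b = l \<cdot>\<^sub>v block m v c"
    unfolding induced_rep_block[OF v T c(1) Suc.prems(1) quot, symmetric] eigen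
    by (rule block_smult[OF v c(1)])
  also have "\<rho> (adj22 (\<gamma> a) ** ?T (of_nat n * x) ** \<gamma> c) *\<^sub>v (l \<cdot>\<^sub>v block m v c) =
      l \<cdot>\<^sub>v (l ^ n \<cdot>\<^sub>v block m v a)"
    unfolding mult_mat_vec[OF rep_carrier_H[OF c(2)] block_carrier] Suc.IH[OF c] ..
  finally show ?case by (simp add: smult_smult_assoc)
qed

lemma parabolic_conj_cusp_translation:
  "B \<in> carrier SL2R \<Longrightarrow> parabolic (adj22 B ** cusp_translation \<cc> x ** B)"
  by (simp add: parabolic_def trace_conj trace_cusp_translation)

text \<open>Some block of the eigenvector is nonzero. Along a closed path of length n from this
  block to itself, it is an eigenvector of \<open>\<rho>\<close> at a parabolic element of
  \<open>H\<close>, with eigenvalue l^n.\<close>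

lemma induced_unimodular:
  assumes T: "cusp_translation \<cc> x \<in> G" and eigen: "eigenvalue (ind_rep (cusp_translation \<cc> x)) l"
  shows "norm l = 1"
proof -
  obtain v where v: "v \<in> carrier_vec (d * m)" "v \<noteq> 0\<^sub>v (d * m)"
    "ind_rep (cusp_translation \<cc> x) *\<^sub>v v = l \<cdot>\<^sub>v v"
    using eigen induced_rep_carrier[of "cusp_translation \<cc> x"] by (auto simp: eigenvalue_def eigenvector_def)
  obtain a where a: "a < d" "block m v a \<noteq> block m (0\<^sub>v (d * m)) a"
    using block_eqI[OF v(1), of "0\<^sub>v (d * m)"] v(2) by auto
  have "block m (0\<^sub>v (d * m)) a = 0\<^sub>v m"
    using block_index_less[OF a(1)] by (intro eq_vecI) (auto simp: block_def)
  then have nz: "block m v a \<noteq> 0\<^sub>v m" using a(2) by simp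
  obtain n where n: "n > 0" "adj22 (\<gamma> a) ** cusp_translation \<cc> (of_nat n * x) ** \<gamma> a \<in> H"
    using conj_cusp_translation_mem[OF T a(1)] by blast
  let ?B = "adj22 (\<gamma> a) ** cusp_translation \<cc> (of_nat n * x) ** \<gamma> a"
  have "\<rho> ?B *\<^sub>v block m v a = l ^ n \<cdot>\<^sub>v block m v a"
    by (rule induced_eigenvector[OF T v(1,3) a(1) a(1) n(2)])
  then have "eigenvalue (\<rho> ?B) (l ^ n)"
    using rep_carrier_H[OF n(2)] nz by (auto simp: eigenvalue_def eigenvector_def intro!: exI[of _ "block m v a"])
  then have "norm (l ^ n) = 1"
    using unimodular_H n(2) parabolic_conj_cusp_translation[OF \<gamma>_carrier[OF a(1)]]
    by (auto simp: unimodular_at_parabolics_def)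
  then show ?thesis
    using n(1) power_eq_imp_eq_base[of "norm l" n 1] by (simp add: norm_power)
qed

lemma cuspidal_rep_H: "cuspidal_rep H m \<rho>"
proof -
  interpret H: cuspidal_group H by (rule cuspidal_group_H)
  show ?thesis
  proof unfold_locales
    show "norm l = 1" if "\<cc> \<in> cusps H" "eigenvalue (\<rho> (cusp_gen H \<cc>)) l" for \<cc> l
      using that unimodular_H H.cusp_gen_mem[OF that(1)] trace_cusp_translation
      by (auto simp: unimodular_at_parabolics_def parabolic_def cusp_gen_def)
  qed (rule rep_carrier_H)
qed

lemma cuspidal_rep_G: "cuspidal_rep G (d * m) ind_rep"
proof -
  interpret G: cuspidal_group G by (rule cuspidal_group_G)
  show ?thesis
  proof unfold_locales
    show "norm l = 1" if "\<cc> \<in> cusps G" "eigenvalue (ind_rep (cusp_gen G \<cc>)) l" for \<cc> l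
      using induced_unimodular G.cusp_gen_mem[OF that(1)] that(2) unfolding cusp_gen_def by blast
  qed (rule induced_rep_carrier)
qed

section \<open>Moving cusps between G and H\<close>

lemma cusps_conj_G:
  assumes "\<cc> \<in> cusps G" "A \<in> G"
  shows "moebius_bd A \<cc> \<in> cusps G"
proof -
  obtain B where B: "B \<in> G" "parabolic B" "B \<noteq> id22" "B \<noteq> - id22" "moebius_bd B \<cc> = \<cc>"
    using assms(1) by (auto simp: cusps_def)
  have c: "A \<in> carrier SL2R" "B \<in> carrier SL2R" using assms(2) B(1) G_facts(1) by blast+
  let ?C = "A ** B ** adj22 A"
  have conj_back: "B = adj22 A ** ?C ** A"
  proof -
    have "adj22 A ** ?C ** A = (adj22 A ** A) ** B ** (adj22 A ** A)" by (simp add: matrix_mul_assoc)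
    then show ?thesis by (simp add: adj22_left c)
  qed
  have "?C \<in> G" using assms(2) B(1) G_facts(3,4) by blast
  moreover have "parabolic ?C"
    using B(2) trace_conj[OF c(1), of ?C] unfolding conj_back[symmetric] by (simp add: parabolic_def)
  moreover have "?C \<noteq> id22" using B(3) conj_back c by (auto simp: adj22_left)
  moreover have "?C \<noteq> - id22" using B(4) conj_back c by (auto simp: adj22_left mult22_minus)
  moreover have "moebius_bd ?C (moebius_bd A \<cc>) = moebius_bd A \<cc>"
    by (intro moebius_bd_mult[OF mult22_carrier[OF c] adj22_carrier[OF c(1)]
          moebius_bd_adj22[OF c(1) refl]] moebius_bd_mult[OF c B(5) refl])
  ultimately show ?thesis unfolding cusps_def by blast
qed

lemma cusps_H_subset: "cusps H \<subseteq> cusps G"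
  using H_subset by (auto simp: cusps_def)

text \<open>A power of the translation at \<open>\<cc>\<close>, conjugated by the representative,
  lies in \<open>H\<close>, is parabolic and fixes the transported cusp. It is nontrivial because a
  nonzero length has nonzero multiples.\<close>

lemma cusps_G_H:
  assumes "\<cc> \<in> cusps G" "a < d"
  shows "moebius_bd (adj22 (\<gamma> a)) \<cc> \<in> cusps H"
proof -
  obtain B where B: "B \<in> G" "parabolic B" "B \<noteq> id22" "B \<noteq> - id22" "moebius_bd B \<cc> = \<cc>"
    using assms(1) by (auto simp: cusps_def)
  have "B \<in> carrier SL2R" using B(1) G_facts(1) by blast
  then obtain x where x: "B = cusp_translation \<cc> x \<or> B = - cusp_translation \<cc> x"
    using parabolic_fixing_cusp[OF _ B(5,2)] by blast
  have "- B \<in> G" using G_facts(3)[OF _ B(1), of "- id22"] neg_id_H H_subset by (auto simp: mult22_minus)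
  then have T: "cusp_translation \<cc> x \<in> G" using x B(1) by auto
  have "x \<noteq> 0" using x B(3,4) cusp_translation_0 by auto
  obtain n where n: "n > 0" "adj22 (\<gamma> a) ** cusp_translation \<cc> (of_nat n * x) ** \<gamma> a \<in> H"
    using conj_cusp_translation_mem[OF T assms(2)] by blast
  let ?T = "cusp_translation \<cc> (of_nat n * x)"
  let ?C = "adj22 (\<gamma> a) ** ?T ** \<gamma> a"
  note c = \<gamma>_carrier[OF assms(2)]
  have conj_back: "?T = \<gamma> a ** ?C ** adj22 (\<gamma> a)"
  proof -
    have "\<gamma> a ** ?C ** adj22 (\<gamma> a) = (\<gamma> a ** adj22 (\<gamma> a)) ** ?T ** (\<gamma> a ** adj22 (\<gamma> a))"
      by (simp add: matrix_mul_assoc)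
    then show ?thesis by (simp add: adj22_right c)
  qed
  have "of_nat n * x \<noteq> 0" using n(1) \<open>x \<noteq> 0\<close> by simp
  then have "\<not> (?T = id22 \<or> ?T = - id22)"
    using cusp_translation_eqD[OF _ cusp_translation_0[symmetric]] by blast
  moreover have "?T = id22" if "?C = id22"
    by (subst conj_back) (simp add: that adj22_right c)
  moreover have "?T = - id22" if "?C = - id22"
    by (subst conj_back) (simp add: that adj22_right c mult22_minus)
  ultimately have "?C \<noteq> id22" "?C \<noteq> - id22" by blast+
  moreover have "parabolic ?C" by (rule parabolic_conj_cusp_translation[OF c])
  moreover have "moebius_bd ?C (moebius_bd (adj22 (\<gamma> a)) \<cc>) = moebius_bd (adj22 (\<gamma> a)) \<cc>"
  proof (rule moebius_bd_mult[OF mult22_carrier[OF adj22_carrier[OF c] cusp_translation_carrier] c])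
    show "moebius_bd (\<gamma> a) (moebius_bd (adj22 (\<gamma> a)) \<cc>) = \<cc>"
      using moebius_bd_adj22[OF adj22_carrier[OF c] refl, of \<cc>] by simp
    show "moebius_bd (adj22 (\<gamma> a) ** ?T) \<cc> = moebius_bd (adj22 (\<gamma> a)) \<cc>"
      by (rule moebius_bd_mult[OF adj22_carrier[OF c] cusp_translation_carrier
            moebius_bd_cusp_translation refl])
  qed
  ultimately show ?thesis using n(2) unfolding cusps_def by blast
qed

end

section \<open>The two maps between forms for H and forms for G\<close>

lemma slash_mat_vec:
  assumes "M \<in> carrier_mat m m" "Z (moebius A \<tau>) \<in> carrier_vec m"
  shows "slash k (\<lambda>w. M *\<^sub>v Z w) A \<tau> = M *\<^sub>v slash k Z A \<tau>"
  unfolding slash_altdef by (rule mult_mat_vec[OF assms, symmetric])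

lemma slash_block:
  assumes "Y (moebius A \<tau>) \<in> carrier_vec (d * m)" "a < d"
  shows "slash k (\<lambda>w. block m (Y w) a) A \<tau> = block m (slash k Y A \<tau>) a"
  unfolding slash_altdef by (rule block_smult[OF assms, symmetric])

context induction_data
begin

interpretation H: cuspidal_rep H m \<rho>
  by (rule cuspidal_rep_H)

interpretation G: cuspidal_rep G "d * m" ind_rep
  by (rule cuspidal_rep_G)

definition induced_fun :: "int \<Rightarrow> (complex \<Rightarrow> complex Matrix.vec) \<Rightarrow> complex \<Rightarrow> complex Matrix.vec" where
  "induced_fun k X \<tau> = Matrix.vec (d * m) (\<lambda>r. slash k X (adj22 (\<gamma> (r div m))) \<tau> $ (r mod m))"

abbreviation induced_form :: "int \<Rightarrow> (complex \<Rightarrow> complex Matrix.vec) \<Rightarrow> complex \<Rightarrow> complex Matrix.vec" where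
  "induced_form k X \<equiv> (\<lambda>\<tau>\<in>upper_half. induced_fun k X \<tau>)"

text \<open>The representative with index 0 may be any element of its coset, so block 0 has to be
  moved back by \<open>\<gamma> 0\<close>.\<close>

definition component_fun :: "int \<Rightarrow> (complex \<Rightarrow> complex Matrix.vec) \<Rightarrow> complex \<Rightarrow> complex Matrix.vec" where
  "component_fun k Y = slash k (\<lambda>w. block m (Y w) 0) (\<gamma> 0)"

abbreviation component_form :: "int \<Rightarrow> (complex \<Rightarrow> complex Matrix.vec) \<Rightarrow> complex \<Rightarrow> complex Matrix.vec" where
  "component_form k Y \<equiv> (\<lambda>\<tau>\<in>upper_half. component_fun k Y \<tau>)"

lemma adj_\<gamma>_carrier: "a < d \<Longrightarrow> adj22 (\<gamma> a) \<in> carrier SL2R"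
  by (intro adj22_carrier \<gamma>_carrier)

lemma induced_fun_carrier: "induced_fun k X \<tau> \<in> carrier_vec (d * m)"
  by (simp add: induced_fun_def)

lemma block_induced_fun:
  assumes "X \<in> upper_half \<rightarrow> carrier_vec m" "\<tau> \<in> upper_half" "a < d"
  shows "block m (induced_fun k X \<tau>) a = slash k X (adj22 (\<gamma> a)) \<tau>"
  using slash_carrier[OF adj_\<gamma>_carrier[OF assms(3)] assms(2,1), of k] block_index_less[OF assms(3)]
  by (intro eq_vecI) (auto simp: block_def induced_fun_def)

text \<open>Writing \<gamma>_a^(-1) A = B \<gamma>_b^(-1) with B in H moves \<open>A\<close> past
  the representatives; automorphy of X turns B into \<open>\<rho> B\<close>, which is the block of
  the induced matrix at (a, b).\<close>

lemma slash_induced_fun: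
  assumes X: "X \<in> H.growth_forms Es k" and A: "A \<in> G" and \<tau>: "\<tau> \<in> upper_half"
  shows "slash k (induced_fun k X) A \<tau> = ind_rep A *\<^sub>v induced_fun k X \<tau>"
proof (rule block_eqI)
  note X' = H.growth_formsD[OF X]
  have Xc: "X \<in> upper_half \<rightarrow> carrier_vec m" using X'(2) by blast
  have Ac: "A \<in> carrier SL2R" using A G_facts(1) by blast
  show "slash k (induced_fun k X) A \<tau> \<in> carrier_vec (d * m)"
    using induced_fun_carrier by (simp add: slash_altdef)
  show "ind_rep A *\<^sub>v induced_fun k X \<tau> \<in> carrier_vec (d * m)"
    by (rule mult_mat_vec_carrier[OF induced_rep_carrier induced_fun_carrier])
  fix a assume a: "a < d"
  obtain b where b: "b < d" "adj22 (\<gamma> a) ** A ** \<gamma> b \<in> H"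
    using block_ex1[OF A a] by blast
  let ?B = "adj22 (\<gamma> a) ** A ** \<gamma> b"
  have Bc: "?B \<in> carrier SL2R" using b(2) H_facts(1) by blast
  have A\<tau>: "moebius A \<tau> \<in> upper_half" by (rule moebius_upper_half[OF Ac \<tau>])
  have b\<tau>: "moebius (adj22 (\<gamma> b)) \<tau> \<in> upper_half"
    by (rule moebius_upper_half[OF adj_\<gamma>_carrier[OF b(1)] \<tau>])
  have "block m (slash k (induced_fun k X) A \<tau>) a = slash k (\<lambda>w. block m (induced_fun k X w) a) A \<tau>"
    by (rule slash_block[where Y = "induced_fun k X", OF induced_fun_carrier a, symmetric])
  also have "\<dots> = slash k (slash k X (adj22 (\<gamma> a))) A \<tau>"
    using block_induced_fun[OF Xc A\<tau> a] by (simp add: slash_altdef[of k _ A])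
  also have "\<dots> = slash k X (adj22 (\<gamma> a) ** A) \<tau>"
    by (rule slash_mult[OF adj_\<gamma>_carrier[OF a] Ac \<tau>])
  also have "adj22 (\<gamma> a) ** A = ?B ** adj22 (\<gamma> b)"
    using adj_\<gamma>_mult[OF b(1), of "adj22 (\<gamma> a) ** A" id22] by (simp add: matrix_mul_assoc)
  also have "slash k X (?B ** adj22 (\<gamma> b)) \<tau> = slash k (slash k X ?B) (adj22 (\<gamma> b)) \<tau>"
    by (rule slash_mult[OF Bc adj_\<gamma>_carrier[OF b(1)] \<tau>, symmetric])
  also have "\<dots> = slash k (\<lambda>w. \<rho> ?B *\<^sub>v X w) (adj22 (\<gamma> b)) \<tau>"
    by (rule slash_cong[OF adj_\<gamma>_carrier[OF b(1)] \<tau>]) (rule X'(4)[OF b(2)])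
  also have "\<dots> = \<rho> ?B *\<^sub>v slash k X (adj22 (\<gamma> b)) \<tau>"
    by (rule slash_mat_vec[where Z = X, OF rep_carrier_H[OF b(2)] X'(2)[OF b\<tau>]])
  also have "\<dots> = block m (ind_rep A *\<^sub>v induced_fun k X \<tau>) a"
    unfolding induced_rep_block[OF induced_fun_carrier A a b] block_induced_fun[OF Xc \<tau> b(1)] ..
  finally show "block m (slash k (induced_fun k X) A \<tau>) a = block m (ind_rep A *\<^sub>v induced_fun k X \<tau>) a" .
qed

text \<open>At a cusp of G, the components in block a grow as X does at the image of the cusp under
  \<gamma>_a^(-1), a cusp of H, up to a positive factor on the rate. The closure condition on
  \<open>Es\<close> absorbs this factor.\<close>

lemma induced_form_mem:
  assumes X: "X \<in> H.growth_forms Es k" and Es: "\<And>s E. s > 0 \<Longrightarrow> E \<in> Es \<Longrightarrow> s * E \<in> Es"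
  shows "induced_form k X \<in> G.growth_forms Es k"
proof (rule G.growth_formsI)
  note X' = H.growth_formsD[OF X]
  have Xc: "X \<in> upper_half \<rightarrow> carrier_vec m" using X'(2) by blast
  show "induced_fun k X \<tau> \<in> carrier_vec (d * m)" for \<tau> by (rule induced_fun_carrier)
  show "slash k (induced_fun k X) A \<tau> = ind_rep A *\<^sub>v induced_fun k X \<tau>"
    if "A \<in> G" "\<tau> \<in> upper_half" for A \<tau>
    by (rule slash_induced_fun[OF X that])
  have div_mod: "r div m < d" "r mod m < m" if "r < d * m" for r
    using that by (auto simp: less_mult_imp_div_less intro!: mod_less_divisor Nat.gr0I)
  have index: "induced_fun k X \<tau> $ r =
      scalar_slash k (\<lambda>\<tau>. X \<tau> $ (r mod m)) (adj22 (\<gamma> (r div m))) \<tau>"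
    if "r < d * m" "\<tau> \<in> upper_half" for r \<tau>
    using that slash_index[OF adj_\<gamma>_carrier[OF div_mod(1)] _ Xc div_mod(2)] by (simp add: induced_fun_def)
  show "(\<lambda>\<tau>. induced_fun k X \<tau> $ r) holomorphic_on upper_half" if r: "r < d * m" for r
    by (rule holomorphic_transform[OF holomorphic_scalar_slash[OF adj_\<gamma>_carrier[OF div_mod(1)[OF r]]
          X'(3)[OF div_mod(2)[OF r]]]]) (simp add: index r)
  fix \<cc> r assume \<cc>: "\<cc> \<in> cusps G" and r: "r < d * m"
  let ?A = "adj22 (\<gamma> (r div m))"
  note A = adj_\<gamma>_carrier[OF div_mod(1)[OF r]]
  obtain E where E: "E \<in> Es" "cusp_growth E (cusp_component k X (moebius_bd ?A \<cc>) (r mod m))"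
    using X'(5)[OF cusps_G_H[OF \<cc> div_mod(1)[OF r]] div_mod(2)[OF r]] by blast
  obtain s where s: "s > 0"
    "cusp_growth (s * E) (scalar_slash k (scalar_slash k (\<lambda>\<tau>. X \<tau> $ (r mod m)) ?A) (cusp_mat \<cc>))"
    by (rule cusp_growth_slash[OF A refl E(2)])
  have "cusp_growth (s * E) (cusp_component k (induced_fun k X) \<cc> r)"
    by (rule cusp_growth_cong[OF s(2)])
      (rule scalar_slash_cong[OF cusp_mat_carrier], simp_all add: index r)
  then show "\<exists>E\<in>Es. cusp_growth E (cusp_component k (induced_fun k X) \<cc> r)"
    using Es[OF s(1) E(1)] by blast
qed

text \<open>An element \<open>B\<close> of H acts on the component as its conjugate by
  \<open>\<gamma> 0\<close> acts on block 0 of \<open>Y\<close>, and the diagonal block 0 of the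
  induced matrix at this conjugate is \<open>\<rho> B\<close>.\<close>

lemma component_form_mem:
  assumes Y: "Y \<in> G.growth_forms Es k" and Es: "\<And>s E. s > 0 \<Longrightarrow> E \<in> Es \<Longrightarrow> s * E \<in> Es"
  shows "component_form k Y \<in> H.growth_forms Es k"
proof (rule H.growth_formsI)
  note Y' = G.growth_formsD[OF Y]
  note \<gamma>0 = \<gamma>_carrier[OF d_pos]
  let ?Z = "\<lambda>w. block m (Y w) 0"
  have Zc: "?Z \<in> upper_half \<rightarrow> carrier_vec m" by simp
  show "component_fun k Y \<tau> \<in> carrier_vec m" if "\<tau> \<in> upper_half" for \<tau>
    unfolding component_fun_def by (rule slash_carrier[OF \<gamma>0 that Zc])
  show "slash k (component_fun k Y) B \<tau> = \<rho> B *\<^sub>v component_fun k Y \<tau>"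
    if B: "B \<in> H" and \<tau>: "\<tau> \<in> upper_half" for B \<tau>
  proof -
    let ?A = "\<gamma> 0 ** B ** adj22 (\<gamma> 0)"
    have Bc: "B \<in> carrier SL2R" using B H_facts(1) by blast
    have A: "?A \<in> G" using G_facts(3,4) \<gamma>_mem[OF d_pos] B H_subset by blast
    then have Ac: "?A \<in> carrier SL2R" using G_facts(1) by blast
    have A\<gamma>: "?A ** \<gamma> 0 = \<gamma> 0 ** B"
      by (simp add: matrix_mul_assoc[symmetric] adj22_left[OF \<gamma>0])
    then have conj: "adj22 (\<gamma> 0) ** ?A ** \<gamma> 0 = B"
      by (simp add: matrix_mul_assoc[symmetric] adj22_cancel[OF \<gamma>0] adj22_left[OF \<gamma>0])
    have "slash k (component_fun k Y) B \<tau> = slash k ?Z (?A ** \<gamma> 0) \<tau>"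
      unfolding component_fun_def A\<gamma> by (rule slash_mult[OF \<gamma>0 Bc \<tau>])
    also have "\<dots> = slash k (slash k ?Z ?A) (\<gamma> 0) \<tau>"
      by (rule slash_mult[OF Ac \<gamma>0 \<tau>, symmetric])
    also have "\<dots> = slash k (\<lambda>w. \<rho> B *\<^sub>v ?Z w) (\<gamma> 0) \<tau>"
    proof (rule slash_cong[OF \<gamma>0 \<tau>])
      fix w assume w: "w \<in> upper_half"
      have "slash k ?Z ?A w = block m (slash k Y ?A w) 0"
        by (rule slash_block[where Y = Y, OF Y'(2)[OF moebius_upper_half[OF Ac w]] d_pos])
      also have "\<dots> = block m (ind_rep ?A *\<^sub>v Y w) 0"
        unfolding Y'(4)[OF A w] ..
      also have "\<dots> = \<rho> B *\<^sub>v ?Z w"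
        using induced_rep_block[OF Y'(2)[OF w] A d_pos d_pos] B unfolding conj by blast
      finally show "slash k ?Z ?A w = \<rho> B *\<^sub>v ?Z w" .
    qed
    also have "\<dots> = \<rho> B *\<^sub>v component_fun k Y \<tau>"
      unfolding component_fun_def by (rule slash_mat_vec[where Z = ?Z, OF rep_carrier_H[OF B] block_carrier])
    finally show ?thesis .
  qed
  have less: "r < d * m" if "r < m" for r
    using block_index_less[OF d_pos that] by simp
  have index: "component_fun k Y \<tau> $ r = scalar_slash k (\<lambda>\<tau>. Y \<tau> $ r) (\<gamma> 0) \<tau>"
    if "r < m" "\<tau> \<in> upper_half" for r \<tau>
    unfolding component_fun_def slash_index[OF \<gamma>0 that(2) Zc that(1)]
    using that(1) by (simp add: block_def)
  show "(\<lambda>\<tau>. component_fun k Y \<tau> $ r) holomorphic_on upper_half" if r: "r < m" for r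
    by (rule holomorphic_transform[OF holomorphic_scalar_slash[OF \<gamma>0 Y'(3)[OF less[OF r]]]])
      (simp add: index r)
  fix \<cc> r assume \<cc>: "\<cc> \<in> cusps H" and r: "r < m"
  have "moebius_bd (\<gamma> 0) \<cc> \<in> cusps G"
    using cusps_conj_G[OF _ \<gamma>_mem[OF d_pos]] \<cc> cusps_H_subset by blast
  then obtain E where E: "E \<in> Es" "cusp_growth E (cusp_component k Y (moebius_bd (\<gamma> 0) \<cc>) r)"
    using Y'(5)[OF _ less[OF r]] by blast
  obtain s where s: "s > 0"
    "cusp_growth (s * E) (scalar_slash k (scalar_slash k (\<lambda>\<tau>. Y \<tau> $ r) (\<gamma> 0)) (cusp_mat \<cc>))"
    by (rule cusp_growth_slash[OF \<gamma>0 refl E(2)])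
  have "cusp_growth (s * E) (cusp_component k (component_fun k Y) \<cc> r)"
    by (rule cusp_growth_cong[OF s(2)])
      (rule scalar_slash_cong[OF cusp_mat_carrier], simp_all add: index r)
  then show "\<exists>E\<in>Es. cusp_growth E (cusp_component k (component_fun k Y) \<cc> r)"
    using Es[OF s(1) E(1)] by blast
qed

lemma component_induced_form:
  assumes X: "X \<in> upper_half \<rightarrow>\<^sub>E carrier_vec m"
  shows "component_form k (induced_form k X) = X"
proof (rule extensionalityI[of _ upper_half])
  note \<gamma>0 = \<gamma>_carrier[OF d_pos]
  have Xc: "X \<in> upper_half \<rightarrow> carrier_vec m" using X by auto
  fix \<tau> assume \<tau>: "\<tau> \<in> upper_half"
  have "component_fun k (induced_form k X) \<tau> = slash k (slash k X (adj22 (\<gamma> 0))) (\<gamma> 0) \<tau>"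
    unfolding component_fun_def
    by (rule slash_cong[OF \<gamma>0 \<tau>]) (simp add: block_induced_fun[OF Xc _ d_pos])
  also have "\<dots> = X \<tau>"
    by (simp add: slash_mult[OF adj22_carrier[OF \<gamma>0] \<gamma>0 \<tau>] adj22_left[OF \<gamma>0])
  finally show "component_form k (induced_form k X) \<tau> = X \<tau>"
    using \<tau> by simp
qed (use X in \<open>auto simp: PiE_def\<close>)

text \<open>Block 0 determines a form for the induced representation: at the element \<gamma>_0
  \<gamma>_a^(-1) of G, the block (0, a) of the induced matrix is the identity, so automorphy
  recovers block a from block 0.\<close>

lemma induced_component_form:
  assumes Y: "Y \<in> G.growth_forms Es k"
  shows "induced_form k (component_form k Y) = Y"
proof (rule G.growth_forms_ext[OF Y])
  note Y' = G.growth_formsD[OF Y]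
  note \<gamma>0 = \<gamma>_carrier[OF d_pos]
  let ?Z = "\<lambda>w. block m (Y w) 0"
  have c: "component_form k Y \<in> upper_half \<rightarrow> carrier_vec m"
    using slash_carrier[OF \<gamma>0, of _ ?Z] by (auto simp: component_fun_def)
  fix \<tau> assume \<tau>: "\<tau> \<in> upper_half"
  have "induced_fun k (component_form k Y) \<tau> = Y \<tau>"
  proof (rule block_eqI[OF induced_fun_carrier Y'(2)[OF \<tau>]])
    fix a assume a: "a < d"
    let ?A = "\<gamma> 0 ** adj22 (\<gamma> a)"
    have A: "?A \<in> G" using G_facts(3,4) \<gamma>_mem d_pos a by blast
    then have Ac: "?A \<in> carrier SL2R" using G_facts(1) by blast
    have id: "adj22 (\<gamma> 0) ** ?A ** \<gamma> a = id22"
    proof -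
      have "adj22 (\<gamma> 0) ** ?A ** \<gamma> a = (adj22 (\<gamma> 0) ** \<gamma> 0) ** (adj22 (\<gamma> a) ** \<gamma> a)"
        by (simp add: matrix_mul_assoc)
      then show ?thesis by (simp add: adj22_left[OF \<gamma>_carrier[OF a]] adj22_left[OF \<gamma>0])
    qed
    have "block m (induced_fun k (component_form k Y) \<tau>) a = slash k (component_form k Y) (adj22 (\<gamma> a)) \<tau>"
      by (rule block_induced_fun[OF c \<tau> a])
    also have "\<dots> = slash k (slash k ?Z (\<gamma> 0)) (adj22 (\<gamma> a)) \<tau>"
      by (rule slash_cong[OF adj_\<gamma>_carrier[OF a] \<tau>]) (simp add: component_fun_def)
    also have "\<dots> = slash k ?Z ?A \<tau>"
      by (rule slash_mult[OF \<gamma>0 adj_\<gamma>_carrier[OF a] \<tau>])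
    also have "\<dots> = block m (slash k Y ?A \<tau>) 0"
      by (rule slash_block[where Y = Y, OF Y'(2)[OF moebius_upper_half[OF Ac \<tau>]] d_pos])
    also have "\<dots> = block m (Y \<tau>) a"
      unfolding Y'(4)[OF A \<tau>]
      using induced_rep_block[OF Y'(2)[OF \<tau>] A d_pos a] H_facts(2) unfolding id rep_id by simp
    finally show "block m (induced_fun k (component_form k Y) \<tau>) a = block m (Y \<tau>) a" .
  qed
  then show "induced_form k (component_form k Y) \<tau> = Y \<tau>"
    using \<tau> by simp
qed simp

lemma bij_induced_form:
  assumes "\<And>s E. s > 0 \<Longrightarrow> E \<in> Es \<Longrightarrow> s * E \<in> Es"
  shows "bij_betw (induced_form k) (H.growth_forms Es k) (G.growth_forms Es k)"
  by (rule bij_betwI[where g = "component_form k"])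
    (use induced_form_mem[OF _ assms] component_form_mem[OF _ assms] component_induced_form
      H.growth_formsD(1) induced_component_form in auto)

lemma induced_form_add:
  assumes X: "X \<in> upper_half \<rightarrow> carrier_vec m" and Y: "Y \<in> upper_half \<rightarrow> carrier_vec m"
  shows "induced_form k (\<lambda>\<tau>\<in>upper_half. X \<tau> + Y \<tau>) =
    (\<lambda>\<tau>\<in>upper_half. induced_form k X \<tau> + induced_form k Y \<tau>)"
proof (rule restrict_ext)
  fix \<tau> assume \<tau>: "\<tau> \<in> upper_half"
  have XY: "(\<lambda>\<tau>\<in>upper_half. X \<tau> + Y \<tau>) \<in> upper_half \<rightarrow> carrier_vec m"
    using X Y by (auto intro!: add_carrier_vec)
  have "induced_fun k (\<lambda>\<tau>\<in>upper_half. X \<tau> + Y \<tau>) \<tau> = induced_fun k X \<tau> + induced_fun k Y \<tau>"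
  proof (rule block_eqI[OF induced_fun_carrier add_carrier_vec[OF induced_fun_carrier induced_fun_carrier]])
    fix a assume a: "a < d"
    have "moebius (adj22 (\<gamma> a)) \<tau> \<in> upper_half" by (rule moebius_upper_half[OF adj_\<gamma>_carrier[OF a] \<tau>])
    moreover from this have "X (moebius (adj22 (\<gamma> a)) \<tau>) \<in> carrier_vec m"
      "Y (moebius (adj22 (\<gamma> a)) \<tau>) \<in> carrier_vec m" using X Y by blast+
    ultimately show "block m (induced_fun k (\<lambda>\<tau>\<in>upper_half. X \<tau> + Y \<tau>) \<tau>) a =
        block m (induced_fun k X \<tau> + induced_fun k Y \<tau>) a"
      unfolding block_add[OF induced_fun_carrier induced_fun_carrier a]
        block_induced_fun[OF XY \<tau> a] block_induced_fun[OF X \<tau> a] block_induced_fun[OF Y \<tau> a]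
      by (simp add: slash_altdef smult_add_distrib_vec[of _ m])
  qed
  then show "induced_fun k (\<lambda>\<tau>\<in>upper_half. X \<tau> + Y \<tau>) \<tau> = induced_form k X \<tau> + induced_form k Y \<tau>"
    using \<tau> by simp
qed

text \<open>Invariance under the representatives lets f pass through every block; this is why the
  scalars are automorphic for G and not merely for H.\<close>

lemma induced_form_smult:
  assumes X: "X \<in> upper_half \<rightarrow> carrier_vec m"
    and inv: "\<And>A \<tau>. A \<in> G \<Longrightarrow> \<tau> \<in> upper_half \<Longrightarrow> f (moebius A \<tau>) = f \<tau>"
  shows "induced_form k (\<lambda>\<tau>\<in>upper_half. f \<tau> \<cdot>\<^sub>v X \<tau>) = (\<lambda>\<tau>\<in>upper_half. f \<tau> \<cdot>\<^sub>v induced_form k X \<tau>)"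
proof (rule restrict_ext)
  fix \<tau> assume \<tau>: "\<tau> \<in> upper_half"
  have fX: "(\<lambda>\<tau>\<in>upper_half. f \<tau> \<cdot>\<^sub>v X \<tau>) \<in> upper_half \<rightarrow> carrier_vec m" using X by auto
  have "induced_fun k (\<lambda>\<tau>\<in>upper_half. f \<tau> \<cdot>\<^sub>v X \<tau>) \<tau> = f \<tau> \<cdot>\<^sub>v induced_fun k X \<tau>"
  proof (rule block_eqI[OF induced_fun_carrier])
    show "f \<tau> \<cdot>\<^sub>v induced_fun k X \<tau> \<in> carrier_vec (d * m)" by (simp add: induced_fun_carrier)
    fix a assume a: "a < d"
    have "moebius (adj22 (\<gamma> a)) \<tau> \<in> upper_half" by (rule moebius_upper_half[OF adj_\<gamma>_carrier[OF a] \<tau>])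
    moreover have "f (moebius (adj22 (\<gamma> a)) \<tau>) = f \<tau>" by (rule inv[OF G_facts(4)[OF \<gamma>_mem[OF a]] \<tau>])
    ultimately show "block m (induced_fun k (\<lambda>\<tau>\<in>upper_half. f \<tau> \<cdot>\<^sub>v X \<tau>) \<tau>) a =
        block m (f \<tau> \<cdot>\<^sub>v induced_fun k X \<tau>) a"
      unfolding block_smult[OF induced_fun_carrier a]
        block_induced_fun[OF fX \<tau> a] block_induced_fun[OF X \<tau> a]
      by (simp add: slash_altdef smult_smult_assoc mult.commute)
  qed
  then show "induced_fun k (\<lambda>\<tau>\<in>upper_half. f \<tau> \<cdot>\<^sub>v X \<tau>) \<tau> = f \<tau> \<cdot>\<^sub>v induced_form k X \<tau>"
    using \<tau> by simp
qed

text \<open>The map and its inverse both preserve the growth class, so membership of a product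
  transfers in either direction.\<close>

lemma partial_module_iso_induced_form:
  assumes Es: "\<And>s E. s > 0 \<Longrightarrow> E \<in> Es \<Longrightarrow> s * E \<in> Es"
  shows "induced_form k \<in> partial_module_iso (automorphic_ring G)
    (vvaf_module m (H.growth_forms Es k)) (vvaf_module (d * m) (G.growth_forms Es k))"
proof -
  have Xc: "X \<in> upper_half \<rightarrow> carrier_vec m" "X \<in> upper_half \<rightarrow>\<^sub>E carrier_vec m"
    if "X \<in> H.growth_forms Es k" for X
    using H.growth_formsD(1)[OF that] by (auto simp: PiE_def)
  note bij = bij_induced_form[OF Es, where k = k]
  have "induced_form k (\<lambda>\<tau>\<in>upper_half. X \<tau> + Y \<tau>) =
      (\<lambda>\<tau>\<in>upper_half. induced_form k X \<tau> + induced_form k Y \<tau>)"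
    if "X \<in> H.growth_forms Es k" "Y \<in> H.growth_forms Es k" for X Y
    by (rule induced_form_add[OF Xc(1)[OF that(1)] Xc(1)[OF that(2)]])
  then have "induced_form k \<in> Group.iso (add_monoid (vvaf_module m (H.growth_forms Es k)))
      (add_monoid (vvaf_module (d * m) (G.growth_forms Es k)))"
    using bij bij_betw_imp_funcset[OF bij]
    by (simp add: Group.iso_def hom_def vvaf_module_def del: restrict_apply)
  moreover have "(\<lambda>\<tau>\<in>upper_half. f \<tau> \<cdot>\<^sub>v X \<tau>) \<in> H.growth_forms Es k \<longleftrightarrow>
      (\<lambda>\<tau>\<in>upper_half. f \<tau> \<cdot>\<^sub>v induced_form k X \<tau>) \<in> G.growth_forms Es k"
    and "induced_form k (\<lambda>\<tau>\<in>upper_half. f \<tau> \<cdot>\<^sub>v X \<tau>) = (\<lambda>\<tau>\<in>upper_half. f \<tau> \<cdot>\<^sub>v induced_form k X \<tau>)"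
    if f: "f \<in> automorphic_functions G" and X: "X \<in> H.growth_forms Es k" for f X
  proof -
    show eq: "induced_form k (\<lambda>\<tau>\<in>upper_half. f \<tau> \<cdot>\<^sub>v X \<tau>) = (\<lambda>\<tau>\<in>upper_half. f \<tau> \<cdot>\<^sub>v induced_form k X \<tau>)"
      by (rule induced_form_smult[OF Xc(1)[OF X] G.automorphic_functionsD(3)[OF f]])
    have "(\<lambda>\<tau>\<in>upper_half. f \<tau> \<cdot>\<^sub>v X \<tau>) \<in> upper_half \<rightarrow>\<^sub>E carrier_vec m"
      using Xc(1)[OF X] by auto
    \<comment> \<open>The two maps cancel on any vector of functions of the right size, hence also
      on a product that leaves the growth class.\<close>
    note cancel = component_induced_form[OF this, of k, unfolded eq]
    show "(\<lambda>\<tau>\<in>upper_half. f \<tau> \<cdot>\<^sub>v X \<tau>) \<in> H.growth_forms Es k \<longleftrightarrow>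
        (\<lambda>\<tau>\<in>upper_half. f \<tau> \<cdot>\<^sub>v induced_form k X \<tau>) \<in> G.growth_forms Es k"
    proof
      assume "(\<lambda>\<tau>\<in>upper_half. f \<tau> \<cdot>\<^sub>v X \<tau>) \<in> H.growth_forms Es k"
      from induced_form_mem[OF this Es] show "(\<lambda>\<tau>\<in>upper_half. f \<tau> \<cdot>\<^sub>v induced_form k X \<tau>) \<in> G.growth_forms Es k"
        unfolding eq .
    next
      assume "(\<lambda>\<tau>\<in>upper_half. f \<tau> \<cdot>\<^sub>v induced_form k X \<tau>) \<in> G.growth_forms Es k"
      from component_form_mem[OF this Es] show "(\<lambda>\<tau>\<in>upper_half. f \<tau> \<cdot>\<^sub>v X \<tau>) \<in> H.growth_forms Es k"
        unfolding cancel .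
    qed
  qed
  ultimately show ?thesis
    by (simp add: partial_module_iso_def vvaf_module_def automorphic_ring_def del: restrict_apply)
qed

lemma module_hom_induced_form:
  "induced_form k \<in> module_hom (automorphic_ring G)
    (vvaf_module m (H.growth_forms UNIV k)) (vvaf_module (d * m) (G.growth_forms UNIV k))"
proof -
  have Xc: "X \<in> upper_half \<rightarrow> carrier_vec m" if "X \<in> H.growth_forms UNIV k" for X
    using H.growth_formsD(1)[OF that] by (auto simp: PiE_def)
  have "induced_form k (\<lambda>\<tau>\<in>upper_half. X \<tau> + Y \<tau>) =
      (\<lambda>\<tau>\<in>upper_half. induced_form k X \<tau> + induced_form k Y \<tau>)"
    if "X \<in> H.growth_forms UNIV k" "Y \<in> H.growth_forms UNIV k" for X Y
    by (rule induced_form_add[OF Xc[OF that(1)] Xc[OF that(2)]])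
  moreover have "induced_form k (\<lambda>\<tau>\<in>upper_half. f \<tau> \<cdot>\<^sub>v X \<tau>) =
      (\<lambda>\<tau>\<in>upper_half. f \<tau> \<cdot>\<^sub>v induced_form k X \<tau>)"
    if "f \<in> automorphic_functions G" "X \<in> H.growth_forms UNIV k" for f X
    by (rule induced_form_smult[OF Xc[OF that(2)] G.automorphic_functionsD(3)[OF that(1)]])
  moreover have "induced_form k \<in> H.growth_forms UNIV k \<rightarrow> G.growth_forms UNIV k"
    by (intro Pi_I induced_form_mem) simp_all
  ultimately show ?thesis
    unfolding module_hom_def vvaf_module_def automorphic_ring_def by (simp del: restrict_apply)
qed

end

theorem proposition4p4:
  fixes G H :: "(real^2^2) set" and \<rho> :: rep and m d :: nat
    and \<gamma> :: "nat \<Rightarrow> real^2^2" and k :: int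
  assumes "subgroup G SL2R"
    and "subgroup H (SL2R\<lparr>carrier := G\<rparr>)"
    and "finite (lcosets\<^bsub>SL2R\<lparr>carrier := G\<rparr>\<^esub> H)"
    and "- id22 \<in> H"
    and "fuchsian_first_kind (to_PSL ` H)"
    and "fuchsian_first_kind (to_PSL ` G)"
    and "representation H m \<rho>"
    and "logarithmic_rep H \<rho> \<or> admissible_rep H \<rho>"
    and "left_transversal G H d \<gamma>"
  shows
    "(weight_compatible k \<rho> \<longrightarrow>
       (let M = vvaf_module m (weakly_hol_vvafs H m k \<rho>);
            N = vvaf_module (d * m) (weakly_hol_vvafs G (d * m) k (induced_rep H m d \<gamma> \<rho>))
        in Module.module (automorphic_ring G) M \<and> Module.module (automorphic_ring G) N \<and>
           (\<exists>\<Phi>. \<Phi> \<in> module_hom (automorphic_ring G) M N \<and>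
                bij_betw \<Phi> (carrier M) (carrier N)))) \<and>
     (weight_compatible 0 \<rho> \<longrightarrow>
       (let M = vvaf_module m (hol_vvafs H m 0 \<rho>);
            N = vvaf_module (d * m) (hol_vvafs G (d * m) 0 (induced_rep H m d \<gamma> \<rho>))
        in abelian_group M \<and> abelian_group N \<and>
           (\<exists>\<Phi>. \<Phi> \<in> partial_module_iso (automorphic_ring G) M N))) \<and>
     (weight_compatible 0 \<rho> \<longrightarrow>
       (let M = vvaf_module m (cusp_vvafs H m 0 \<rho>);
            N = vvaf_module (d * m) (cusp_vvafs G (d * m) 0 (induced_rep H m d \<gamma> \<rho>))
        in abelian_group M \<and> abelian_group N \<and>
           (\<exists>\<Phi>. \<Phi> \<in> partial_module_iso (automorphic_ring G) M N)))"
proof -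
  have unimodular: "unimodular_at_parabolics H \<rho>"
    using assms(8) by (auto simp: logarithmic_rep_def admissible_rep_def)
  interpret induction_data G H \<rho> m d \<gamma>
    by (rule induction_data.intro) (use assms unimodular in auto)
  interpret H: cuspidal_rep H m \<rho> by (rule cuspidal_rep_H)
  interpret G: cuspidal_rep G "d * m" ind_rep by (rule cuspidal_rep_G)
  have group_G: "cuspidal_group G" by (rule cuspidal_group_G)
  have "\<exists>\<Phi>. \<Phi> \<in> module_hom (automorphic_ring G) (vvaf_module m (H.growth_forms UNIV k))
        (vvaf_module (d * m) (G.growth_forms UNIV k)) \<and>
      bij_betw \<Phi> (carrier (vvaf_module m (H.growth_forms UNIV k)))
        (carrier (vvaf_module (d * m) (G.growth_forms UNIV k)))"
    using module_hom_induced_form[of k] bij_induced_form[of UNIV k]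
    by (intro exI[of _ "induced_form k"]) (simp add: vvaf_module_def)
  moreover have "Module.module (automorphic_ring G) (vvaf_module m (H.growth_forms UNIV k))"
    by (rule H.module_growth_forms[OF group_G H_subset])
  moreover have "Module.module (automorphic_ring G) (vvaf_module (d * m) (G.growth_forms UNIV k))"
    by (rule G.module_growth_forms[OF group_G subset_refl])
  \<comment> \<open>One statement for all nonempty sets of rates closed under positive scaling:
    \<open>{0}\<close> yields the holomorphic case and \<open>{0<..}\<close> the cuspidal
    one.\<close>
  moreover have "abelian_group (vvaf_module m (H.growth_forms Es 0)) \<and>
      abelian_group (vvaf_module (d * m) (G.growth_forms Es 0)) \<and>
      (\<exists>\<Phi>. \<Phi> \<in> partial_module_iso (automorphic_ring G) (vvaf_module m (H.growth_forms Es 0))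
        (vvaf_module (d * m) (G.growth_forms Es 0)))"
    if "Es \<noteq> {}" "\<And>s E. s > 0 \<Longrightarrow> E \<in> Es \<Longrightarrow> s * E \<in> Es" for Es :: "real set"
    using H.abelian_group_growth_forms[OF that(1)] G.abelian_group_growth_forms[OF that(1)]
      partial_module_iso_induced_form[OF that(2)] by blast
  from this[of "{0}"] this[of "{0<..}"]
  have "abelian_group (vvaf_module m (H.growth_forms {0} 0)) \<and>
      abelian_group (vvaf_module (d * m) (G.growth_forms {0} 0)) \<and>
      (\<exists>\<Phi>. \<Phi> \<in> partial_module_iso (automorphic_ring G) (vvaf_module m (H.growth_forms {0} 0))
        (vvaf_module (d * m) (G.growth_forms {0} 0)))"
    "abelian_group (vvaf_module m (H.growth_forms {0<..} 0)) \<and>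
      abelian_group (vvaf_module (d * m) (G.growth_forms {0<..} 0)) \<and>
      (\<exists>\<Phi>. \<Phi> \<in> partial_module_iso (automorphic_ring G) (vvaf_module m (H.growth_forms {0<..} 0))
        (vvaf_module (d * m) (G.growth_forms {0<..} 0)))"
    by auto
  ultimately show ?thesis
    unfolding Let_def H.weakly_hol_vvafs_eq G.weakly_hol_vvafs_eq H.hol_vvafs_eq G.hol_vvafs_eq
      H.cusp_vvafs_eq G.cusp_vvafs_eq by blast
qed

end
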